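(* Let $X\subset\mathbb R^{n+1}$ be a nonempty compact set and let $\sigma:X\to\mathbb S^n$ be a continuous map with $\sigma(y)\in N_yX$ for all $y\in X$. Then for every $\alpha\in(0,\pi/2)$, $$\mathcal H^n(N^\alpha X/\sigma)\ge\frac{1-C\alpha}{2}\,\mathcal H^n(\mathbb S^n),\qquad C=C(n)=\frac{2\,\mathcal H^{n-1}(\mathbb S^{n-1})}{\mathcal H^n(\mathbb S^n)}.$$ Moreover $\mathcal H^n(NX/\sigma)\ge\frac12\mathcal H^n(\mathbb S^n)$.
   Context: For $y\in\mathbb R^{n+1}$, the normal cone of $X$ at $y$ is $N_yX=\{\nu\in\mathbb S^n:\nu\cdot(x-y)\le0\text{ for all }x\in X\}$. For $\alpha\in(0,\pi/2)$, $N^\alpha_yX/\sigma=\{\nu\in N_yX:\sigma(y)\cdot\nu\ge\sin\alpha\}$, $N_yX/\sigma=\{\nu\in N_yX:\sigma(y)\cdot\nu>0\}$, $N^\alpha X/\sigma=\bigcup_{y\in X}N^\alpha_yX/\sigma$ and $NX/\sigma=\bigcup_{y\in X}N_yX/\sigma$, as subsets of $\mathbb S^n$. *)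

theory Defs
  imports "HOL-Analysis.Analysis"
begin

text \<open>Standard (normalised) s-dimensional Hausdorff measure on a metric space,
  for integer dimension s, via the Caratheodory construction with countable covers.
  The empty set contributes 0; for s = 0 this gives the counting measure.\<close>

definition hcontent :: "nat \<Rightarrow> 'a::metric_space set \<Rightarrow> real" where
  "hcontent s E = (if E = {} then 0 else unit_ball_vol (real s) / 2 ^ s * diameter E ^ s)"

definition hausdorff_pre :: "nat \<Rightarrow> real \<Rightarrow> 'a::metric_space set \<Rightarrow> ennreal" where
  "hausdorff_pre s \<delta> A =
     (INF E \<in> {E :: nat \<Rightarrow> 'a set. A \<subseteq> (\<Union>i. E i) \<and> (\<forall>i. bounded (E i) \<and> diameter (E i) \<le> \<delta>)}.
        (\<Sum>i. ennreal (hcontent s (E i))))"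

definition hausdorff_measure :: "nat \<Rightarrow> 'a::metric_space set \<Rightarrow> ennreal" where
  "hausdorff_measure s A = (SUP \<delta> \<in> {0<..}. hausdorff_pre s \<delta> A)"

definition normal_cone :: "'a::euclidean_space set \<Rightarrow> 'a \<Rightarrow> 'a set" where
  "normal_cone X y = {\<nu> \<in> sphere 0 1. \<forall>x\<in>X. \<nu> \<bullet> (x - y) \<le> 0}"

definition normal_cone_alpha :: "real \<Rightarrow> 'a::euclidean_space set \<Rightarrow> ('a \<Rightarrow> 'a) \<Rightarrow> 'a \<Rightarrow> 'a set" where
  "normal_cone_alpha \<alpha> X \<sigma> y = {\<nu> \<in> normal_cone X y. \<sigma> y \<bullet> \<nu> \<ge> sin \<alpha>}"

definition normal_cone_pos :: "'a::euclidean_space set \<Rightarrow> ('a \<Rightarrow> 'a) \<Rightarrow> 'a \<Rightarrow> 'a set" where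
  "normal_cone_pos X \<sigma> y = {\<nu> \<in> normal_cone X y. \<sigma> y \<bullet> \<nu> > 0}"

definition NA :: "real \<Rightarrow> 'a::euclidean_space set \<Rightarrow> ('a \<Rightarrow> 'a) \<Rightarrow> 'a set" where
  "NA \<alpha> X \<sigma> = (\<Union>y\<in>X. normal_cone_alpha \<alpha> X \<sigma> y)"

definition NP :: "'a::euclidean_space set \<Rightarrow> ('a \<Rightarrow> 'a) \<Rightarrow> 'a set" where
  "NP X \<sigma> = (\<Union>y\<in>X. normal_cone_pos X \<sigma> y)"

text \<open>A copy of S^{n-1} inside R^{n+1}: the equator of the unit sphere orthogonal
  to a fixed basis vector (isometric to the standard S^{n-1} in R^n).\<close>
definition equator :: "'a::euclidean_space set" where
  "equator = {x \<in> sphere 0 1. x \<bullet> (SOME b. b \<in> Basis) = 0}"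

end

theory Submission
  imports Defs
begin

text \<open>
  Up to a null set the normal cones of a finite set tile the space.  The cone at \<open>y\<close> is convex and
  contains \<open>\<sigma> y\<close>, hence it is star-shaped about \<open>\<sigma> y\<close>, and such a cone fills a cap centred at
  \<open>\<sigma> y\<close> in at least the proportion in which it fills the whole sphere.  Summing over \<open>y\<close> bounds the
  area of the union from below by that of a cap of radius \<open>\<pi>/2 - \<alpha>\<close>; an increasing sequence of
  finite subsets with dense union gives the case of a compact set, and \<open>\<alpha> \<rightarrow> 0\<close> the second claim.

  Areas on the sphere are measured by the volume of the cone they span.  This measure is compared
  with the normalised Hausdorff measure in both directions.  The isodiametric
  inequality, in the form \<open>2^N |S| \<le> |S - S|\<close> applied to thin shells, shows that it is at most the
  Hausdorff measure; this is used on the sphere and on the equator.  A Vitali covering by small caps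
  shows that on the whole sphere (or equator) it is at least the Hausdorff measure.
\<close>

subsection \<open>Fibre integrals, reflections and the volume of cylinders\<close>

text \<open>The constant comes from a one-dimensional integral. With N = n + 1, on a line parallel
  to \<open>\<sigma> y\<close> at distance r from the axis, the density |z|^(-N) becomes, after the
  substitution height = r t, a multiple of (1 + t^2)^(-N/2), the same function for all lines, and
  the cap of radius \<pi>/2 - \<alpha> becomes the half-line t \<ge> tan \<alpha>. If J is the
  integral over the whole line, the tail has a share of at least 1/2 - \<alpha>/J, because the
  function is at most 1/(1 + t^2), whose integral from 0 to tan \<alpha> is \<alpha>. As J is at
  least the quotient of the areas of S^n and S^(n-1), the share is at least (1 - C \<alpha>)/2.

  The right side of the claim is half the area of S^n minus \<alpha> times the area of S^(n-1).
  Besides lower bounds it therefore requires an upper bound for the Hausdorff measure of the sphere,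
  which is why a covering argument is unavoidable.

  In the passage to compact sets the condition with sin \<alpha> survives limits because it is
  closed; strict positivity would be lost.\<close>

lemma nn_integral_lborel_shift:
  fixes f :: "'a::euclidean_space \<Rightarrow> ennreal"
  assumes [measurable]: "f \<in> borel_measurable borel"
  shows "(\<integral>\<^sup>+z. f (c + z) \<partial>lborel) = (\<integral>\<^sup>+z. f z \<partial>lborel)"
proof -
  have "(\<integral>\<^sup>+z. f z \<partial>lborel) = (\<integral>\<^sup>+z. f z \<partial>distr lborel borel ((+) c))"
    by (simp add: lborel_distr_plus)
  also have "\<dots> = (\<integral>\<^sup>+z. f (c + z) \<partial>lborel)"
    by (subst nn_integral_distr) auto
  finally show ?thesis ..
qed

text \<open>Fubini along the lines parallel to \<open>v\<close>, without coordinates adapted to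
  \<open>v\<close>. Every such line meets the slab in a segment of length 1; this 1 is inserted
  under the integral, the order is exchanged and a translation moves the slab condition to the base
  point.\<close>

lemma nn_integral_lborel_fibers:
  fixes f :: "'a::euclidean_space \<Rightarrow> ennreal"
  assumes [measurable]: "f \<in> borel_measurable borel" and v: "norm v = 1"
  shows "(\<integral>\<^sup>+z. f z \<partial>lborel) =
    (\<integral>\<^sup>+z. indicator {z. \<bar>z \<bullet> v\<bar> \<le> 1/2} z * (\<integral>\<^sup>+s. f (z + s *\<^sub>R v) \<partial>lborel) \<partial>lborel)"
proof -
  define p :: "'a \<Rightarrow> ennreal" where "p = indicator {z. \<bar>z \<bullet> v\<bar> \<le> 1/2}"
  have [measurable]: "p \<in> borel_measurable borel"
    unfolding p_def by measurable
  have vv: "v \<bullet> v = 1"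
    using v by (simp add: dot_square_norm)
  have one: "(\<integral>\<^sup>+s. p (z - s *\<^sub>R v) \<partial>lborel) = 1" for z
  proof -
    have "p (z - s *\<^sub>R v) = indicator {z \<bullet> v - 1/2 .. z \<bullet> v + 1/2} s" for s
    proof -
      have "\<bar>z \<bullet> v - s\<bar> \<le> 1/2 \<longleftrightarrow> z \<bullet> v - 1/2 \<le> s \<and> s \<le> z \<bullet> v + 1/2"
        by arith
      then show ?thesis
        by (simp add: p_def indicator_def inner_diff_left vv)
    qed
    then show ?thesis
      by simp
  qed
  have "(\<integral>\<^sup>+z. p z * (\<integral>\<^sup>+s. f (z + s *\<^sub>R v) \<partial>lborel) \<partial>lborel)
      = (\<integral>\<^sup>+z. (\<integral>\<^sup>+s. p z * f (z + s *\<^sub>R v) \<partial>lborel) \<partial>lborel)"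
    by (intro nn_integral_cong nn_integral_cmult[symmetric]) simp
  also have "\<dots> = (\<integral>\<^sup>+s. (\<integral>\<^sup>+z. p z * f (z + s *\<^sub>R v) \<partial>lborel) \<partial>(lborel :: real measure))"
    by (rule lborel_pair.Fubini') measurable
  also have "\<dots> = (\<integral>\<^sup>+s. (\<integral>\<^sup>+z. p (z - s *\<^sub>R v) * f z \<partial>lborel) \<partial>(lborel :: real measure))"
  proof (rule nn_integral_cong)
    fix s :: real
    have "(\<integral>\<^sup>+z. p (z - s *\<^sub>R v) * f z \<partial>lborel) =
        (\<integral>\<^sup>+z. p ((s *\<^sub>R v + z) - s *\<^sub>R v) * f (s *\<^sub>R v + z) \<partial>lborel)"
      by (rule nn_integral_lborel_shift[symmetric]) simp
    then show "(\<integral>\<^sup>+z. p z * f (z + s *\<^sub>R v) \<partial>lborel) = (\<integral>\<^sup>+z. p (z - s *\<^sub>R v) * f z \<partial>lborel)"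
      by (simp add: add.commute)
  qed
  also have "\<dots> = (\<integral>\<^sup>+z. (\<integral>\<^sup>+s. p (z - s *\<^sub>R v) * f z \<partial>lborel) \<partial>lborel)"
    by (rule lborel_pair.Fubini'[symmetric]) measurable
  also have "\<dots> = (\<integral>\<^sup>+z. f z \<partial>lborel)"
    by (simp add: nn_integral_multc one)
  finally show ?thesis
    by (simp add: p_def)
qed

section \<open>Reflections in hyperplanes through the origin\<close>

definition reflect :: "'a::euclidean_space \<Rightarrow> 'a \<Rightarrow> 'a" where
  "reflect v z = z - (2 * (z \<bullet> v)) *\<^sub>R v"

lemma reflect_measurable [measurable]: "reflect v \<in> borel_measurable borel"
  unfolding reflect_def[abs_def] by measurable

text \<open>On each line parallel to \<open>v\<close> the reflection is an affine map of slope -1,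
  so no fibre integral changes. Rotation invariance of volume enters in this form.\<close>

lemma nn_integral_reflect:
  fixes f :: "'a::euclidean_space \<Rightarrow> ennreal"
  assumes [measurable]: "f \<in> borel_measurable borel" and v: "norm v = 1"
  shows "(\<integral>\<^sup>+z. f (reflect v z) \<partial>lborel) = (\<integral>\<^sup>+z. f z \<partial>lborel)"
proof -
  have vv: "v \<bullet> v = 1"
    using v by (simp add: dot_square_norm)
  have "(\<integral>\<^sup>+s. f (z + s *\<^sub>R v) \<partial>lborel) = (\<integral>\<^sup>+s. f (reflect v (z + s *\<^sub>R v)) \<partial>lborel)" for z
  proof -
    have "(\<integral>\<^sup>+s. f (z + s *\<^sub>R v) \<partial>lborel) =
        ennreal \<bar>-1\<bar> * (\<integral>\<^sup>+s. f (z + (- 2 * (z \<bullet> v) + (-1) * s) *\<^sub>R v) \<partial>lborel)"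
      by (rule nn_integral_real_affine) simp_all
    also have "\<dots> = (\<integral>\<^sup>+s. f (reflect v (z + s *\<^sub>R v)) \<partial>lborel)"
      proof -
      have "z + (- 2 * (z \<bullet> v) + (-1) * s) *\<^sub>R v = reflect v (z + s *\<^sub>R v)" for s
        by (simp add: reflect_def vv inner_add_left algebra_simps flip: scaleR_add_left)
      then show ?thesis by simp
    qed
    finally show ?thesis .
  qed
  then show ?thesis
    using nn_integral_lborel_fibers[of f v] nn_integral_lborel_fibers[of "\<lambda>z. f (reflect v z)" v] v
    by simp
qed

lemma emeasure_reflect_vimage:
  fixes A :: "'a::euclidean_space set"
  assumes [measurable]: "A \<in> sets borel" and v: "norm v = 1"
  shows "emeasure lborel (reflect v -` A) = emeasure lborel A"
proof -
  have m: "reflect v -` A \<in> sets borel"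
    using measurable_sets[OF reflect_measurable assms(1), of v] by simp
  have "(\<integral>\<^sup>+z. indicator (reflect v -` A) z \<partial>lborel) = (\<integral>\<^sup>+z. indicator A (reflect v z) \<partial>lborel)"
    by (simp add: indicator_def)
  also have "\<dots> = (\<integral>\<^sup>+z. indicator A z \<partial>lborel)"
    by (rule nn_integral_reflect) (simp_all add: v)
  finally show ?thesis
    using m by simp
qed

lemma emeasure_lborel_block:
  fixes I :: "'a::euclidean_space set"
  assumes I: "I \<subseteq> Basis" and c: "\<And>i. i \<in> I \<Longrightarrow> c i \<ge> 0" and r: "r \<ge> 0"
    and rI: "r > 0 \<or> I = Basis"
  shows "emeasure lborel {z::'a. (\<forall>i\<in>I. \<bar>z \<bullet> i\<bar> \<le> c i) \<and> (\<Sum>j\<in>Basis - I. (z \<bullet> j)\<^sup>2) \<le> r\<^sup>2} =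
    ennreal ((\<Prod>i\<in>I. 2 * c i) * (unit_ball_vol (real (card (Basis - I))) * r ^ card (Basis - I)))"
    (is "emeasure lborel ?A = _")
proof -
  interpret product_sigma_finite "\<lambda>_::'a. lborel :: real measure" ..
  have fin: "finite I" "finite (Basis - I)"
    using I by (auto intro: finite_subset[OF _ finite_Basis])
  let ?J = "Basis - I"
  let ?PI = "Pi\<^sub>M I (\<lambda>_. lborel :: real measure)" and ?PJ = "Pi\<^sub>M ?J (\<lambda>_. lborel :: real measure)"
  have IJ: "I \<union> ?J = Basis"
    using I by auto
  define g :: "('a \<Rightarrow> real) \<Rightarrow> 'a" where "g f = (\<Sum>b\<in>Basis. f b *\<^sub>R b)" for f
  have gm: "g \<in> measurable (Pi\<^sub>M Basis (\<lambda>_. lborel)) borel"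
    unfolding g_def[abs_def] by measurable
  have mm: "merge I ?J \<in> measurable (?PI \<Otimes>\<^sub>M ?PJ) (Pi\<^sub>M Basis (\<lambda>_. lborel))"
    using measurable_merge[of I ?J "\<lambda>_. lborel :: real measure"] IJ by simp
  have Am: "?A \<in> sets borel"
  proof -
    have "closed ((\<Inter>i\<in>I. {z. \<bar>z \<bullet> i\<bar> \<le> c i}) \<inter> {z. (\<Sum>j\<in>?J. (z \<bullet> j)\<^sup>2) \<le> r\<^sup>2})"
      by (intro closed_Int closed_INT ballI closed_Collect_le continuous_intros)
    moreover have "?A = (\<Inter>i\<in>I. {z. \<bar>z \<bullet> i\<bar> \<le> c i}) \<inter> {z. (\<Sum>j\<in>?J. (z \<bullet> j)\<^sup>2) \<le> r\<^sup>2}"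
      by auto
    ultimately show ?thesis by simp
  qed
  have "lborel = distr (Pi\<^sub>M Basis (\<lambda>_. lborel)) borel g"
    unfolding g_def[abs_def] by (rule lborel_eq)
  also have "Pi\<^sub>M Basis (\<lambda>_. lborel) = distr (?PI \<Otimes>\<^sub>M ?PJ) (Pi\<^sub>M Basis (\<lambda>_. lborel)) (merge I ?J)"
    using distr_merge[of I ?J] fin IJ by auto
  finally have "lborel = distr (?PI \<Otimes>\<^sub>M ?PJ) borel (g \<circ> merge I ?J)"
    by (subst (asm) distr_distr[OF gm mm]) simp
  then have "emeasure lborel ?A = emeasure (distr (?PI \<Otimes>\<^sub>M ?PJ) borel (g \<circ> merge I ?J)) ?A"
    by simp
  also have "\<dots> = emeasure (?PI \<Otimes>\<^sub>M ?PJ) ((g \<circ> merge I ?J) -` ?A \<inter> space (?PI \<Otimes>\<^sub>M ?PJ))"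
    using measurable_comp[OF mm gm] Am by (subst emeasure_distr) (auto simp: comp_def)
  also have "(g \<circ> merge I ?J) -` ?A \<inter> space (?PI \<Otimes>\<^sub>M ?PJ) =
      (Pi\<^sub>E I (\<lambda>i. {- c i .. c i})) \<times> ({f. sqrt (\<Sum>i\<in>?J. (f i)\<^sup>2) \<le> r} \<inter> space ?PJ)"
    (is "?L = ?R")
  proof -
    have gi: "g f \<bullet> b = f b" if "b \<in> Basis" for f b
      unfolding g_def using that by simp
    have "(x, y) \<in> ?L \<longleftrightarrow> (x, y) \<in> ?R" for x y
    proof -
      have 1: "(\<forall>i\<in>I. \<bar>g (merge I ?J (x, y)) \<bullet> i\<bar> \<le> c i) \<longleftrightarrow> (\<forall>i\<in>I. \<bar>x i\<bar> \<le> c i)"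
        using I by (intro ball_cong refl) (subst gi, auto simp: merge_def)
      have 2: "(\<Sum>j\<in>?J. (g (merge I ?J (x, y)) \<bullet> j)\<^sup>2) = (\<Sum>j\<in>?J. (y j)\<^sup>2)"
        by (intro sum.cong refl) (subst gi, auto simp: merge_def)
      have 3: "sqrt (\<Sum>i\<in>?J. (y i)\<^sup>2) \<le> r \<longleftrightarrow> (\<Sum>i\<in>?J. (y i)\<^sup>2) \<le> r\<^sup>2"
        using r by (intro real_sqrt_le_iff') (auto intro: sum_nonneg)
      show ?thesis
        unfolding comp_def vimage_def mem_Collect_eq Int_iff mem_Times_iff fst_conv snd_conv 1 2 3
        by (auto simp: space_pair_measure space_PiM PiE_iff abs_le_iff)
    qed
    then show ?thesis by auto
  qed
  also have "emeasure (?PI \<Otimes>\<^sub>M ?PJ) ?R = emeasure ?PI (Pi\<^sub>E I (\<lambda>i. {- c i .. c i})) *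
      emeasure ?PJ ({f. sqrt (\<Sum>i\<in>?J. (f i)\<^sup>2) \<le> r} \<inter> space ?PJ)"
  proof (rule sigma_finite_measure.emeasure_pair_measure_Times)
    show "sigma_finite_measure ?PJ"
      by (rule sigma_finite) (rule fin)
    show "Pi\<^sub>E I (\<lambda>i. {- c i .. c i}) \<in> sets ?PI"
      using fin by (intro sets_PiM_I_finite) auto
    have "{f \<in> space ?PJ. sqrt (\<Sum>i\<in>?J. (f i)\<^sup>2) \<le> r} \<in> sets ?PJ"
      by measurable
    then show "{f. sqrt (\<Sum>i\<in>?J. (f i)\<^sup>2) \<le> r} \<inter> space ?PJ \<in> sets ?PJ"
      by (simp add: Collect_conj_eq Int_commute)
  qed
  also have "emeasure ?PI (Pi\<^sub>E I (\<lambda>i. {- c i .. c i})) = ennreal (\<Prod>i\<in>I. 2 * c i)"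
    proof -
    have "emeasure ?PI (Pi\<^sub>E I (\<lambda>i. {- c i .. c i})) = (\<Prod>i\<in>I. emeasure lborel {- c i .. c i})"
      by (rule emeasure_PiM) (use fin in simp_all)
    also have "\<dots> = (\<Prod>i\<in>I. ennreal (2 * c i))"
      using c by (intro prod.cong) simp_all
    also have "\<dots> = ennreal (\<Prod>i\<in>I. 2 * c i)"
      using c by (intro prod_ennreal) simp
    finally show ?thesis .
  qed
  also have "emeasure ?PJ ({f. sqrt (\<Sum>i\<in>?J. (f i)\<^sup>2) \<le> r} \<inter> space ?PJ) =
      ennreal (unit_ball_vol (real (card ?J)) * r ^ card ?J)"
  proof (cases "r > 0")
    case True
    then show ?thesis using emeasure_cball_aux[OF fin(2)] by blast
  next
    case False
    then have "I = Basis" "r = 0" using rI r by auto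
    then show ?thesis by (simp add: space_PiM emeasure_PiM_empty unit_ball_vol_def)
  qed
  finally show ?thesis
    using c r by (simp add: ennreal_mult' prod_nonneg)
qed

lemma norm_square_split:
  assumes "J \<subseteq> Basis"
  shows "(norm z)\<^sup>2 = (\<Sum>j\<in>Basis - J. (z \<bullet> j)\<^sup>2) + (\<Sum>j\<in>J. (z \<bullet> j)\<^sup>2)"
proof -
  have "(norm z)\<^sup>2 = (\<Sum>j\<in>Basis. (z \<bullet> j)\<^sup>2)"
    by (subst power2_norm_eq_inner, subst euclidean_inner) (simp add: power2_eq_square)
  also have "\<dots> = (\<Sum>j\<in>Basis - J. (z \<bullet> j)\<^sup>2) + (\<Sum>j\<in>J. (z \<bullet> j)\<^sup>2)"
    using assms by (intro sum.subset_diff) auto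
  finally show ?thesis .
qed

text \<open>For a unit \<open>p\<close> orthogonal to \<open>I\<close>, the last left-hand side is
  the squared distance from the span of \<open>I\<close> and \<open>p\<close>. Written with norms
  and inner products alone, the set can be carried along by a reflection.\<close>

definition cylinder :: "'a::euclidean_space set \<Rightarrow> 'a \<Rightarrow> real \<Rightarrow> real \<Rightarrow> real \<Rightarrow> 'a set" where
  "cylinder I p c a r = {z. (\<forall>i\<in>I. \<bar>z \<bullet> i\<bar> \<le> c) \<and> \<bar>z \<bullet> p\<bar> \<le> a \<and>
     (norm z)\<^sup>2 - (\<Sum>i\<in>I. (z \<bullet> i)\<^sup>2) - (z \<bullet> p)\<^sup>2 \<le> r\<^sup>2}"

lemma closed_cylinder: "closed (cylinder I p c a r)"
proof -
  have "cylinder I p c a r = (\<Inter>i\<in>I. {z. \<bar>z \<bullet> i\<bar> \<le> c}) \<inter> {z. \<bar>z \<bullet> p\<bar> \<le> a} \<inter>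
      {z. (norm z)\<^sup>2 - (\<Sum>i\<in>I. (z \<bullet> i)\<^sup>2) - (z \<bullet> p)\<^sup>2 \<le> r\<^sup>2}"
    unfolding cylinder_def by auto
  also have "closed \<dots>"
    by (intro closed_Int closed_INT ballI closed_Collect_le continuous_intros)
  finally show ?thesis .
qed

text \<open>Since \<open>p\<close> and \<open>e\<close> have equal length, the reflection along
  their difference exchanges them and fixes whatever is orthogonal to both, in particular the
  directions of \<open>I\<close> in the application to cylinders.\<close>

lemma reflect_swap:
  assumes p: "norm p = 1" and e: "norm e = 1" and "p \<noteq> e"
  defines "v \<equiv> (p - e) /\<^sub>R norm (p - e)"
  shows "norm v = 1" and "reflect v z \<bullet> e = z \<bullet> p" and "norm (reflect v z) = norm z"
    and "w \<bullet> p = 0 \<Longrightarrow> w \<bullet> e = 0 \<Longrightarrow> reflect v z \<bullet> w = z \<bullet> w"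
proof -
  define N where "N = norm (p - e)"
  have N: "N > 0"
    using \<open>p \<noteq> e\<close> by (simp add: N_def)
  have pe: "p \<bullet> p = 1" "e \<bullet> e = 1"
    using p e by (simp_all add: dot_square_norm)
  have NN: "N * N = 2 - 2 * (p \<bullet> e)"
    by (simp add: N_def flip: power2_eq_square)
      (simp add: power2_norm_eq_inner inner_diff_left inner_diff_right pe inner_commute)
  have v: "v = (1 / N) *\<^sub>R (p - e)"
    by (simp add: v_def N_def divide_inverse)
  show nv: "norm v = 1"
    using N by (simp add: v flip: N_def)
  then have vv: "v \<bullet> v = 1"
    by (simp add: dot_square_norm)
  have ve: "2 * (v \<bullet> e) = - N"
    using N NN by (simp add: v inner_diff_left pe field_simps)
  have "reflect v z \<bullet> e = z \<bullet> e - (z \<bullet> v) * (2 * (v \<bullet> e))"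
    by (simp add: reflect_def inner_diff_left)
  also have "\<dots> = z \<bullet> p"
    unfolding ve using N by (simp add: v inner_diff_right)
  finally show "reflect v z \<bullet> e = z \<bullet> p" .
  have "reflect v z \<bullet> reflect v z = z \<bullet> z"
    by (simp add: reflect_def inner_diff_left inner_diff_right vv inner_commute)
  then show "norm (reflect v z) = norm z"
    by (simp add: norm_eq)
  show "reflect v z \<bullet> w = z \<bullet> w" if "w \<bullet> p = 0" "w \<bullet> e = 0"
    using that by (simp add: reflect_def v inner_diff_left inner_commute[of p] inner_commute[of e])
qed

text \<open>Some basis vector \<open>e\<close> lies outside \<open>I\<close>, for otherwise
  \<open>p\<close> would vanish. With axis \<open>e\<close> the cylinder is a block, and the
  reflection exchanging \<open>p\<close> and \<open>e\<close> reduces the general axis to this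
  one.\<close>

lemma emeasure_cylinder:
  fixes I :: "'a::euclidean_space set"
  assumes I: "I \<subseteq> Basis" and p: "norm p = 1" and pI: "\<And>i. i \<in> I \<Longrightarrow> p \<bullet> i = 0"
    and ca: "c \<ge> 0" "a \<ge> 0" and r: "r > 0 \<or> r = 0 \<and> card (Basis - I) = 1"
  shows "emeasure lborel (cylinder I p c a r) =
    ennreal ((2 * c) ^ card I * (2 * a) *
      (unit_ball_vol (real (card (Basis - I) - 1)) * r ^ (card (Basis - I) - 1)))"
proof -
  have fin: "finite I"
    using I by (rule finite_subset) simp
  have "\<exists>e\<in>Basis. e \<notin> I"
  proof (rule ccontr)
    assume "\<not> ?thesis"
    then have "p \<bullet> b = 0 \<bullet> b" if "b \<in> Basis" for b
      using pI that by auto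
    then have "p = 0"
      by (rule euclidean_eqI)
    then show False
      using p by simp
  qed
  then obtain e where e: "e \<in> Basis" "e \<notin> I" by blast
  have ne: "norm e = 1"
    using e by simp
  have eI: "i \<bullet> e = 0" if "i \<in> I" for i
    using that e I by (metis inner_not_same_Basis subsetD)
  have *: "emeasure lborel (cylinder I e c a r) =
    ennreal ((2 * c) ^ card I * (2 * a) *
      (unit_ball_vol (real (card (Basis - I) - 1)) * r ^ (card (Basis - I) - 1)))"
  proof -
    have 1: "cylinder I e c a r = {z. (\<forall>i\<in>insert e I. \<bar>z \<bullet> i\<bar> \<le> (if i = e then a else c)) \<and>
        (\<Sum>j\<in>Basis - insert e I. (z \<bullet> j)\<^sup>2) \<le> r\<^sup>2}"
    proof -
      have "(norm z)\<^sup>2 - (\<Sum>i\<in>I. (z \<bullet> i)\<^sup>2) - (z \<bullet> e)\<^sup>2 = (\<Sum>j\<in>Basis - insert e I. (z \<bullet> j)\<^sup>2)" for z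
        using norm_square_split[of "insert e I" z] fin e I by simp
      then show ?thesis
        unfolding cylinder_def using e by auto
    qed
    have 2: "card (Basis - insert e I) = card (Basis - I) - 1"
      using e I by (metis Diff_insert card_Diff_singleton DiffI)
    have 3: "r > 0 \<or> insert e I = Basis"
    proof (rule ccontr)
      assume "\<not> ?thesis"
      then have "card (Basis - I) = 1" "insert e I \<noteq> Basis" using r by auto
      then obtain x where "Basis - I = {x}" by (auto simp: card_1_singleton_iff)
      moreover have "e \<in> Basis - I" using e by simp
      ultimately have "Basis - I = {e}" by simp
      then have "insert e I = Basis" using I by (metis Diff_partition Un_insert_right sup_bot_right)
      with \<open>insert e I \<noteq> Basis\<close> show False by simp
    qed
    have 4: "(\<Prod>i\<in>insert e I. 2 * (if i = e then a else c)) = (2 * c) ^ card I * (2 * a)"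
    proof -
      have "(\<Prod>i\<in>I. 2 * (if i = e then a else c)) = (\<Prod>i\<in>I. 2 * c)"
        using e by (intro prod.cong) auto
      then show ?thesis using fin e by simp
    qed
    show ?thesis
      unfolding 1 using I e ca r 3
      by (subst emeasure_lborel_block) (auto simp: 2 4 split: if_splits)
  qed
  show ?thesis
  proof (cases "p = e")
    case True
    then show ?thesis using * by simp
  next
    case False
    define v where "v = (p - e) /\<^sub>R norm (p - e)"
    note rs = reflect_swap[OF p ne False, folded v_def]
    have "cylinder I p c a r = reflect v -` cylinder I e c a r"
    proof -
      have i: "reflect v z \<bullet> i = z \<bullet> i" if "i \<in> I" for z i
        using rs(4)[of i z] pI[OF that] eI[OF that] by (simp add: inner_commute)
      show ?thesis
        unfolding cylinder_def vimage_def by (auto simp: rs(2,3) i)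
    qed
    then show ?thesis
      using emeasure_reflect_vimage[OF borel_closed[OF closed_cylinder] rs(1)] * by metis
  qed
qed

subsection \<open>The Brunn--Minkowski inequality for difference sets\<close>

definition minkowski_sum :: "'a::real_normed_vector set \<Rightarrow> 'a set \<Rightarrow> 'a set" where
  "minkowski_sum A B = (\<Union>x\<in>A. \<Union>y\<in>B. {x + y})"

lemma minkowski_sum_commute: "minkowski_sum A B = minkowski_sum B A"
  unfolding minkowski_sum_def by (auto simp: add.commute)

lemma minkowski_sum_mono: "A \<subseteq> A' \<Longrightarrow> B \<subseteq> B' \<Longrightarrow> minkowski_sum A B \<subseteq> minkowski_sum A' B'"
  unfolding minkowski_sum_def by blast

lemma lmeasurable_minkowski_sum:
  fixes A B :: "'a::euclidean_space set"
  assumes "open A" "bounded A" "bounded B"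
  shows "minkowski_sum A B \<in> lmeasurable"
  unfolding minkowski_sum_def using assms by (intro lmeasurable_open open_sums bounded_sums) auto

section \<open>Finite families of disjoint boxes and their cuts\<close>

definition disjoint_boxes :: "'a::euclidean_space set set \<Rightarrow> bool" where
  "disjoint_boxes F \<longleftrightarrow> finite F \<and> disjoint F \<and> (\<forall>Q\<in>F. Q \<noteq> {} \<and> (\<exists>a b. Q = box a b))"

lemma disjoint_boxes_Union:
  assumes "disjoint_boxes F"
  shows "open (\<Union>F)" "bounded (\<Union>F)" "\<Union>F \<in> lmeasurable"
proof -
  have "open Q \<and> bounded Q" if "Q \<in> F" for Q
    using assms that unfolding disjoint_boxes_def by (metis bounded_box open_box)
  moreover have "finite F"
    using assms by (simp add: disjoint_boxes_def)
  ultimately show 1: "open (\<Union>F)" "bounded (\<Union>F)"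
    by (simp_all add: open_Union bounded_Union)
  then show "\<Union>F \<in> lmeasurable"
    by (rule lmeasurable_open[rotated])
qed

lemma disjoint_boxes_pos:
  assumes "disjoint_boxes F" "F \<noteq> {}"
  shows "measure lebesgue (\<Union>F) > 0"
proof -
  have "\<Union>F \<noteq> {}"
    using assms unfolding disjoint_boxes_def by blast
  then have "\<not> negligible (\<Union>F)"
    using disjoint_boxes_Union[OF assms(1)] open_not_negligible by blast
  then show ?thesis
    using disjoint_boxes_Union(3)[OF assms(1)] by (metis negligible_iff_measure measure_nonneg less_eq_real_def)
qed

text \<open>Discarding the empty set makes the number of boxes drop whenever a box misses
  \<open>H\<close>; the induction below runs on this number.\<close>

definition cut_boxes :: "'a set set \<Rightarrow> 'a set \<Rightarrow> 'a set set" where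
  "cut_boxes F H = (\<lambda>Q. Q \<inter> H) ` F - {{}}"

lemma Union_cut_boxes: "\<Union>(cut_boxes F H) = \<Union>F \<inter> H"
  unfolding cut_boxes_def by auto

lemma halfspace_box_lt:
  fixes a b :: "'a::euclidean_space"
  assumes "i \<in> Basis"
  shows "\<exists>b'. box a b \<inter> {x. x \<bullet> i < c} = box a b'"
proof
  show "box a b \<inter> {x. x \<bullet> i < c} = box a (\<Sum>j\<in>Basis. (if j = i then min (b \<bullet> j) c else b \<bullet> j) *\<^sub>R j)"
    using assms by (auto simp: mem_box split: if_splits)
qed

lemma halfspace_box_gt:
  fixes a b :: "'a::euclidean_space"
  assumes "i \<in> Basis"
  shows "\<exists>a'. box a b \<inter> {x. x \<bullet> i > c} = box a' b"
proof
  show "box a b \<inter> {x. x \<bullet> i > c} = box (\<Sum>j\<in>Basis. (if j = i then max (a \<bullet> j) c else a \<bullet> j) *\<^sub>R j) b"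
    using assms by (auto simp: mem_box split: if_splits)
qed

lemma disjoint_boxes_cut:
  assumes F: "disjoint_boxes F"
    and H: "\<And>a b. \<exists>a' b'. box a b \<inter> H = box a' b'"
  shows "disjoint_boxes (cut_boxes F H)" and "card (cut_boxes F H) \<le> card F"
    and "Q \<in> F \<Longrightarrow> Q \<inter> H = {} \<Longrightarrow> card (cut_boxes F H) < card F"
proof -
  have fin: "finite F"
    using F by (simp add: disjoint_boxes_def)
  have "disjoint (cut_boxes F H)"
    using F unfolding disjoint_boxes_def cut_boxes_def disjoint_def by fastforce
  moreover have "\<exists>a b. Q = box a b" if Q: "Q \<in> cut_boxes F H" for Q
  proof -
    obtain R where "R \<in> F" "Q = R \<inter> H"
      using Q unfolding cut_boxes_def by blast
    then show ?thesis
      using F H unfolding disjoint_boxes_def by metis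
  qed
  moreover have "finite (cut_boxes F H)" "{} \<notin> cut_boxes F H"
    using fin by (auto simp: cut_boxes_def)
  ultimately show "disjoint_boxes (cut_boxes F H)"
    by (metis disjoint_boxes_def)
  show "card (cut_boxes F H) \<le> card F"
    unfolding cut_boxes_def by (metis Diff_subset card_image_le card_mono fin finite_imageI le_trans)
  show "card (cut_boxes F H) < card F" if "Q \<in> F" "Q \<inter> H = {}"
  proof -
    have "cut_boxes F H \<subseteq> (\<lambda>Q. Q \<inter> H) ` (F - {Q})"
      using that by (auto simp: cut_boxes_def)
    then have "card (cut_boxes F H) \<le> card (F - {Q})"
      by (meson card_image_le card_mono fin finite_Diff finite_imageI le_trans)
    then show ?thesis
      using that fin by (meson card_Diff1_less le_less_trans)
  qed
qed

lemma measure_halfspaces: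
  assumes A: "A \<in> lmeasurable" and i: "i \<in> Basis"
  shows "measure lebesgue A =
    measure lebesgue (A \<inter> {x. x \<bullet> i < c}) + measure lebesgue (A \<inter> {x. x \<bullet> i > c})"
proof -
  have neg: "negligible {x. x \<bullet> i = c}"
    using i negligible_standard_hyperplane by blast
  have m: "A \<inter> {x. x \<bullet> i < c} \<in> lmeasurable" "A \<inter> {x. x \<bullet> i > c} \<in> lmeasurable"
  proof -
    have "{x. x \<bullet> i < c} \<in> sets borel" "{x. x \<bullet> i > c} \<in> sets borel"
      by measurable
    then have "{x. x \<bullet> i < c} \<in> sets lebesgue" "{x. x \<bullet> i > c} \<in> sets lebesgue"
      by (metis sets_completionI_sets sets_lborel)+
    then show "A \<inter> {x. x \<bullet> i < c} \<in> lmeasurable" "A \<inter> {x. x \<bullet> i > c} \<in> lmeasurable"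
      using A fmeasurable_Int_fmeasurable by blast+
  qed
  have "measure lebesgue ((A \<inter> {x. x \<bullet> i < c}) \<union> (A \<inter> {x. x \<bullet> i > c})) =
      measure lebesgue (A \<inter> {x. x \<bullet> i < c}) + measure lebesgue (A \<inter> {x. x \<bullet> i > c})"
  proof -
    have "(A \<inter> {x. x \<bullet> i < c}) \<inter> (A \<inter> {x. x \<bullet> i > c}) = {}" by auto
    then show ?thesis
      using measure_Un3[OF m] by simp
  qed
  moreover have "measure lebesgue A = measure lebesgue ((A \<inter> {x. x \<bullet> i < c}) \<union> (A \<inter> {x. x \<bullet> i > c}))"
    by (rule measure_negligible_symdiff[OF A negligible_subset[OF neg], symmetric]) auto
  ultimately show ?thesis by simp
qed

text \<open>Intermediate value theorem: moving the hyperplane changes the mass beyond it by at most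
  the volume of a thin slab in a bounding box, which tends to 0 with the width.\<close>

lemma measure_halfspace_attains:
  fixes A :: "'a::euclidean_space set"
  assumes A: "A \<in> lmeasurable" "bounded A" and i: "i \<in> Basis"
    and t: "0 \<le> t" "t \<le> measure lebesgue A"
  shows "\<exists>c. measure lebesgue (A \<inter> {x. x \<bullet> i > c}) = t"
proof -
  obtain u where u: "A \<subseteq> cbox (-u) u"
    using bounded_subset_cbox_symmetric[OF A(2)] by blast
  define g where "g c = measure lebesgue (A \<inter> {x. x \<bullet> i > c})" for c
  have m: "A \<inter> {x. P (x \<bullet> i)} \<in> lmeasurable" if "{x::'a. P (x \<bullet> i)} \<in> sets borel" for P
    using that A by (metis fmeasurable_Int_fmeasurable sets_completionI_sets sets_lborel)
  have mgt: "A \<inter> {x. x \<bullet> i > c} \<in> lmeasurable" for c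
    by (rule m) measurable
  have step: "g c - g c' \<le> measure lebesgue (cbox (-u) u \<inter> {x. \<bar>x \<bullet> i - e\<bar> \<le> d})"
    if "\<bar>c - e\<bar> \<le> d" "\<bar>c' - e\<bar> \<le> d" for c c' e d
  proof -
    let ?S = "cbox (-u) u \<inter> {x. \<bar>x \<bullet> i - e\<bar> \<le> d}"
    have S: "?S \<in> lmeasurable"
    proof -
      have "{x::'a. \<bar>x \<bullet> i - e\<bar> \<le> d} \<in> sets borel" by measurable
      then show ?thesis
        by (metis fmeasurable_Int_fmeasurable sets_completionI_sets sets_lborel lmeasurable_cbox)
    qed
    have "A \<inter> {x. x \<bullet> i > c} \<subseteq> (A \<inter> {x. x \<bullet> i > c'}) \<union> ?S"
      using u that by auto
    then have "g c \<le> measure lebesgue ((A \<inter> {x. x \<bullet> i > c'}) \<union> ?S)"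
      unfolding g_def using mgt S by (intro measure_mono_fmeasurable) auto
    also have "\<dots> \<le> g c' + measure lebesgue ?S"
      unfolding g_def using mgt S by (intro measure_Un_le) auto
    finally show ?thesis by simp
  qed
  have "isCont g c" for c
    unfolding continuous_at_eps_delta
  proof (intro allI impI)
    fix e :: real assume "e > 0"
    then obtain d where d: "0 < d" "measure lborel (cbox (-u) u \<inter> {x. \<bar>x \<bullet> i - c\<bar> \<le> d}) < e"
      using content_doublesplit[OF _ i] by blast
    have "measure lebesgue (cbox (-u) u \<inter> {x. \<bar>x \<bullet> i - c\<bar> \<le> d}) < e"
      using d(2) by (simp add: measure_completion)
    then have "\<forall>x'. dist x' c < d \<longrightarrow> dist (g x') (g c) < e"
    proof (intro allI impI)
      fix x' assume "dist x' c < d"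
      then have "\<bar>x' - c\<bar> \<le> d" "\<bar>c - c\<bar> \<le> d"
        using d(1) by (auto simp: dist_real_def)
      then show "dist (g x') (g c) < e"
        using step[of x' c d c] step[of c c d x'] \<open>measure lebesgue _ < e\<close>
        unfolding dist_real_def by linarith
    qed
    then show "\<exists>d>0. \<forall>x'. dist x' c < d \<longrightarrow> dist (g x') (g c) < e"
      using d(1) by blast
  qed
  then have cont: "\<forall>x. a \<le> x \<and> x \<le> b \<longrightarrow> isCont g x" for a b by blast
  have bd: "- (u \<bullet> i) \<le> x \<bullet> i \<and> x \<bullet> i \<le> u \<bullet> i" if "x \<in> A" for x
    using u that i by (force simp: mem_box)
  let ?K = "\<bar>u \<bullet> i\<bar> + 1"
  have e1: "A \<inter> {x. x \<bullet> i > ?K} = {}" and e2: "A \<inter> {x. x \<bullet> i > - ?K} = A"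
    using bd by force+
  have "g ?K \<le> t" "t \<le> g (- ?K)"
    unfolding g_def e1 e2 using t by simp_all
  then have "\<exists>x. - ?K \<le> x \<and> x \<le> ?K \<and> g x = t"
    by (intro IVT2 cont) auto
  then show ?thesis
    by (auto simp: g_def)
qed

text \<open>The inequality of arithmetic and geometric means is applied in each factor. As the two
  products agree, the product of the geometric means is their common value, and no root
  remains.\<close>

lemma prod_mean_ge:
  assumes "finite B" "\<And>b. b \<in> B \<Longrightarrow> 0 < f b" "\<And>b. b \<in> B \<Longrightarrow> 0 < g b"
    and eq: "(\<Prod>b\<in>B. f b) = (\<Prod>b\<in>B. g b)"
  shows "2 ^ card B * (\<Prod>b\<in>B. f b) \<le> (\<Prod>b\<in>B. (f b + g b :: real))"
proof -
  let ?P = "\<Prod>b\<in>B. f b"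
  have P: "?P > 0" using assms by (intro prod_pos) auto
  have "(\<Prod>b\<in>B. 2 * sqrt (f b * g b)) \<le> (\<Prod>b\<in>B. (f b + g b))"
  proof (rule prod_mono)
    fix b assume "b \<in> B"
    then show "0 \<le> 2 * sqrt (f b * g b) \<and> 2 * sqrt (f b * g b) \<le> f b + g b"
      using arith_geo_mean_sqrt[of "f b" "g b"] assms(2,3)[of b] by simp
  qed
  moreover have "(\<Prod>b\<in>B. 2 * sqrt (f b * g b)) = 2 ^ card B * ?P"
  proof -
    have "(\<Prod>b\<in>B. sqrt (f b * g b)) = sqrt (?P * ?P)"
    proof (rule real_sqrt_unique[symmetric])
      have "(\<Prod>b\<in>B. sqrt (f b * g b))\<^sup>2 = (\<Prod>b\<in>B. f b * g b)"
        unfolding prod_power_distrib using assms(2,3)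
        by (simp add: less_imp_le)
      then show "(\<Prod>b\<in>B. sqrt (f b * g b))\<^sup>2 = ?P * ?P"
        by (simp add: prod.distrib eq)
      show "0 \<le> (\<Prod>b\<in>B. sqrt (f b * g b))"
        using assms(2,3) by (intro prod_nonneg) (simp add: less_imp_le)
    qed
    then show ?thesis
      using P by (simp add: prod.distrib)
  qed
  ultimately show ?thesis by simp
qed

lemma measure_minkowski_sum_box:
  fixes a b c d :: "'a::euclidean_space"
  assumes ne: "box a b \<noteq> {}" "box c d \<noteq> {}"
    and eq: "measure lebesgue (box a b) = measure lebesgue (box c d)"
  shows "2 ^ DIM('a) * measure lebesgue (box a b) \<le> measure lebesgue (minkowski_sum (box a b) (box c d))"
proof -
  have ab: "a \<bullet> i < b \<bullet> i" "c \<bullet> i < d \<bullet> i" if "i \<in> Basis" for i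
    using ne that by (auto simp: box_ne_empty)
  have m: "measure lebesgue (box u v) = (\<Prod>i\<in>Basis. (v - u) \<bullet> i)"
    if "\<And>i. i \<in> Basis \<Longrightarrow> u \<bullet> i < v \<bullet> i" for u v :: 'a
    using that by (simp add: measure_completion measure_lborel_box_eq less_imp_le)
  have "2 ^ DIM('a) * measure lebesgue (box a b) \<le> (\<Prod>i\<in>Basis. (b - a) \<bullet> i + (d - c) \<bullet> i)"
  proof -
    have "0 < (b - a) \<bullet> i" "0 < (d - c) \<bullet> i" if "i \<in> Basis" for i
      using ab[OF that] by (simp_all add: inner_diff_left)
    moreover have "(\<Prod>i\<in>Basis. (b - a) \<bullet> i) = (\<Prod>i\<in>Basis. (d - c) \<bullet> i)"
      using eq m[OF ab(1)] m[OF ab(2)] by simp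
    ultimately show ?thesis
      using prod_mean_ge[of Basis "\<lambda>i. (b - a) \<bullet> i" "\<lambda>i. (d - c) \<bullet> i"] m[OF ab(1)] by simp
  qed
  also have "\<dots> = measure lebesgue (box (a + c) (b + d))"
    using ab by (subst m) (auto simp: inner_diff_left inner_add_left add_strict_mono algebra_simps)
  also have "box (a + c) (b + d) \<subseteq> minkowski_sum (box a b) (box c d)"
  proof
    fix z assume z: "z \<in> box (a + c) (b + d)"
    \<comment> \<open>Both summands are given the relative position of \<open>z\<close> in the sum
      box, coordinate by coordinate.\<close>
    define t where "t i = (z \<bullet> i - (a + c) \<bullet> i) / ((b + d) \<bullet> i - (a + c) \<bullet> i)" for i
    have t: "0 < t i" "t i < 1" if "i \<in> Basis" for i
    proof -
      have "0 < z \<bullet> i - (a + c) \<bullet> i" "z \<bullet> i - (a + c) \<bullet> i < (b + d) \<bullet> i - (a + c) \<bullet> i"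
        using z that by (auto simp: mem_box)
      then show "0 < t i" "t i < 1" by (auto simp: t_def)
    qed
    define x where "x = (\<Sum>i\<in>Basis. (a \<bullet> i + t i * (b \<bullet> i - a \<bullet> i)) *\<^sub>R i)"
    have xi: "x \<bullet> i = a \<bullet> i + t i * (b \<bullet> i - a \<bullet> i)" if "i \<in> Basis" for i
      using that by (simp add: x_def)
    have lt: "0 < t i * s" "t i * s < s" if "i \<in> Basis" "s > 0" for i s
      using t[OF that(1)] that(2) by simp_all
    have "x \<in> box a b"
      unfolding mem_box using xi lt ab by (smt (verit, ccfv_SIG))
    moreover have "z - x \<in> box c d"
    proof -
      have "(z - x) \<bullet> i = c \<bullet> i + t i * (d \<bullet> i - c \<bullet> i)" if i: "i \<in> Basis" for i
      proof -
        have "(b + d) \<bullet> i - (a + c) \<bullet> i > 0"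
          using ab[OF i] by (simp add: inner_add_left)
        then have "z \<bullet> i = (a + c) \<bullet> i + t i * ((b + d) \<bullet> i - (a + c) \<bullet> i)"
          by (simp add: t_def)
        then show ?thesis
          by (simp add: inner_diff_left xi[OF i] inner_add_left algebra_simps)
      qed
      then show ?thesis
        unfolding mem_box using lt ab by (smt (verit, ccfv_SIG))
    qed
    ultimately show "z \<in> minkowski_sum (box a b) (box c d)"
      unfolding minkowski_sum_def by force
  qed
  then have "measure lebesgue (box (a + c) (b + d)) \<le> measure lebesgue (minkowski_sum (box a b) (box c d))"
    by (intro measure_mono_fmeasurable lmeasurable_minkowski_sum) auto
  finally show ?thesis .
qed

text \<open>The cutting argument of Hadwiger and Ohmann.  Cutting \<open>\<Union>G\<close> parallel to \<open>\<Union>F\<close> in the same ratio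
  preserves the equality of volumes, so that no \<open>N\<close>-th roots are needed.\<close>

lemma measure_minkowski_sum_boxes_step:
  fixes F G :: "'a::euclidean_space set set"
  assumes F: "disjoint_boxes F" and G: "disjoint_boxes G"
    and eq: "measure lebesgue (\<Union>F) = measure lebesgue (\<Union>G)"
    and Q: "Q1 \<in> F" "Q2 \<in> F" "Q1 \<noteq> Q2"
    and IH: "\<And>F' G' :: 'a set set. card F' + card G' < card F + card G \<Longrightarrow> disjoint_boxes F' \<Longrightarrow> disjoint_boxes G' \<Longrightarrow>
      F' \<noteq> {} \<Longrightarrow> measure lebesgue (\<Union>F') = measure lebesgue (\<Union>G') \<Longrightarrow>
      2 ^ DIM('a) * measure lebesgue (\<Union>F') \<le> measure lebesgue (minkowski_sum (\<Union>F') (\<Union>G'))"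
  shows "2 ^ DIM('a) * measure lebesgue (\<Union>F) \<le> measure lebesgue (minkowski_sum (\<Union>F) (\<Union>G))"
proof -
  \<comment> \<open>Two disjoint boxes are separated by a coordinate hyperplane, so each side of the
    cut misses a box of \<open>F\<close>.\<close>
  have "\<exists>i c P R. i \<in> Basis \<and> P \<in> F \<and> R \<in> F \<and> P \<subseteq> {x. x \<bullet> i < c} \<and> R \<subseteq> {x. x \<bullet> i > c}"
  proof -
    obtain a b c d where Qb: "Q1 = box a b" "Q2 = box c d"
      using F Q unfolding disjoint_boxes_def by metis
    have "Q1 \<inter> Q2 = {}" "Q1 \<noteq> {}" "Q2 \<noteq> {}"
      using F Q unfolding disjoint_boxes_def disjoint_def by auto
    then obtain i where i: "i \<in> Basis" "b \<bullet> i \<le> c \<bullet> i \<or> d \<bullet> i \<le> a \<bullet> i"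
      unfolding Qb disjoint_interval(4) box_ne_empty by (meson not_less)
    then have "Q1 \<subseteq> {x. x \<bullet> i < c \<bullet> i} \<and> Q2 \<subseteq> {x. x \<bullet> i > c \<bullet> i} \<or>
        Q2 \<subseteq> {x. x \<bullet> i < a \<bullet> i} \<and> Q1 \<subseteq> {x. x \<bullet> i > a \<bullet> i}"
      unfolding Qb by (force simp: mem_box)
    then show ?thesis using Q i(1) by blast
  qed
  then obtain i c P R where i: "i \<in> Basis" and PR: "P \<in> F" "R \<in> F"
      "P \<subseteq> {x. x \<bullet> i < c}" "R \<subseteq> {x. x \<bullet> i > c}"
    by blast
  note FU = disjoint_boxes_Union[OF F] and GU = disjoint_boxes_Union[OF G]
  obtain c' where c': "measure lebesgue (\<Union>G \<inter> {x. x \<bullet> i > c'}) = measure lebesgue (\<Union>F \<inter> {x. x \<bullet> i > c})"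
    using measure_halfspace_attains[OF GU(3,2) i, of "measure lebesgue (\<Union>F \<inter> {x. x \<bullet> i > c})"]
      measure_halfspaces[OF FU(3) i, of c] eq
    by auto
  then have c'': "measure lebesgue (\<Union>G \<inter> {x. x \<bullet> i < c'}) = measure lebesgue (\<Union>F \<inter> {x. x \<bullet> i < c})"
    using measure_halfspaces[OF FU(3) i, of c] measure_halfspaces[OF GU(3) i, of c'] eq by simp
  have Hlt: "\<exists>a' b'. box a b \<inter> {x. x \<bullet> i < c} = box a' b'" for a b c
    using halfspace_box_lt[OF i] by blast
  have Hgt: "\<exists>a' b'. box a b \<inter> {x. x \<bullet> i > c} = box a' b'" for a b c
    using halfspace_box_gt[OF i] by blast
  have ne: "P \<noteq> {}" "R \<noteq> {}"
    using F PR unfolding disjoint_boxes_def by auto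
  let ?F1 = "cut_boxes F {x. x \<bullet> i < c}" and ?F2 = "cut_boxes F {x. x \<bullet> i > c}"
  let ?G1 = "cut_boxes G {x. x \<bullet> i < c'}" and ?G2 = "cut_boxes G {x. x \<bullet> i > c'}"
  \<comment> \<open>The position \<open>c'\<close> is dictated by the volumes and need not separate
    boxes of \<open>G\<close>, whose number may stay the same; the strict drop for \<open>F\<close>
    drives the induction.\<close>
  have cards: "card ?F1 < card F" "card ?F2 < card F" "card ?G1 \<le> card G" "card ?G2 \<le> card G"
    using disjoint_boxes_cut(3)[OF F Hlt, of R c] disjoint_boxes_cut(3)[OF F Hgt, of P c]
      disjoint_boxes_cut(2)[OF G Hlt] disjoint_boxes_cut(2)[OF G Hgt] PR
    by fastforce+
  have "P \<in> ?F1" "R \<in> ?F2"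
    unfolding cut_boxes_def using PR ne by blast+
  then have F12: "?F1 \<noteq> {}" "?F2 \<noteq> {}" by auto
  have 1: "2 ^ DIM('a) * measure lebesgue (\<Union>?F1) \<le> measure lebesgue (minkowski_sum (\<Union>?F1) (\<Union>?G1))"
    using cards(1,3) F12(1) c''
    by (intro IH disjoint_boxes_cut(1)[OF F Hlt] disjoint_boxes_cut(1)[OF G Hlt]) (simp_all add: Union_cut_boxes)
  have 2: "2 ^ DIM('a) * measure lebesgue (\<Union>?F2) \<le> measure lebesgue (minkowski_sum (\<Union>?F2) (\<Union>?G2))"
    using cards(2,4) F12(2) c'
    by (intro IH disjoint_boxes_cut(1)[OF F Hgt] disjoint_boxes_cut(1)[OF G Hgt]) (simp_all add: Union_cut_boxes)
  let ?M1 = "minkowski_sum (\<Union>?F1) (\<Union>?G1)" and ?M2 = "minkowski_sum (\<Union>?F2) (\<Union>?G2)"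
  have m: "?M1 \<in> lmeasurable" "?M2 \<in> lmeasurable"
    using disjoint_boxes_Union[OF disjoint_boxes_cut(1)[OF F Hlt]] disjoint_boxes_Union[OF disjoint_boxes_cut(1)[OF G Hlt]]
      disjoint_boxes_Union[OF disjoint_boxes_cut(1)[OF F Hgt]] disjoint_boxes_Union[OF disjoint_boxes_cut(1)[OF G Hgt]]
    by (intro lmeasurable_minkowski_sum; blast)+
  \<comment> \<open>The hyperplane at height \<open>c + c'\<close> separates the two sums, so their
    volumes add.\<close>
  have "?M1 \<inter> ?M2 = {}"
  proof -
    have "z \<bullet> i < c + c'" if "z \<in> ?M1" for z
      using that unfolding Union_cut_boxes minkowski_sum_def by (force simp: inner_add_left)
    moreover have "z \<bullet> i > c + c'" if "z \<in> ?M2" for z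
      using that unfolding Union_cut_boxes minkowski_sum_def by (force simp: inner_add_left)
    ultimately show ?thesis by fastforce
  qed
  then have "measure lebesgue ?M1 + measure lebesgue ?M2 = measure lebesgue (?M1 \<union> ?M2)"
    using m by (simp add: measure_Un3)
  also have "\<dots> \<le> measure lebesgue (minkowski_sum (\<Union>F) (\<Union>G))"
  proof (rule measure_mono_fmeasurable)
    show "?M1 \<union> ?M2 \<subseteq> minkowski_sum (\<Union>F) (\<Union>G)"
      unfolding Union_cut_boxes by (intro Un_least minkowski_sum_mono) auto
    show "?M1 \<union> ?M2 \<in> sets lebesgue"
      using m by blast
    show "minkowski_sum (\<Union>F) (\<Union>G) \<in> lmeasurable"
      using FU GU by (intro lmeasurable_minkowski_sum)
  qed
  finally show ?thesis
    using 1 2 measure_halfspaces[OF FU(3) i, of c] by (simp add: Union_cut_boxes distrib_left)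
qed

text \<open>Since the sum is commutative, whichever family has two boxes can be the one that is cut
  first; the induction ends with one box on each side.\<close>

lemma measure_minkowski_sum_boxes:
  fixes F G :: "'a::euclidean_space set set"
  assumes "disjoint_boxes F" "disjoint_boxes G" "F \<noteq> {}"
    and "measure lebesgue (\<Union>F) = measure lebesgue (\<Union>G)"
  shows "2 ^ DIM('a) * measure lebesgue (\<Union>F) \<le> measure lebesgue (minkowski_sum (\<Union>F) (\<Union>G))"
  using assms
proof (induction "card F + card G" arbitrary: F G rule: less_induct)
  case less
  have G0: "G \<noteq> {}"
    using disjoint_boxes_pos[OF less.prems(1,3)] less.prems(4) by auto
  have fin: "finite F" "finite G"
    using less.prems by (auto simp: disjoint_boxes_def)
  consider "\<exists>Q1 Q2. Q1 \<in> F \<and> Q2 \<in> F \<and> Q1 \<noteq> Q2" | "\<exists>Q1 Q2. Q1 \<in> G \<and> Q2 \<in> G \<and> Q1 \<noteq> Q2"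
    | "\<exists>P Q. F = {P} \<and> G = {Q}"
    using G0 less.prems(3) by blast
  then show ?case
  proof cases
    case 1
    then show ?thesis
      using measure_minkowski_sum_boxes_step[OF less.prems(1,2,4)] less.hyps by blast
  next
    case 2
    then obtain Q1 Q2 where Q: "Q1 \<in> G" "Q2 \<in> G" "Q1 \<noteq> Q2" by blast
    have "2 ^ DIM('a) * measure lebesgue (\<Union>G) \<le> measure lebesgue (minkowski_sum (\<Union>G) (\<Union>F))"
    proof (rule measure_minkowski_sum_boxes_step[OF less.prems(2,1) less.prems(4)[symmetric] Q])
      fix F' G' :: "'a set set"
      assume *: "card F' + card G' < card G + card F" "disjoint_boxes F'" "disjoint_boxes G'"
        "F' \<noteq> {}" "measure lebesgue (\<Union>F') = measure lebesgue (\<Union>G')"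
      then show "2 ^ DIM('a) * measure lebesgue (\<Union>F') \<le> measure lebesgue (minkowski_sum (\<Union>F') (\<Union>G'))"
        by (intro less.hyps) auto
    qed
    then show ?thesis
      using less.prems(4) by (simp add: minkowski_sum_commute)
  next
    case 3
    then obtain P Q where PQ: "F = {P}" "G = {Q}" by blast
    then obtain a b c d where "P = box a b" "Q = box c d" "box a b \<noteq> {}" "box c d \<noteq> {}"
      using less.prems(1,2) unfolding disjoint_boxes_def by (metis singletonI)
    then show ?thesis
      using measure_minkowski_sum_box[of a b c d] less.prems(4) PQ by simp
  qed
qed

section \<open>From boxes to open and compact sets\<close>

lemma open_inner_boxes:
  fixes U :: "'a::euclidean_space set"
  assumes U: "open U" "bounded U" and e: "e > 0"
  obtains F where "disjoint_boxes F" "\<Union>F \<subseteq> U" "measure lebesgue U - e < measure lebesgue (\<Union>F)"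
proof -
  obtain \<D> where D: "countable \<D>" "\<D> \<subseteq> Pow U" "\<And>X. X \<in> \<D> \<Longrightarrow> \<exists>a b. X = cbox a b" "\<Union>\<D> = U"
    using open_countable_Union_open_cbox[OF U(1)] by metis
  have Um: "U \<in> lmeasurable"
    using U by (rule lmeasurable_open[rotated])
  obtain \<D>' where D': "\<D>' \<subseteq> \<D>" "finite \<D>'" "measure lebesgue (\<Union>\<D>) - e < measure lebesgue (\<Union>\<D>')"
  proof (rule measure_countable_Union_approachable[OF D(1) e, of "measure lebesgue U"])
    show "d \<in> lmeasurable" if "d \<in> \<D>" for d
      using D(3)[OF that] by auto
    show "measure lebesgue (\<Union>D') \<le> measure lebesgue U" if "D' \<subseteq> \<D>" "finite D'" for D'
    proof (rule measure_mono_fmeasurable[OF _ _ Um])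
      show "\<Union>D' \<subseteq> U" using that D(4) by blast
      show "\<Union>D' \<in> sets lebesgue"
        using that D(3) by (intro sets.finite_Union) (metis fmeasurableD lmeasurable_cbox subset_iff)+
    qed
  qed
  \<comment> \<open>The chosen boxes may overlap. A division of their union has non-overlapping
    members, and passing to interiors loses only their frontiers, which are null.\<close>
  obtain p where p: "p division_of (\<Union>\<D>')"
    using elementary_unions_intervals[OF D'(2)] D(3) D'(1) by blast
  define F where "F = interior ` p - {{}}"
  have F: "disjoint_boxes F"
    unfolding disjoint_boxes_def
  proof (intro conjI ballI)
    show "finite F" using division_ofD(1)[OF p] by (simp add: F_def)
    show "disjoint F"
      using division_ofD(5)[OF p] unfolding F_def disjoint_def by blast
    fix Q assume "Q \<in> F"
    then show "Q \<noteq> {}" by (simp add: F_def)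
    show "\<exists>a b. Q = box a b"
      using \<open>Q \<in> F\<close> division_ofD(4)[OF p] by (metis DiffD1 F_def imageE interior_cbox)
  qed
  have sub: "\<Union>F \<subseteq> \<Union>\<D>'"
    using division_ofD(2,6)[OF p] interior_subset unfolding F_def by blast
  have "negligible (\<Union>(frontier ` p))"
  proof (intro negligible_Union)
    show "finite (frontier ` p)"
      using division_ofD(1)[OF p] by simp
    fix T assume "T \<in> frontier ` p"
    then show "negligible T"
      using division_ofD(4)[OF p] by (metis imageE convex_box(1) negligible_convex_frontier)
  qed
  moreover have "\<Union>\<D>' - \<Union>F \<subseteq> \<Union>(frontier ` p)"
  proof
    fix x assume x: "x \<in> \<Union>\<D>' - \<Union>F"
    then obtain K where K: "K \<in> p" "x \<in> K" using division_ofD(6)[OF p] by blast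
    then have "x \<notin> interior K" using x by (auto simp: F_def)
    then show "x \<in> \<Union>(frontier ` p)"
      using K closure_subset[of K] unfolding frontier_def by blast
  qed
  ultimately have "negligible ((\<Union>\<D>' - \<Union>F) \<union> (\<Union>F - \<Union>\<D>'))"
    using sub by (metis Diff_eq_empty_iff Un_empty_right negligible_subset)
  then have "measure lebesgue (\<Union>\<D>') = measure lebesgue (\<Union>F)"
    using disjoint_boxes_Union(3)[OF F] by (metis measure_negligible_symdiff sup_commute)
  then have "measure lebesgue U - e < measure lebesgue (\<Union>F)"
    using D'(3) D(4) by simp
  moreover have "\<Union>F \<subseteq> U"
    using sub D'(1) D(4) by blast
  ultimately show ?thesis
    using that F by blast
qed

lemma disjoint_boxes_uminus:
  assumes "disjoint_boxes F"
  shows "disjoint_boxes ((`) uminus ` F)"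
    and "measure lebesgue (\<Union>((`) uminus ` F)) = measure lebesgue (\<Union>F)"
proof -
  show 1: "disjoint_boxes ((`) uminus ` F)"
    unfolding disjoint_boxes_def
  proof (intro conjI ballI)
    show "finite ((`) uminus ` F)" using assms by (simp add: disjoint_boxes_def)
    show "disjoint ((`) uminus ` F)"
      using assms by (intro disjoint_image) (auto simp: disjoint_boxes_def inj_on_def)
    fix Q assume "Q \<in> (`) uminus ` F"
    then obtain R where R: "R \<in> F" "Q = uminus ` R"
      by auto
    then have "R \<noteq> {}" "\<exists>a b. R = box a b"
      using assms by (auto simp: disjoint_boxes_def)
    then obtain a b where Q: "Q = uminus ` box a b" "box a b \<noteq> {}"
      using R by auto
    then show "Q \<noteq> {}" by simp
    have "uminus ` box a b = box (-b) (-a)"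
    proof (intro set_eqI iffI)
      fix x assume "x \<in> box (-b) (-a)"
      have "- x \<in> box a b"
        unfolding mem_box
      proof
        fix i :: 'a assume "i \<in> Basis"
        then have "(- b) \<bullet> i < x \<bullet> i" "x \<bullet> i < (- a) \<bullet> i"
          using \<open>x \<in> box (-b) (-a)\<close> by (auto simp: mem_box)
        then show "a \<bullet> i < (- x) \<bullet> i \<and> (- x) \<bullet> i < b \<bullet> i"
          unfolding inner_minus_left by linarith
      qed
      then show "x \<in> uminus ` box a b" by (metis image_eqI minus_minus)
    qed (auto simp: mem_box)
    then show "\<exists>a b. Q = box a b" using Q by blast
  qed
  have b: "\<Union>F \<in> sets borel" "\<Union>((`) uminus ` F) \<in> sets borel"
    using disjoint_boxes_Union(1)[OF assms] disjoint_boxes_Union(1)[OF 1] by auto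
  have "distr lborel borel (uminus :: 'a \<Rightarrow> 'a) = lborel"
    using lborel_affine[of "-1" "0 :: 'a"] by (simp add: density_1)
  then have "measure lborel (\<Union>((`) uminus ` F)) = measure (distr lborel borel uminus) (\<Union>((`) uminus ` F))"
    by simp
  also have "\<dots> = measure lborel (uminus -` \<Union>((`) uminus ` F) \<inter> space lborel)"
    by (rule measure_distr) (use b(2) in \<open>simp_all\<close>)
  also have "uminus -` \<Union>((`) uminus ` F) \<inter> space lborel = \<Union>F"
  proof -
    have "x \<in> uminus ` A \<longleftrightarrow> - x \<in> A" for x :: 'a and A
      by (metis image_iff minus_minus)
    then show ?thesis by auto
  qed
  finally show "measure lebesgue (\<Union>((`) uminus ` F)) = measure lebesgue (\<Union>F)"
    using b by (simp add: measure_completion)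
qed

text \<open>A set and its point reflection have equal volume, which is the hypothesis that the
  cutting argument requires.\<close>

lemma measure_differences_open:
  fixes U :: "'a::euclidean_space set"
  assumes U: "open U" "bounded U"
  shows "2 ^ DIM('a) * measure lebesgue U \<le> measure lebesgue (minkowski_sum U (uminus ` U))"
proof (rule field_le_epsilon)
  fix e :: real assume e: "e > 0"
  then obtain F where F: "disjoint_boxes F" "\<Union>F \<subseteq> U"
      "measure lebesgue U - e / 2 ^ DIM('a) < measure lebesgue (\<Union>F)"
    using open_inner_boxes[OF U, of "e / 2 ^ DIM('a)"] by auto
  have UM: "minkowski_sum U (uminus ` U) \<in> lmeasurable"
    using U by (intro lmeasurable_minkowski_sum) (auto simp: bounded_uminus)
  have "2 ^ DIM('a) * measure lebesgue (\<Union>F) \<le> measure lebesgue (minkowski_sum U (uminus ` U))"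
  proof (cases "F = {}")
    case False
    have "2 ^ DIM('a) * measure lebesgue (\<Union>F) \<le> measure lebesgue (minkowski_sum (\<Union>F) (\<Union>((`) uminus ` F)))"
      using disjoint_boxes_uminus[OF F(1)] by (intro measure_minkowski_sum_boxes F(1) False) auto
    also have "\<dots> \<le> measure lebesgue (minkowski_sum U (uminus ` U))"
    proof (rule measure_mono_fmeasurable[OF minkowski_sum_mono _ UM])
      show "minkowski_sum (\<Union>F) (\<Union>((`) uminus ` F)) \<in> sets lebesgue"
        using disjoint_boxes_Union[OF F(1)] disjoint_boxes_Union[OF disjoint_boxes_uminus(1)[OF F(1)]]
        by (intro fmeasurableD lmeasurable_minkowski_sum)
    qed (use F(2) in auto)
    finally show ?thesis .
  qed simp
  moreover have "2 ^ DIM('a) * measure lebesgue U < 2 ^ DIM('a) * measure lebesgue (\<Union>F) + e"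
    using F(3) by (simp add: field_simps)
  ultimately show "2 ^ DIM('a) * measure lebesgue U \<le> measure lebesgue (minkowski_sum U (uminus ` U)) + e"
    by linarith
qed

text \<open>\<open>D\<close> only has to contain the differences and may thus be a cylinder of known
  volume. An open neighbourhood of \<open>D\<close> with little more volume still contains the
  differences of a small neighbourhood of \<open>S\<close>, to which the open case applies.\<close>

lemma measure_differences_compact:
  fixes S D :: "'a::euclidean_space set"
  assumes S: "compact S" and D: "compact D" and sub: "\<And>x y. x \<in> S \<Longrightarrow> y \<in> S \<Longrightarrow> x - y \<in> D"
  shows "2 ^ DIM('a) * measure lebesgue S \<le> measure lebesgue D"
proof (rule field_le_epsilon)
  fix e :: real assume e: "e > 0"
  have Dm: "D \<in> lmeasurable"
    using D by (rule lmeasurable_compact)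
  obtain W where W: "open W" "D \<subseteq> W" "W - D \<in> lmeasurable" "emeasure lebesgue (W - D) < ennreal e"
    using sets_lebesgue_outer_open[OF _ e] Dm by blast
  have Wm: "W \<in> lmeasurable"
    using W Dm by (metis fmeasurable.Un Un_Diff_cancel Un_absorb1)
  have Wle: "measure lebesgue W \<le> measure lebesgue D + e"
  proof -
    have "measure lebesgue (W - D) \<le> e"
      using W(3,4) e by (simp add: emeasure_eq_measure2 ennreal_less_iff less_imp_le)
    then show ?thesis
      using measurable_measure_Diff[OF Wm _ W(2)] Dm by simp
  qed
  obtain \<epsilon> where \<epsilon>: "\<epsilon> > 0" "(\<Union>x\<in>D. ball x \<epsilon>) \<subseteq> W"
    using compact_subset_open_imp_ball_epsilon_subset[OF D W(1,2)] by blast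
  \<comment> \<open>Half of \<epsilon>, because a difference of two points of \<open>U\<close>
    carries two errors.\<close>
  define U where "U = (\<Union>x\<in>S. \<Union>y\<in>ball 0 (\<epsilon>/2). {x + y})"
  have U: "open U" "bounded U"
    unfolding U_def using S by (auto intro!: open_sums bounded_sums intro: compact_imp_bounded simp del: UN_simps)
  have SU: "S \<subseteq> U"
    unfolding U_def using \<epsilon>(1) by force
  have "minkowski_sum U (uminus ` U) \<subseteq> W"
  proof
    fix z assume "z \<in> minkowski_sum U (uminus ` U)"
    then obtain x y u v where z: "z = (x + u) - (y + v)" "x \<in> S" "y \<in> S" "norm u < \<epsilon>/2" "norm v < \<epsilon>/2"
      unfolding minkowski_sum_def U_def by auto
    have "norm (u - v) < \<epsilon>"
      using norm_triangle_ineq4[of u v] z by linarith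
    moreover have "z - (x - y) = u - v" using z by simp
    ultimately have "z \<in> ball (x - y) \<epsilon>"
      by (metis dist_commute dist_norm mem_ball)
    then show "z \<in> W" using \<epsilon>(2) sub z by blast
  qed
  then have "measure lebesgue (minkowski_sum U (uminus ` U)) \<le> measure lebesgue W"
    using U Wm by (intro measure_mono_fmeasurable fmeasurableD[OF lmeasurable_minkowski_sum]) (auto simp: bounded_uminus)
  moreover have "measure lebesgue S \<le> measure lebesgue U"
    using SU lmeasurable_open[OF U(2,1)] lmeasurable_compact[OF S] by (intro measure_mono_fmeasurable) auto
  ultimately show "2 ^ DIM('a) * measure lebesgue S \<le> measure lebesgue D + e"
    using measure_differences_open[OF U] Wle
    by (smt (verit, best) mult_left_mono zero_le_power)
qed

subsection \<open>Cone measure on subspheres\<close>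

definition proj :: "'a::euclidean_space set \<Rightarrow> 'a \<Rightarrow> 'a" where
  "proj I z = z - (\<Sum>i\<in>I. (z \<bullet> i) *\<^sub>R i)"

definition subsphere :: "'a::euclidean_space set \<Rightarrow> 'a set" where
  "subsphere I = {x. norm x = 1 \<and> (\<forall>i\<in>I. x \<bullet> i = 0)}"

text \<open>For \<open>I \<subseteq> Basis\<close> this is the codimension of the span of
  \<open>I\<close>, hence the dimension of the space containing \<open>subsphere I\<close>. The
  subsphere itself has dimension \<open>codim I - 1\<close>.\<close>

definition codim :: "'a::euclidean_space set \<Rightarrow> nat" where
  "codim I = card (Basis - I)"

text \<open>As \<open>sgn 0 = 0\<close>, points with zero projection are left out whenever
  \<open>A\<close> lies on the sphere; they form a null set if \<open>I\<close> is a proper subset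
  of the basis.\<close>

definition sector :: "'a::euclidean_space set \<Rightarrow> 'a set \<Rightarrow> real \<Rightarrow> 'a set" where
  "sector I A t = {z. sgn (proj I z) \<in> A \<and> norm (proj I z) \<le> t \<and> (\<forall>i\<in>I. \<bar>z \<bullet> i\<bar> \<le> 1)}"

lemma closed_subsphere: "closed (subsphere I)"
proof -
  have "subsphere I = sphere 0 1 \<inter> (\<Inter>i\<in>I. {x. x \<bullet> i = 0})"
    unfolding subsphere_def by auto
  moreover have "closed (\<Inter>i\<in>I. {x::'a. x \<bullet> i = 0})"
    by (intro closed_INT ballI closed_Collect_eq continuous_intros)
  ultimately show ?thesis
    by (simp add: closed_Int)
qed

lemma continuous_on_proj [continuous_intros]:
  "continuous_on S f \<Longrightarrow> continuous_on S (\<lambda>x. proj I (f x))"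
  unfolding proj_def by (intro continuous_intros)

lemma borel_measurable_proj [measurable]: "proj I \<in> borel_measurable borel"
  by (intro borel_measurable_continuous_onI continuous_intros)

lemma proj_diff: "proj I (x - y) = proj I x - proj I y"
  by (simp add: proj_def inner_diff_left scaleR_diff_left sum_subtractf)

context
  fixes I :: "'a::euclidean_space set"
  assumes I: "I \<subseteq> Basis"
begin

lemma finite_sub_Basis: "finite I"
  using I by (rule finite_subset) simp

lemma card_plus_codim: "card I + codim I = DIM('a)"
  unfolding codim_def using I by (metis card_Diff_subset card_mono finite_Basis finite_sub_Basis le_add_diff_inverse)

lemma codim_pos:
  assumes "I \<noteq> Basis"
  shows "codim I \<ge> 1"
proof -
  have "Basis - I \<noteq> {}"
    using assms I by blast
  then have "codim I > 0"
    unfolding codim_def by (subst card_gt_0_iff) simp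
  then show ?thesis by simp
qed

lemma proj_inner_orth:
  assumes "\<And>i. i \<in> I \<Longrightarrow> w \<bullet> i = 0"
  shows "proj I z \<bullet> w = z \<bullet> w"
proof -
  have "(\<Sum>i\<in>I. (z \<bullet> i) *\<^sub>R i) \<bullet> w = (\<Sum>i\<in>I. (z \<bullet> i) * (i \<bullet> w))"
    by (simp add: inner_sum_left)
  also have "\<dots> = 0"
    using assms by (intro sum.neutral) (simp add: inner_commute)
  finally show ?thesis
    by (simp add: proj_def inner_diff_left)
qed

lemma sum_inner_member:
  assumes "i \<in> I"
  shows "(\<Sum>j\<in>I. c j *\<^sub>R j) \<bullet> i = c i"
proof -
  have "(\<Sum>j\<in>I. c j *\<^sub>R j) \<bullet> i = (\<Sum>j\<in>I. if j = i then c i else 0)"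
    unfolding inner_sum_left using I assms by (intro sum.cong) (auto simp: inner_Basis subset_eq)
  then show ?thesis
    using assms finite_sub_Basis by simp
qed

lemma proj_inner_zero:
  assumes "i \<in> I"
  shows "proj I z \<bullet> i = 0"
  by (simp add: proj_def inner_diff_left sum_inner_member[OF assms])

lemma norm_proj: "(norm (proj I z))\<^sup>2 = (norm z)\<^sup>2 - (\<Sum>i\<in>I. (z \<bullet> i)\<^sup>2)"
proof -
  have "proj I z \<bullet> proj I z = z \<bullet> proj I z"
    by (rule proj_inner_orth) (rule proj_inner_zero)
  also have "\<dots> = z \<bullet> z - (\<Sum>i\<in>I. (z \<bullet> i)\<^sup>2)"
    by (simp add: proj_def inner_diff_right inner_sum_right power2_eq_square)
  finally show ?thesis
    by (simp add: power2_norm_eq_inner)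
qed

lemma norm_le_proj: "norm z \<le> norm (proj I z) + (\<Sum>i\<in>I. \<bar>z \<bullet> i\<bar>)"
proof -
  have "norm z \<le> norm (proj I z) + norm (\<Sum>i\<in>I. (z \<bullet> i) *\<^sub>R i)"
    using norm_triangle_ineq[of "proj I z" "\<Sum>i\<in>I. (z \<bullet> i) *\<^sub>R i"] by (simp add: proj_def)
  also have "norm (\<Sum>i\<in>I. (z \<bullet> i) *\<^sub>R i) \<le> (\<Sum>i\<in>I. \<bar>z \<bullet> i\<bar>)"
  proof (rule sum_norm_le)
    fix i assume "i \<in> I"
    then have "norm i = 1"
      using I by auto
    then show "norm ((z \<bullet> i) *\<^sub>R i) \<le> \<bar>z \<bullet> i\<bar>"
      by simp
  qed
  finally show ?thesis by simp
qed

lemma proj_inner_Basis: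
  assumes "j \<in> Basis - I"
  shows "proj I z \<bullet> j = z \<bullet> j"
proof (rule proj_inner_orth)
  fix i assume "i \<in> I"
  then have "i \<in> Basis" "j \<noteq> i"
    using I assms by auto
  then show "j \<bullet> i = 0"
    using assms by (intro inner_not_same_Basis) auto
qed

lemma proj_eqI:
  assumes "\<And>j. j \<in> Basis - I \<Longrightarrow> x \<bullet> j = y \<bullet> j" "\<And>i. i \<in> I \<Longrightarrow> x \<bullet> i = 0" "\<And>i. i \<in> I \<Longrightarrow> y \<bullet> i = 0"
  shows "x = y"
proof (rule euclidean_eqI)
  fix b :: 'a assume "b \<in> Basis"
  then show "x \<bullet> b = y \<bullet> b"
    using assms by (cases "b \<in> I") simp_all
qed

lemma sector_borel:
  assumes A: "A \<in> sets borel"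
  shows "sector I A t \<in> sets borel"
proof -
  have "closed ({z. norm (proj I z) \<le> t} \<inter> (\<Inter>i\<in>I. {z::'a. \<bar>z \<bullet> i\<bar> \<le> 1}))" (is "closed ?C")
    by (intro closed_Int closed_INT ballI closed_Collect_le continuous_intros)
  then have C: "?C \<in> sets borel"
    by (rule borel_closed)
  have "(\<lambda>z. sgn (proj I z)) \<in> borel_measurable borel"
    by (rule measurable_compose[OF borel_measurable_proj borel_measurable_sgn])
  then have "(\<lambda>z. sgn (proj I z)) -` A \<inter> space borel \<in> sets borel"
    using A by (rule measurable_sets)
  then have "(\<lambda>z. sgn (proj I z)) -` A \<inter> space borel \<inter> ?C \<in> sets borel"
    using C by (rule sets.Int)
  also have "(\<lambda>z. sgn (proj I z)) -` A \<inter> space borel \<inter> ?C = sector I A t"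
    unfolding sector_def space_borel by blast
  finally show ?thesis .
qed

lemma bounded_sector: "bounded (sector I A t)"
proof (rule boundedI)
  fix z assume z: "z \<in> sector I A t"
  then have 1: "norm (proj I z) \<le> t" and 2: "\<And>i. i \<in> I \<Longrightarrow> \<bar>z \<bullet> i\<bar> \<le> 1"
    unfolding sector_def by blast+
  have "(\<Sum>i\<in>I. \<bar>z \<bullet> i\<bar>) \<le> (\<Sum>i\<in>I. 1)"
    by (rule sum_mono) (rule 2)
  then have "(\<Sum>i\<in>I. \<bar>z \<bullet> i\<bar>) \<le> real (card I)"
    by simp
  then show "norm z \<le> t + real (card I)"
    using norm_le_proj[of z] 1 by linarith
qed

lemma sector_fmeasurable: "A \<in> sets borel \<Longrightarrow> sector I A t \<in> fmeasurable lborel"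
  using sector_borel emeasure_bounded_finite[OF bounded_sector] by (intro fmeasurableI) auto

text \<open>The linear map that stretches the coordinates outside \<open>I\<close> by
  \<open>t\<close> and fixes those in \<open>I\<close> carries the sector of radius 1 onto that of
  radius \<open>t\<close>. The cube factor is not scaled, so the determinant is
  \<open>t ^ codim I\<close>.\<close>

lemma measure_sector_scale:
  assumes A: "A \<in> sets borel" and t: "t > 0"
  shows "measure lborel (sector I A t) = t ^ codim I * measure lborel (sector I A 1)"
proof -
  define c :: "'a \<Rightarrow> real" where "c j = (if j \<in> I then 1 else t)" for j
  define T :: "'a \<Rightarrow> 'a" where "T x = 0 + (\<Sum>j\<in>Basis. (c j * (x \<bullet> j)) *\<^sub>R j)" for x
  have [measurable]: "T \<in> borel_measurable borel"
    unfolding T_def[abs_def] by measurable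
  have lb: "lborel = density (distr lborel borel T) (\<lambda>_. ennreal (\<Prod>j\<in>Basis. \<bar>c j\<bar>))"
    unfolding T_def[abs_def] using t by (intro lborel_affine_euclidean) (auto simp: c_def)
  have Tj: "T x \<bullet> j = c j * (x \<bullet> j)" if "j \<in> Basis" for x j
    using that by (simp add: T_def)
  have TI: "T x \<bullet> i = x \<bullet> i" if "i \<in> I" for x i
    using that I Tj[of i x] by (auto simp: c_def)
  have projT: "proj I (T x) = t *\<^sub>R proj I x" for x
  proof (rule proj_eqI)
    fix j assume j: "j \<in> Basis - I"
    then show "proj I (T x) \<bullet> j = (t *\<^sub>R proj I x) \<bullet> j"
      using Tj[of j x] proj_inner_Basis[OF j] by (simp add: c_def)
  qed (simp_all add: proj_inner_zero)
  have vim: "T -` sector I A t = sector I A 1"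
    using t by (auto simp: sector_def projT TI sgn_scaleR)
  have "(\<Prod>j\<in>Basis. \<bar>c j\<bar>) = (\<Prod>j\<in>Basis - I. t) * (\<Prod>j\<in>I. 1)"
  proof -
    have "(\<Prod>j\<in>Basis. \<bar>c j\<bar>) = (\<Prod>j\<in>Basis - I. \<bar>c j\<bar>) * (\<Prod>j\<in>I. \<bar>c j\<bar>)"
      using I by (intro prod.subset_diff) auto
    also have "(\<Prod>j\<in>I. \<bar>c j\<bar>) = (\<Prod>j\<in>I. 1)"
      by (intro prod.cong) (auto simp: c_def)
    also have "(\<Prod>j\<in>Basis - I. \<bar>c j\<bar>) = (\<Prod>j\<in>Basis - I. t)"
      using t by (intro prod.cong) (auto simp: c_def)
    finally show ?thesis .
  qed
  then have pc: "(\<Prod>j\<in>Basis. \<bar>c j\<bar>) = t ^ codim I"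
    by (simp add: codim_def)
  note S = sector_borel[OF A, of t]
  have "emeasure lborel (sector I A t) = emeasure (density (distr lborel borel T) (\<lambda>_. ennreal (t ^ codim I))) (sector I A t)"
    using lb pc by simp
  also have "\<dots> = ennreal (t ^ codim I) * emeasure (distr lborel borel T) (sector I A t)"
    using S by (simp add: emeasure_density nn_integral_cmult)
  also have "emeasure (distr lborel borel T) (sector I A t) = emeasure lborel (T -` sector I A t \<inter> space lborel)"
    using S by (intro emeasure_distr) auto
  finally show ?thesis
    using t by (simp add: vim measure_def enn2real_mult)
qed

text \<open>There is no type for the span of \<open>Basis - I\<close>, so the cone over \<open>A\<close> is thickened by the cube
  \<open>[-1,1]^I\<close>, whose volume is divided out.  The set \<open>I\<close> is empty for the sphere and a singleton for the
  equator.\<close>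

definition smeasure :: "'a set \<Rightarrow> real" where
  "smeasure A = real (codim I) / 2 ^ card I * measure lborel (sector I A 1)"

lemma smeasure_nonneg: "smeasure A \<ge> 0"
  by (simp add: smeasure_def)

lemma sector_disjoint: "A \<inter> B = {} \<Longrightarrow> sector I A t \<inter> sector I B t = {}"
  by (auto simp: sector_def)

lemma smeasure_mono:
  assumes "A \<subseteq> B" "A \<in> sets borel" "B \<in> sets borel"
  shows "smeasure A \<le> smeasure B"
proof -
  have "measure lborel (sector I A 1) \<le> measure lborel (sector I B 1)"
    using assms fmeasurableD[OF sector_fmeasurable, of A 1] sector_fmeasurable[of B 1]
    by (intro measure_mono_fmeasurable) (auto simp: sector_def)
  then show ?thesis
    unfolding smeasure_def by (intro mult_left_mono) auto
qed

lemma smeasure_Un: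
  assumes "A \<inter> B = {}" "A \<in> sets borel" "B \<in> sets borel"
  shows "smeasure (A \<union> B) = smeasure A + smeasure B"
proof -
  have "sector I (A \<union> B) 1 = sector I A 1 \<union> sector I B 1"
    by (auto simp: sector_def)
  then have "measure lborel (sector I (A \<union> B) 1) = measure lborel (sector I A 1) + measure lborel (sector I B 1)"
    using measure_Un3[OF sector_fmeasurable sector_fmeasurable, of A B 1 1] assms sector_disjoint[OF assms(1), of 1]
    by simp
  then show ?thesis
    by (simp add: smeasure_def distrib_left)
qed

lemma smeasure_finite_UN:
  assumes "finite F" "disjoint_family_on A F" "\<And>x. x \<in> F \<Longrightarrow> A x \<in> sets borel"
  shows "smeasure (\<Union>x\<in>F. A x) = (\<Sum>x\<in>F. smeasure (A x))"
  using assms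
proof (induction F)
  case empty
  then show ?case by (simp add: smeasure_def sector_def)
next
  case (insert x F)
  have "A x \<inter> (\<Union>x\<in>F. A x) = {}"
    using insert.prems(1) insert.hyps(2) unfolding disjoint_family_on_def by auto
  moreover have "(\<Union>x\<in>F. A x) \<in> sets borel"
    using insert by (intro sets.finite_UN) auto
  ultimately show ?case
    using insert by (simp add: smeasure_Un disjoint_family_on_def)
qed

lemma smeasure_countable_subadditive:
  assumes A: "A \<in> sets borel" and B: "\<And>i::nat. B i \<in> sets borel" and sub: "A \<subseteq> (\<Union>i. B i)"
  shows "ennreal (smeasure A) \<le> (\<Sum>i. ennreal (smeasure (B i)))"
proof -
  have e: "ennreal (smeasure A) = ennreal (real (codim I) / 2 ^ card I) * emeasure lborel (sector I A 1)"
    if "A \<in> sets borel" for A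
  proof -
    have "emeasure lborel (sector I A 1) = ennreal (measure lborel (sector I A 1))"
      using sector_fmeasurable[OF that, of 1] by (simp add: emeasure_eq_measure2)
    then show ?thesis
      unfolding smeasure_def by (subst ennreal_mult') simp_all
  qed
  have "emeasure lborel (sector I A 1) \<le> emeasure lborel (\<Union>i. sector I (B i) 1)"
  proof (rule emeasure_mono)
    show "sector I A 1 \<subseteq> (\<Union>i. sector I (B i) 1)"
      using sub by (auto simp: sector_def)
    show "(\<Union>i. sector I (B i) 1) \<in> sets lborel"
      using B sector_borel by (intro sets.countable_UN) auto
  qed
  also have "\<dots> \<le> (\<Sum>i. emeasure lborel (sector I (B i) 1))"
    using B by (intro emeasure_subadditive_countably) (auto simp: sector_borel)
  finally show ?thesis
    using A B by (simp add: e mult_left_mono)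
qed

text \<open>A nonzero projection has its direction on the subsphere, so the rest of \<open>A\<close>
  is invisible to the cone measure.\<close>

lemma subsphere_in_sector: "sector I A t - {z. proj I z = 0} = sector I (A \<inter> subsphere I) t - {z. proj I z = 0}"
  by (auto simp: sector_def subsphere_def sgn_div_norm proj_inner_zero)

lemma negligible_proj_zero:
  assumes "I \<noteq> Basis"
  shows "{z. proj I z = 0} \<in> null_sets lborel"
proof -
  obtain e where e: "e \<in> Basis - I"
    using assms I by blast
  have "{z. proj I z = 0} \<subseteq> {z. e \<bullet> z = 0}"
  proof
    fix z assume "z \<in> {z. proj I z = 0}"
    then show "z \<in> {z. e \<bullet> z = 0}"
      using proj_inner_Basis[OF e, of z] by (simp add: inner_commute)
  qed
  moreover have "negligible {z. e \<bullet> z = 0}"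
    using e by (intro negligible_hyperplane) (auto dest: nonzero_Basis)
  ultimately have "negligible {z. proj I z = 0}"
    by (rule negligible_subset[rotated])
  moreover have "{z. proj I z = 0} \<in> sets borel"
    by measurable
  ultimately show ?thesis
    by (simp add: negligible_iff_null_sets null_sets_completion_iff)
qed

text \<open>Up to a null set the sector over the whole subsphere is the cube times the unit ball of
  dimension m = \<open>codim I\<close>, and m times the volume of that ball is the area of its
  boundary.\<close>

lemma smeasure_subsphere:
  assumes "I \<noteq> Basis"
  shows "smeasure (subsphere I) = codim I * unit_ball_vol (codim I)"
proof -
  have B: "{z::'a. (\<forall>i\<in>I. \<bar>z \<bullet> i\<bar> \<le> 1) \<and> (\<Sum>j\<in>Basis - I. (z \<bullet> j)\<^sup>2) \<le> 1\<^sup>2} = sector I UNIV 1"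
  proof -
    have "(\<Sum>j\<in>Basis - I. (z \<bullet> j)\<^sup>2) = (norm (proj I z))\<^sup>2" for z
      using norm_square_split[OF I, of z] by (simp add: norm_proj)
    then show ?thesis
      by (auto simp: sector_def abs_square_le_1)
  qed
  have N: "{z. proj I z = 0} \<in> null_sets lborel"
    by (rule negligible_proj_zero[OF assms])
  have "measure lborel (sector I (subsphere I) 1) = measure lborel (sector I UNIV 1)"
  proof -
    have "sector I (subsphere I) 1 \<in> sets lborel" "sector I UNIV 1 \<in> sets lborel"
      using sector_borel[OF borel_closed[OF closed_subsphere]] sector_borel[of UNIV] by simp_all
    then show ?thesis
      using measure_Diff_null_set[OF _ N] subsphere_in_sector[of UNIV 1] by (metis Int_UNIV_left)
  qed
  also have "\<dots> = 2 ^ card I * unit_ball_vol (codim I)"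
    using emeasure_lborel_block[OF I, of "\<lambda>_. 1" 1] unfolding B
    by (simp add: measure_def codim_def)
  finally show ?thesis
    by (simp add: smeasure_def)
qed

end

subsection \<open>Small sets on subspheres\<close>

text \<open>The counterpart of Bernoulli's inequality: together they confine q^n - 1 between n (q -
  1) and q^(n-1) times this, which agree to first order as q tends to 1.\<close>

lemma power_minus_one_le:
  fixes q :: real
  assumes "q \<ge> 1"
  shows "q ^ n - 1 \<le> real n * (q - 1) * q ^ (n - 1)"
proof (cases n)
  case (Suc k)
  have "q ^ Suc k - 1 \<le> real (Suc k) * (q - 1) * q ^ k"
  proof (induction k)
    case (Suc k)
    have "q * (q ^ Suc k - 1) \<le> q * (real (Suc k) * (q - 1) * q ^ k)"
      using assms Suc.IH by (intro mult_left_mono) auto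
    moreover have "(q - 1) * 1 \<le> (q - 1) * q ^ Suc k"
      using assms by (intro mult_left_mono one_le_power) auto
    ultimately show ?case
      by (simp add: algebra_simps)
  qed simp
  then show ?thesis
    using Suc by simp
qed simp

lemma sgn_scaleR_norm: "norm x *\<^sub>R sgn x = (x::'a::real_normed_vector)"
  by (cases "x = 0") (simp_all add: sgn_div_norm)

context
  fixes I :: "'a::euclidean_space set"
  assumes I: "I \<subseteq> Basis"
begin

text \<open>The inner radius 1 keeps the shell away from the zeros of \<open>proj I\<close>, where
  \<open>sgn\<close> is discontinuous; the full sector over \<open>E\<close> need not be
  closed.\<close>

lemma shell_compact:
  assumes E: "closed E" and h: "h \<ge> 0"
  shows "compact (sector I E (1 + h) \<inter> {z. norm (proj I z) \<ge> 1})"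
proof -
  let ?S = "{z. 1 \<le> norm (proj I z)} \<inter> {z. norm (proj I z) \<le> 1 + h} \<inter> (\<Inter>i\<in>I. {z. \<bar>z \<bullet> i\<bar> \<le> 1})"
  have cS: "closed ?S"
    by (intro closed_Int closed_INT ballI closed_Collect_le continuous_intros)
  have "continuous_on ?S (\<lambda>z. sgn (proj I z))"
  proof (rule continuous_on_sgn)
    show "continuous_on ?S (proj I)"
      using continuous_on_proj[OF continuous_on_id, of ?S I] by simp
  qed auto
  then have "closed (?S \<inter> (\<lambda>z. sgn (proj I z)) -` E)"
    using cS E by (rule continuous_closed_preimage)
  moreover have "?S \<inter> (\<lambda>z. sgn (proj I z)) -` E = sector I E (1 + h) \<inter> {z. norm (proj I z) \<ge> 1}"
    unfolding sector_def by blast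
  moreover have "bounded (sector I E (1 + h) \<inter> {z. norm (proj I z) \<ge> 1})"
    using bounded_sector[OF I] by (rule bounded_subset) blast
  ultimately show ?thesis
    by (simp add: compact_eq_bounded_closed)
qed

lemma measure_shell_ge:
  assumes E: "closed E" and h: "h > 0"
  shows "real (codim I) * h * measure lborel (sector I E 1) \<le>
    measure lborel (sector I E (1 + h) \<inter> {z. norm (proj I z) \<ge> 1})"
proof -
  let ?V = "measure lborel (sector I E 1)"
  let ?Sh = "sector I E (1 + h) \<inter> {z. norm (proj I z) \<ge> 1}"
  note Eb = borel_closed[OF E]
  have Sh: "?Sh \<in> fmeasurable lborel"
    using shell_compact[OF E] h by (intro fmeasurable_compact) simp
  have "sector I E (1 + h) \<subseteq> sector I E 1 \<union> ?Sh"
    unfolding sector_def by auto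
  then have "measure lborel (sector I E (1 + h)) \<le> measure lborel (sector I E 1 \<union> ?Sh)"
    using sector_fmeasurable[OF I Eb] Sh
    by (intro measure_mono_fmeasurable fmeasurableD fmeasurable.Un)
  also have "\<dots> \<le> ?V + measure lborel ?Sh"
    using sector_fmeasurable[OF I Eb] Sh by (intro measure_Un_le fmeasurableD)
  finally have "(1 + h) ^ codim I * ?V \<le> ?V + measure lborel ?Sh"
    using measure_sector_scale[OF I Eb, of "1 + h"] h by simp
  moreover have "(1 + real (codim I) * h) * ?V \<le> (1 + h) ^ codim I * ?V"
    using Bernoulli_inequality[of h "codim I"] h by (intro mult_right_mono) auto
  ultimately show ?thesis
    by (simp add: distrib_right)
qed

text \<open>All directions in \<open>E\<close> are within \<open>d\<close> of \<open>p\<close>, so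
  heights along \<open>p\<close> lie between 1 - d^2/2 and 1 + h. Across \<open>p\<close>, a
  difference is split into t (x - x') and (t - t') x', which contribute at most (1 + h) d and h
  d.\<close>

lemma shell_difference_in_cylinder:
  assumes E: "E \<subseteq> subsphere I" and diam: "\<And>x y. x \<in> E \<Longrightarrow> y \<in> E \<Longrightarrow> dist x y \<le> d"
    and d: "0 \<le> d" "d \<le> 1" and h: "h > 0" and p: "p \<in> E"
    and z: "z \<in> sector I E (1 + h)" "norm (proj I z) \<ge> 1"
    and z': "z' \<in> sector I E (1 + h)" "norm (proj I z') \<ge> 1"
  shows "z - z' \<in> cylinder I p 2 (h + d\<^sup>2 / 2) ((1 + 2 * h) * d)"
proof -
  have pI: "\<And>i. i \<in> I \<Longrightarrow> p \<bullet> i = 0" and p1: "norm p = 1"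
    using p E unfolding subsphere_def by blast+
  have pp: "p \<bullet> p = 1"
    using p1 by (simp add: dot_square_norm)
  have slab: "\<bar>(z - z') \<bullet> i\<bar> \<le> 2" if "i \<in> I" for i
  proof -
    have "\<bar>z \<bullet> i\<bar> \<le> 1" "\<bar>z' \<bullet> i\<bar> \<le> 1"
      using z z' that unfolding sector_def by blast+
    then show ?thesis
      unfolding inner_diff_left by linarith
  qed
  have axis: "1 - d\<^sup>2 / 2 \<le> w \<bullet> p \<and> w \<bullet> p \<le> 1 + h"
    if w: "w \<in> sector I E (1 + h)" "norm (proj I w) \<ge> 1" for w
  proof -
    let ?x = "sgn (proj I w)" and ?t = "norm (proj I w)"
    have x: "?x \<in> E" and t: "1 \<le> ?t" "?t \<le> 1 + h"
      using w unfolding sector_def by blast+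
    have nx: "norm ?x = 1"
      using x E unfolding subsphere_def by blast
    have wp: "w \<bullet> p = ?t * (?x \<bullet> p)"
    proof -
      have "w \<bullet> p = proj I w \<bullet> p"
        using proj_inner_orth[OF I, of p w] pI by simp
      also have "\<dots> = (?t *\<^sub>R ?x) \<bullet> p"
        unfolding sgn_scaleR_norm ..
      finally show ?thesis
        unfolding inner_scaleR_left .
    qed
    have xx: "?x \<bullet> ?x = 1"
      unfolding dot_square_norm nx by simp
    have "(dist ?x p)\<^sup>2 = 2 - 2 * (?x \<bullet> p)"
      unfolding dist_norm power2_norm_eq_inner inner_diff_left inner_diff_right xx pp
      by (simp add: inner_commute)
    moreover have "(dist ?x p)\<^sup>2 \<le> d\<^sup>2"
      using diam[OF x p] by (intro power_mono) auto
    ultimately have xp: "1 - d\<^sup>2 / 2 \<le> ?x \<bullet> p"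
      by linarith
    have xp1: "?x \<bullet> p \<le> 1"
      using Cauchy_Schwarz_ineq2[of ?x p] nx p1 by simp
    have "d\<^sup>2 \<le> 1"
      using d by (simp add: power_le_one)
    then have xp0: "?x \<bullet> p \<ge> 0"
      using xp by linarith
    have a: "?x \<bullet> p \<le> ?t * (?x \<bullet> p)"
      using mult_right_mono[OF t(1) xp0] by simp
    have b: "?t * (?x \<bullet> p) \<le> 1 + h"
      using mult_mono[OF t(2) xp1] xp0 h by simp
    show ?thesis
      unfolding wp using order_trans[OF xp a] b by blast
  qed
  have ax: "\<bar>(z - z') \<bullet> p\<bar> \<le> h + d\<^sup>2 / 2"
    using axis[OF z] axis[OF z'] unfolding inner_diff_left by linarith
  have "(norm (z - z'))\<^sup>2 - (\<Sum>i\<in>I. ((z - z') \<bullet> i)\<^sup>2) - ((z - z') \<bullet> p)\<^sup>2 \<le> ((1 + 2 * h) * d)\<^sup>2"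
  proof -
    define P where "P w = w - (w \<bullet> p) *\<^sub>R p" for w
    have Pn2: "(norm (P w))\<^sup>2 = (norm w)\<^sup>2 - (w \<bullet> p)\<^sup>2" for w
      unfolding power2_norm_eq_inner P_def inner_diff_left inner_diff_right inner_scaleR_left inner_scaleR_right pp
      by (simp add: inner_commute power2_eq_square)
    have Pn: "norm (P w) \<le> norm w" for w
    proof (rule power2_le_imp_le)
      show "(norm (P w))\<^sup>2 \<le> (norm w)\<^sup>2"
        unfolding Pn2 by simp
    qed simp
    let ?x = "sgn (proj I z)" and ?t = "norm (proj I z)"
    let ?x' = "sgn (proj I z')" and ?t' = "norm (proj I z')"
    have x: "?x \<in> E" "?x' \<in> E" and t: "1 \<le> ?t" "?t \<le> 1 + h" "1 \<le> ?t'" "?t' \<le> 1 + h"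
      using z z' unfolding sector_def by blast+
    have pr: "proj I (z - z') = ?t *\<^sub>R (?x - ?x') + (?t - ?t') *\<^sub>R ?x'"
      unfolding proj_diff scaleR_diff_right scaleR_diff_left sgn_scaleR_norm by simp
    have Plin: "P (b *\<^sub>R v + c *\<^sub>R w) = b *\<^sub>R P v + c *\<^sub>R P w" for b c v w
      by (simp add: P_def inner_add_left scaleR_add_left scaleR_diff_right)
    \<comment> \<open>Subtracting \<open>p\<close> does not change the part across \<open>p\<close>;
      hence \<open>x'\<close> counts with its distance \<open>d\<close> from \<open>p\<close> and
      not with its length 1.\<close>
    have Pp: "P (w - p) = P w" for w
      by (simp add: P_def inner_diff_left pp scaleR_diff_left)
    have "P (?t *\<^sub>R (?x - ?x') + (?t - ?t') *\<^sub>R ?x') = ?t *\<^sub>R P (?x - ?x') + (?t - ?t') *\<^sub>R P (?x' - p)"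
      unfolding Plin Pp ..
    then have "norm (P (proj I (z - z'))) \<le> norm (?t *\<^sub>R P (?x - ?x')) + norm ((?t - ?t') *\<^sub>R P (?x' - p))"
      unfolding pr by (metis norm_triangle_ineq)
    also have "\<dots> \<le> (1 + h) * d + h * d"
    proof (intro add_mono)
      have "norm (P (?x - ?x')) \<le> d"
        using Pn[of "?x - ?x'"] diam[OF x] by (simp add: dist_norm)
      then show "norm (?t *\<^sub>R P (?x - ?x')) \<le> (1 + h) * d"
        using t h by (simp add: mult_mono)
      have "norm (P (?x' - p)) \<le> d"
        using Pn[of "?x' - p"] diam[OF x(2) p] by (simp add: dist_norm)
      moreover have "\<bar>?t - ?t'\<bar> \<le> h"
        using t by linarith
      ultimately show "norm ((?t - ?t') *\<^sub>R P (?x' - p)) \<le> h * d"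
        using h by (simp add: mult_mono)
    qed
    finally have "norm (P (proj I (z - z'))) \<le> (1 + 2 * h) * d"
      by (simp add: algebra_simps)
    then have "(norm (P (proj I (z - z'))))\<^sup>2 \<le> ((1 + 2 * h) * d)\<^sup>2"
      by (intro power_mono) auto
    moreover have "proj I (z - z') \<bullet> p = (z - z') \<bullet> p"
      using pI by (intro proj_inner_orth[OF I]) auto
    ultimately show ?thesis
      unfolding Pn2 norm_proj[OF I] by simp
  qed
  then show ?thesis
    unfolding cylinder_def using slab ax by blast
qed

text \<open>The isodiametric inequality in dimension \<open>codim I - 1\<close>, obtained in the ambient dimension from a
  shell of thickness \<open>h\<close> over \<open>E\<close>.\<close>

lemma smeasure_le_diameter_pos:
  assumes IB: "I \<noteq> Basis"
    and E: "closed E" "E \<subseteq> subsphere I" and diam: "\<And>x y. x \<in> E \<Longrightarrow> y \<in> E \<Longrightarrow> dist x y \<le> d"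
    and d: "0 < d" "d \<le> h" and h: "h \<le> 1"
  shows "smeasure I E \<le> (1 + h / 2) * (1 + 2 * h) ^ (codim I - 1) *
    (unit_ball_vol (real (codim I - 1)) / 2 ^ (codim I - 1) * d ^ (codim I - 1))"
proof (cases "E = {}")
  case True
  then show ?thesis
    using d by (simp add: smeasure_def[OF I] sector_def)
next
  case False
  then obtain p where p: "p \<in> E" by blast
  have pI: "\<And>i. i \<in> I \<Longrightarrow> p \<bullet> i = 0" and p1: "norm p = 1"
    using p E unfolding subsphere_def by blast+
  define m where "m = codim I"
  have m: "m \<ge> 1"
    unfolding m_def by (rule codim_pos[OF I IB])
  have h0: "h > 0" using d by simp
  let ?Sh = "sector I E (1 + h) \<inter> {z. norm (proj I z) \<ge> 1}"
  let ?D = "cylinder I p 2 (h + d\<^sup>2 / 2) ((1 + 2 * h) * d)"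
  let ?V = "measure lborel (sector I E 1)"
  let ?\<omega> = "unit_ball_vol (real (m - 1))"
  have Sh: "compact ?Sh"
    using shell_compact[OF E(1)] h0 by simp
  have Dv: "emeasure lborel ?D =
      ennreal ((2 * 2) ^ card I * (2 * (h + d\<^sup>2 / 2)) * (?\<omega> * ((1 + 2 * h) * d) ^ (m - 1)))"
    unfolding m_def codim_def using d h0 p1 pI by (intro emeasure_cylinder[OF I]) auto
  have cD: "compact ?D"
  proof -
    have "norm w \<le> (h + d\<^sup>2 / 2) + ((1 + 2 * h) * d) + 2 * real (card I)" if w: "w \<in> ?D" for w
    proof -
      have w1: "\<bar>w \<bullet> p\<bar> \<le> h + d\<^sup>2 / 2" and w2: "\<And>i. i \<in> I \<Longrightarrow> \<bar>w \<bullet> i\<bar> \<le> 2"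
        and w3: "(norm w)\<^sup>2 - (\<Sum>i\<in>I. (w \<bullet> i)\<^sup>2) - (w \<bullet> p)\<^sup>2 \<le> ((1 + 2 * h) * d)\<^sup>2"
        using w unfolding cylinder_def by blast+
      have "(norm (proj I w))\<^sup>2 \<le> (w \<bullet> p)\<^sup>2 + ((1 + 2 * h) * d)\<^sup>2"
        using w3 unfolding norm_proj[OF I] by linarith
      also have "\<dots> \<le> (\<bar>w \<bullet> p\<bar> + (1 + 2 * h) * d)\<^sup>2"
        using d h0 by (simp add: power2_sum)
      finally have "norm (proj I w) \<le> \<bar>w \<bullet> p\<bar> + (1 + 2 * h) * d"
        by (rule power2_le_imp_le) (use d h0 in simp)
      moreover have "(\<Sum>i\<in>I. \<bar>w \<bullet> i\<bar>) \<le> (\<Sum>i\<in>I. 2)"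
        by (rule sum_mono) (rule w2)
      ultimately show ?thesis
        using norm_le_proj[OF I, of w] w1 by simp
    qed
    then have "bounded ?D"
      by (rule boundedI)
    then show ?thesis
      using closed_cylinder by (simp add: compact_eq_bounded_closed)
  qed
  have BM: "2 ^ DIM('a) * measure lebesgue ?Sh \<le> measure lebesgue ?D"
  proof (rule measure_differences_compact[OF Sh cD])
    fix x y assume "x \<in> ?Sh" "y \<in> ?Sh"
    then show "x - y \<in> ?D"
      using shell_difference_in_cylinder[OF E(2) diam _ _ h0 p, of x y] d h by force
  qed
  have leb: "measure lebesgue ?Sh = measure lborel ?Sh" "measure lebesgue ?D = measure lborel ?D"
    using borel_compact[OF Sh] borel_compact[OF cD] by (simp_all add: measure_completion)
  have "2 ^ DIM('a) * (real m * h * ?V) \<le> 2 ^ DIM('a) * measure lborel ?Sh"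
    unfolding m_def using measure_shell_ge[OF E(1) h0] by (intro mult_left_mono) auto
  also have "\<dots> \<le> measure lborel ?D"
    using BM unfolding leb .
  also have "\<dots> = (2 * 2) ^ card I * (2 * (h + d\<^sup>2 / 2)) * (?\<omega> * ((1 + 2 * h) * d) ^ (m - 1))"
    unfolding measure_def Dv using d h0 by (intro enn2real_ennreal) simp
  also have "\<dots> \<le> (2 * 2) ^ card I * (2 * (h * (1 + h / 2))) * (?\<omega> * ((1 + 2 * h) * d) ^ (m - 1))"
  proof -
    \<comment> \<open>This is why \<open>d\<close> is bounded by the thickness: the curvature of the
      sphere adds d^2/2 to the height \<open>h\<close> of the cylinder, a relative error of at most
      h/2.\<close>
    have "d\<^sup>2 \<le> h * h"
      unfolding power2_eq_square using d h0 by (intro mult_mono) auto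
    then have "h + d\<^sup>2 / 2 \<le> h * (1 + h / 2)"
      by (simp add: algebra_simps)
    then show ?thesis
      using d h0 by (intro mult_right_mono mult_left_mono) auto
  qed
  finally have *: "2 ^ DIM('a) * (real m * h * ?V) \<le>
      (2 * 2) ^ card I * (2 * (h * (1 + h / 2))) * (?\<omega> * ((1 + 2 * h) * d) ^ (m - 1))" .
  \<comment> \<open>The powers of two cancel as follows: the doubled cube and the doubled height
    absorb \<open>2 ^ card I\<close> and 2, and 2^(m-1) remains to turn a radius into a
    diameter.\<close>
  have "(2::real) ^ DIM('a) = 2 ^ card I * (2 * 2 ^ (m - 1))"
  proof -
    have "DIM('a) = card I + Suc (m - 1)"
      using card_plus_codim[OF I] m by (simp add: m_def)
    then show ?thesis
      by (simp add: power_add)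
  qed
  then have L: "(2 ^ card I * 2 ^ card I * (2 * h * 2 ^ (m - 1))) * smeasure I E = 2 ^ DIM('a) * (real m * h * ?V)"
    unfolding smeasure_def[OF I] m_def[symmetric] by simp
  have R: "(2 ^ card I * 2 ^ card I * (2 * h * 2 ^ (m - 1))) *
      ((1 + h / 2) * (1 + 2 * h) ^ (m - 1) * (?\<omega> / 2 ^ (m - 1) * d ^ (m - 1))) =
      (2 * 2) ^ card I * (2 * (h * (1 + h / 2))) * (?\<omega> * ((1 + 2 * h) * d) ^ (m - 1))"
  proof -
    have "x * x * (2 * h * y) * ((1 + h / 2) * c * (w / y * e)) = x * x * (2 * (h * (1 + h / 2))) * (w * (c * e))"
      if "y \<noteq> 0" for x y c w e :: real
      using that by (simp add: field_simps)
    then show ?thesis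
      unfolding power_mult_distrib by simp
  qed
  have "2 ^ card I * 2 ^ card I * (2 * h * 2 ^ (m - 1)) > (0::real)"
    using h0 by simp
  then show ?thesis
    using * unfolding L[symmetric] R[symmetric] m_def[symmetric] by (rule mult_left_le_imp_le[rotated])
qed

text \<open>Letting the bound decrease to \<open>d\<close> admits d = 0 and hence one-point sets. On
  a 0-dimensional sphere these carry positive mass, in agreement with 0 ^ 0 = 1.\<close>

lemma smeasure_le_diameter:
  assumes IB: "I \<noteq> Basis"
    and E: "closed E" "E \<subseteq> subsphere I" and diam: "\<And>x y. x \<in> E \<Longrightarrow> y \<in> E \<Longrightarrow> dist x y \<le> d"
    and d: "0 \<le> d" "d < h" and h: "h \<le> 1"
  shows "smeasure I E \<le> (1 + h / 2) * (1 + 2 * h) ^ (codim I - 1) *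
    (unit_ball_vol (real (codim I - 1)) / 2 ^ (codim I - 1) * d ^ (codim I - 1))"
proof (rule tendsto_lowerbound)
  let ?f = "\<lambda>d. (1 + h / 2) * (1 + 2 * h) ^ (codim I - 1) *
    (unit_ball_vol (real (codim I - 1)) / 2 ^ (codim I - 1) * d ^ (codim I - 1))"
  show "(?f \<longlongrightarrow> ?f d) (at_right d)"
    by (intro tendsto_intros)
  show "\<forall>\<^sub>F x in at_right d. smeasure I E \<le> ?f x"
  proof (rule eventually_at_rightI[OF _ d(2)])
    fix x assume "x \<in> {d<..<h}"
    then show "smeasure I E \<le> ?f x"
      using diam d h by (intro smeasure_le_diameter_pos[OF IB E]) force+
  qed
qed simp

text \<open>A cylinder of radius \<open>r\<close> about \<open>p\<close>, standing on the tangent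
  plane at \<open>p\<close>, fits into the cone over the cap between the radii 1 and 1 + r. Its
  volume bounds that of the shell over the cap from below.\<close>

lemma smeasure_cap_ge:
  assumes p: "p \<in> subsphere I" and r: "0 < r" "r \<le> 1"
  shows "unit_ball_vol (real (codim I - 1)) * r ^ (codim I - 1) * (1 - r / 2) \<le>
    (1 + r) ^ (codim I - 1) * smeasure I (subsphere I \<inter> cball p r)"
proof -
  define m where "m = codim I"
  have pI: "\<And>i. i \<in> I \<Longrightarrow> p \<bullet> i = 0" and p1: "norm p = 1"
    using p unfolding subsphere_def by blast+
  have pp: "p \<bullet> p = 1"
    using p1 by (simp add: dot_square_norm)
  have IB: "I \<noteq> Basis"
    using pI p1 by (metis euclidean_all_zero_iff norm_zero zero_neq_one)
  have m: "m \<ge> 1"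
    unfolding m_def by (rule codim_pos[OF I IB])
  \<comment> \<open>Half the height of the cylinder, fixed by 1 + 2a + r^2/2 = 1 + r: a point at
    height s \<ge> 1 and at distance at most r from the axis has norm at most s + r^2/2.\<close>
  define a where "a = (r - r\<^sup>2 / 2) / 2"
  have r2: "r\<^sup>2 \<le> r"
    using r by (simp add: power2_eq_square mult_left_le)
  have a: "a > 0"
    using r r2 by (simp add: a_def)
  define A where "A = (\<lambda>z. - ((1 + a) *\<^sub>R p) + z) -` cylinder I p 1 a r"
  let ?cap = "subsphere I \<inter> cball p r"
  have clcap: "closed ?cap"
    by (simp add: closed_Int closed_subsphere)
  note capb = borel_closed[OF clcap]
  have Ab: "A \<in> sets borel"
    unfolding A_def
    by (intro borel_closed continuous_closed_vimage closed_cylinder continuous_intros)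
  have "emeasure lborel A = emeasure lborel (cylinder I p 1 a r)"
  proof -
    have "emeasure lborel (cylinder I p 1 a r) = emeasure (distr lborel borel ((+) (- ((1 + a) *\<^sub>R p)))) (cylinder I p 1 a r)"
      by (simp add: lborel_distr_plus)
    also have "\<dots> = emeasure lborel ((+) (- ((1 + a) *\<^sub>R p)) -` cylinder I p 1 a r \<inter> space lborel)"
      by (intro emeasure_distr) (simp_all add: borel_closed closed_cylinder)
    finally show ?thesis
      by (simp only: A_def space_lborel space_borel Int_UNIV_right)
  qed
  also have "\<dots> = ennreal ((2 * 1) ^ card I * (2 * a) * (unit_ball_vol (real (m - 1)) * r ^ (m - 1)))"
    unfolding m_def codim_def using r a p1 pI by (intro emeasure_cylinder[OF I]) auto
  finally have Av: "emeasure lborel A = ennreal (2 ^ card I * (2 * a) * (unit_ball_vol (real (m - 1)) * r ^ (m - 1)))"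
    by simp
  have Am: "measure lborel A = 2 ^ card I * (2 * a) * (unit_ball_vol (real (m - 1)) * r ^ (m - 1))"
    unfolding measure_def Av using r a by (intro enn2real_ennreal) simp
  have Af: "A \<in> fmeasurable lborel"
    using Ab Av by (intro fmeasurableI) auto
  have sub: "A \<subseteq> sector I ?cap (1 + r) - sector I ?cap 1 \<union> {z. p \<bullet> z = 1}"
  proof
    fix z assume "z \<in> A"
    define u where "u = - ((1 + a) *\<^sub>R p) + z"
    have uz: "u \<in> cylinder I p 1 a r"
      using \<open>z \<in> A\<close> by (simp add: A_def u_def)
    have ui: "u \<bullet> i = z \<bullet> i" if "i \<in> I" for i
      using pI[OF that] by (simp add: u_def inner_add_left inner_diff_left)
    define s where "s = z \<bullet> p"
    have up: "u \<bullet> p = s - (1 + a)"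
      by (simp add: u_def inner_add_left inner_diff_left pp s_def)
    have zi: "\<And>i. i \<in> I \<Longrightarrow> \<bar>z \<bullet> i\<bar> \<le> 1" and usa: "\<bar>s - (1 + a)\<bar> \<le> a"
      and un: "(norm u)\<^sup>2 - (\<Sum>i\<in>I. (u \<bullet> i)\<^sup>2) - (u \<bullet> p)\<^sup>2 \<le> r\<^sup>2"
      using uz ui up unfolding cylinder_def by auto
    have s: "1 \<le> s" "s \<le> 1 + 2 * a"
      using usa by linarith+
    define w where "w = proj I z"
    have wp: "w \<bullet> p = s"
      unfolding w_def s_def using pI by (intro proj_inner_orth[OF I]) auto
    have "(norm u)\<^sup>2 = (norm z)\<^sup>2 - 2 * (1 + a) * s + (1 + a)\<^sup>2"
      unfolding power2_norm_eq_inner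
      by (simp add: u_def s_def inner_add_left inner_add_right inner_diff_left inner_diff_right
          pp inner_commute power2_eq_square algebra_simps)
    moreover have "(\<Sum>i\<in>I. (u \<bullet> i)\<^sup>2) = (\<Sum>i\<in>I. (z \<bullet> i)\<^sup>2)"
      by (intro sum.cong refl) (simp add: ui)
    moreover have "(u \<bullet> p)\<^sup>2 = s\<^sup>2 - 2 * (1 + a) * s + (1 + a)\<^sup>2"
      unfolding up by (simp add: power2_diff)
    ultimately have wn: "(norm w)\<^sup>2 \<le> s\<^sup>2 + r\<^sup>2"
      using un unfolding w_def norm_proj[OF I] by linarith
    have sw: "s \<le> norm w"
      using Cauchy_Schwarz_ineq2[of w p] wp p1 by simp
    have s2: "1 * 1 \<le> s\<^sup>2" and sr: "1 * r\<^sup>2 \<le> s * r\<^sup>2" "1 * r\<^sup>2 \<le> s\<^sup>2 * r\<^sup>2"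
    proof -
      show s2: "1 * 1 \<le> s\<^sup>2"
        unfolding power2_eq_square using s by (intro mult_mono) auto
      show "1 * r\<^sup>2 \<le> s * r\<^sup>2" "1 * r\<^sup>2 \<le> s\<^sup>2 * r\<^sup>2"
        using s s2 by (intro mult_right_mono; simp)+
    qed
    have "(norm w)\<^sup>2 \<le> (s + r\<^sup>2 / 2)\<^sup>2"
    proof -
      have "(s + r\<^sup>2 / 2)\<^sup>2 = s\<^sup>2 + s * r\<^sup>2 + (r\<^sup>2 / 2)\<^sup>2"
        by (simp add: power2_sum)
      then show ?thesis
        using wn sr zero_le_power2[of "r\<^sup>2 / 2"] by linarith
    qed
    then have "norm w \<le> s + r\<^sup>2 / 2"
      by (rule power2_le_imp_le) (use s in simp)
    then have w_le: "norm w \<le> 1 + r"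
    proof -
      have "2 * a = r - r\<^sup>2 / 2"
        by (simp add: a_def)
      then show ?thesis
        using s(2) \<open>norm w \<le> s + r\<^sup>2 / 2\<close> by simp
    qed
    have near: "dist p (sgn w) \<le> r"
    proof -
      have w0: "norm w > 0"
        using sw s by linarith
      have "((1 - r\<^sup>2 / 2) * norm w)\<^sup>2 \<le> s\<^sup>2"
      proof -
        \<comment> \<open>Seen from the origin the slope against the axis is at most r, so the
          cosine of the angle to \<open>p\<close> is at least 1 / sqrt (1 + r^2). This is at least 1
          - r^2/2, which means a chord of length at most r.\<close>
        have "(1 - r\<^sup>2 / 2)\<^sup>2 * (1 + r\<^sup>2) \<le> 1"
        proof -
          have "(1 - q / 2)\<^sup>2 * (1 + q) = 1 - q\<^sup>2 * (3 - q) / 4" for q :: real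
            by (simp add: power2_eq_square field_simps)
          then have "(1 - r\<^sup>2 / 2)\<^sup>2 * (1 + r\<^sup>2) = 1 - (r\<^sup>2)\<^sup>2 * (3 - r\<^sup>2) / 4"
            by blast
          moreover have "(r\<^sup>2)\<^sup>2 * (3 - r\<^sup>2) \<ge> 0"
            using r r2 by (intro mult_nonneg_nonneg) auto
          ultimately show ?thesis by linarith
        qed
        moreover have "(norm w)\<^sup>2 \<le> s\<^sup>2 * (1 + r\<^sup>2)"
          using wn sr by (simp add: algebra_simps)
        ultimately have "(1 - r\<^sup>2 / 2)\<^sup>2 * (norm w)\<^sup>2 \<le> (1 - r\<^sup>2 / 2)\<^sup>2 * (s\<^sup>2 * (1 + r\<^sup>2))"
          by (intro mult_left_mono) auto
        also have "\<dots> = s\<^sup>2 * ((1 - r\<^sup>2 / 2)\<^sup>2 * (1 + r\<^sup>2))"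
          by simp
        also have "\<dots> \<le> s\<^sup>2 * 1"
          using \<open>(1 - r\<^sup>2 / 2)\<^sup>2 * (1 + r\<^sup>2) \<le> 1\<close> by (intro mult_left_mono) auto
        finally show ?thesis
          by (simp add: power_mult_distrib)
      qed
      then have "(1 - r\<^sup>2 / 2) * norm w \<le> s"
        by (rule power2_le_imp_le) (use s in simp)
      then have "1 - r\<^sup>2 / 2 \<le> s / norm w"
        using w0 by (simp add: field_simps)
      moreover have "p \<bullet> sgn w = s / norm w"
        using wp by (simp add: sgn_div_norm inner_commute divide_inverse)
      moreover have "norm (sgn w) = 1"
        using w0 by (simp add: norm_sgn)
      then have "sgn w \<bullet> sgn w = 1"
        by (simp add: dot_square_norm)
      then have "(dist p (sgn w))\<^sup>2 = 2 - 2 * (p \<bullet> sgn w)"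
        by (simp add: dist_norm power2_norm_eq_inner inner_diff_left inner_diff_right inner_commute pp)
      ultimately have "(dist p (sgn w))\<^sup>2 \<le> r\<^sup>2"
        by linarith
      then show ?thesis
        by (rule power2_le_imp_le) (use r in simp)
    qed
    have w1: "norm w > 0"
      using sw s by linarith
    have "sgn w \<in> subsphere I"
      using w1 unfolding subsphere_def w_def by (auto simp: norm_sgn sgn_div_norm proj_inner_zero[OF I])
    then have in1: "z \<in> sector I ?cap (1 + r)"
      using near w_le zi unfolding sector_def w_def by auto
    \<comment> \<open>A point whose projection has norm 1 belongs to the inner sector as well; it
      can occur only in the tangent plane, which is null.\<close>
    show "z \<in> sector I ?cap (1 + r) - sector I ?cap 1 \<union> {z. p \<bullet> z = 1}"
    proof (cases "s = 1")
      case True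
      then show ?thesis by (simp add: s_def inner_commute)
    next
      case False
      then have "norm w > 1" using s sw by linarith
      then have "z \<notin> sector I ?cap 1"
        unfolding sector_def w_def by auto
      then show ?thesis using in1 by blast
    qed
  qed
  have N: "{z. p \<bullet> z = 1} \<in> null_sets lborel"
  proof -
    have "negligible {z. p \<bullet> z = 1}"
      by (rule negligible_hyperplane) simp
    moreover have "closed {z. p \<bullet> z = 1}"
      by (rule closed_hyperplane)
    ultimately show ?thesis
      by (simp add: negligible_iff_null_sets null_sets_completion_iff)
  qed
  let ?S1 = "sector I ?cap 1" and ?S2 = "sector I ?cap (1 + r)"
  have S: "?S1 \<in> fmeasurable lborel" "?S2 \<in> fmeasurable lborel"
    using sector_fmeasurable[OF I capb] by blast+
  have SD: "?S2 - ?S1 \<in> fmeasurable lborel"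
    using S by (intro fmeasurable.Diff) auto
  have "measure lborel A = measure lborel (A - {z. p \<bullet> z = 1})"
    using measure_Diff_null_set[OF _ N, of A] Ab by simp
  also have "\<dots> \<le> measure lborel (?S2 - ?S1)"
    using sub Ab N SD by (intro measure_mono_fmeasurable) auto
  also have "\<dots> = measure lborel ?S2 - measure lborel ?S1"
  proof (rule measurable_measure_Diff)
    show "?S1 \<subseteq> ?S2"
      using r unfolding sector_def by force
  qed (use S in auto)
  also have "\<dots> = ((1 + r) ^ m - 1) * measure lborel ?S1"
    using measure_sector_scale[OF I capb, of "1 + r"] r by (simp add: m_def algebra_simps)
  also have "\<dots> \<le> (real m * r * (1 + r) ^ (m - 1)) * measure lborel ?S1"
  proof (rule mult_right_mono)
    show "(1 + r) ^ m - 1 \<le> real m * r * (1 + r) ^ (m - 1)"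
      using power_minus_one_le[of "1 + r" m] r by simp
  qed simp
  finally have *: "2 ^ card I * (2 * a) * (unit_ball_vol (real (m - 1)) * r ^ (m - 1)) \<le>
      (real m * r * (1 + r) ^ (m - 1)) * measure lborel ?S1"
    unfolding Am .
  have a2: "2 * a = r * (1 - r / 2)"
    by (simp add: a_def power2_eq_square field_simps)
  have L: "2 ^ card I * (2 * a) * (unit_ball_vol (real (m - 1)) * r ^ (m - 1)) =
      (r * 2 ^ card I) * (unit_ball_vol (real (m - 1)) * r ^ (m - 1) * (1 - r / 2))"
    unfolding a2 by (simp add: mult_ac)
  have R: "(real m * r * (1 + r) ^ (m - 1)) * measure lborel ?S1 =
      (r * 2 ^ card I) * ((1 + r) ^ (m - 1) * smeasure I ?cap)"
    by (simp add: smeasure_def[OF I] m_def[symmetric])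
  have "r * 2 ^ card I > 0"
    using r by simp
  then show ?thesis
    using * unfolding L R m_def[symmetric] by (rule mult_left_le_imp_le[rotated])
qed

end

subsection \<open>Hausdorff measure from below\<close>

lemma suminf_prod_decode:
  fixes f :: "nat \<times> nat \<Rightarrow> ennreal"
  shows "(\<Sum>k. f (prod_decode k)) = (\<Sum>n. \<Sum>i. f (n, i))"
proof -
  have "(\<Sum>k. f (prod_decode k)) = (\<integral>\<^sup>+k. f (prod_decode k) \<partial>count_space UNIV)"
    by (rule nn_integral_count_space_nat[symmetric])
  also have "\<dots> = (\<integral>\<^sup>+p. f p \<partial>count_space UNIV)"
    by (rule nn_integral_bij_count_space[OF bij_prod_decode])
  also have "\<dots> = (\<integral>\<^sup>+n. \<integral>\<^sup>+i. f (n, i) \<partial>count_space UNIV \<partial>count_space UNIV)"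
    by (rule nn_integral_fst_count_space[symmetric])
  finally show ?thesis
    by (simp add: nn_integral_count_space_nat)
qed

section \<open>Covers of bounded size and subadditivity\<close>

definition diam_cover :: "real \<Rightarrow> 'a::metric_space set \<Rightarrow> (nat \<Rightarrow> 'a set) set" where
  "diam_cover \<delta> A = {E. A \<subseteq> (\<Union>i. E i) \<and> (\<forall>i. bounded (E i) \<and> diameter (E i) \<le> \<delta>)}"

lemma hausdorff_pre_eq:
  "hausdorff_pre s \<delta> A = (INF E\<in>diam_cover \<delta> A. \<Sum>i. ennreal (hcontent s (E i)))"
  unfolding hausdorff_pre_def diam_cover_def ..

lemma hausdorff_pre_mono: "A \<subseteq> B \<Longrightarrow> hausdorff_pre s \<delta> A \<le> hausdorff_pre s \<delta> B"
  unfolding hausdorff_pre_eq by (rule INF_superset_mono) (auto simp: diam_cover_def)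

lemma hausdorff_pre_le_measure: "\<delta> > 0 \<Longrightarrow> hausdorff_pre s \<delta> A \<le> hausdorff_measure s A"
  unfolding hausdorff_measure_def by (rule SUP_upper) simp

lemma hausdorff_measure_mono: "A \<subseteq> B \<Longrightarrow> hausdorff_measure s A \<le> hausdorff_measure s B"
  unfolding hausdorff_measure_def by (intro SUP_mono) (auto intro: hausdorff_pre_mono)

lemma hausdorff_pre_single:
  assumes "bounded E" "diameter E \<le> \<delta>" "0 \<le> \<delta>"
  shows "hausdorff_pre s \<delta> E \<le> ennreal (hcontent s E)"
proof -
  \<comment> \<open>Padding the cover with empty sets costs nothing, since \<open>hcontent\<close>
    gives them 0 even for s = 0.\<close>
  define F where "F i = (if i = 0 then E else {})" for i :: nat
  have "F \<in> diam_cover \<delta> E"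
    using assms by (auto simp: diam_cover_def F_def)
  then have "hausdorff_pre s \<delta> E \<le> (\<Sum>i. ennreal (hcontent s (F i)))"
    unfolding hausdorff_pre_eq by (rule INF_lower)
  also have "\<dots> = (\<Sum>i\<in>{0}. ennreal (hcontent s (F i)))"
    by (rule suminf_finite) (auto simp: F_def hcontent_def)
  finally show ?thesis
    by (simp add: F_def)
qed

lemma hausdorff_pre_empty: "0 \<le> \<delta> \<Longrightarrow> hausdorff_pre s \<delta> {} = 0"
  using hausdorff_pre_single[of "{}" \<delta> s] by (simp add: hcontent_def)

lemma hausdorff_pre_UN:
  fixes A :: "nat \<Rightarrow> 'a::metric_space set"
  shows "hausdorff_pre s \<delta> (\<Union>n. A n) \<le> (\<Sum>n. hausdorff_pre s \<delta> (A n))"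
proof (cases "\<forall>n. hausdorff_pre s \<delta> (A n) \<noteq> \<infinity>")
  case False
  then obtain n where "hausdorff_pre s \<delta> (A n) = top" by auto
  then have "(\<Sum>n. hausdorff_pre s \<delta> (A n)) = top"
  proof -
    have False if "(\<Sum>n. hausdorff_pre s \<delta> (A n)) < top"
      using ennreal_suminf_lessD[OF that, of n] \<open>hausdorff_pre s \<delta> (A n) = top\<close> by simp
    then show ?thesis
      using less_top by blast
  qed
  then show ?thesis by simp
next
  case True
  show ?thesis
  proof (rule ennreal_le_epsilon)
    fix e :: real assume e: "e > 0"
    have "\<exists>E\<in>diam_cover \<delta> (A n). (\<Sum>i. ennreal (hcontent s (E i))) <
        hausdorff_pre s \<delta> (A n) + ennreal (e * (1/2) ^ Suc n)" for n
      using e True by (intro INF_approx_ennreal) (auto simp: hausdorff_pre_eq)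
    then obtain E where E: "\<And>n. E n \<in> diam_cover \<delta> (A n)"
      "\<And>n. (\<Sum>i. ennreal (hcontent s (E n i))) < hausdorff_pre s \<delta> (A n) + ennreal (e * (1/2) ^ Suc n)"
      by metis
    define F where "F k = (case prod_decode k of (n, i) \<Rightarrow> E n i)" for k
    have Fp: "F (prod_encode (n, i)) = E n i" for n i
      by (simp add: F_def)
    have "F \<in> diam_cover \<delta> (\<Union>n. A n)"
      unfolding diam_cover_def
    proof (intro CollectI conjI allI subsetI)
      fix x assume "x \<in> (\<Union>n. A n)"
      then obtain n i where "x \<in> E n i"
        using E(1) unfolding diam_cover_def by blast
      then show "x \<in> (\<Union>k. F k)"
        using Fp by (metis UN_iff UNIV_I)
    next
      fix k
      obtain n i where k: "prod_decode k = (n, i)" by fastforce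
      show "bounded (F k)" "diameter (F k) \<le> \<delta>"
        using E(1)[of n] by (auto simp: F_def k diam_cover_def)
    qed
    then have "hausdorff_pre s \<delta> (\<Union>n. A n) \<le> (\<Sum>k. ennreal (hcontent s (F k)))"
      unfolding hausdorff_pre_eq by (rule INF_lower)
    also have "\<dots> = (\<Sum>n. \<Sum>i. ennreal (hcontent s (E n i)))"
      using suminf_prod_decode[of "\<lambda>(n, i). ennreal (hcontent s (E n i))"]
      by (simp add: F_def case_prod_unfold)
    also have "\<dots> \<le> (\<Sum>n. hausdorff_pre s \<delta> (A n) + ennreal (e * (1/2) ^ Suc n))"
      using E(2) by (intro suminf_le) (auto intro: less_imp_le)
    also have "\<dots> = (\<Sum>n. hausdorff_pre s \<delta> (A n)) + (\<Sum>n. ennreal (e * (1/2) ^ Suc n))"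
      by (rule suminf_add[symmetric]) auto
    also have "(\<Sum>n. ennreal (e * (1/2) ^ Suc n)) = ennreal e"
      using e sums_mult[OF power_half_series, of e] by (intro suminf_ennreal_eq) auto
    finally show "hausdorff_pre s \<delta> (\<Union>n. A n) \<le> (\<Sum>n. hausdorff_pre s \<delta> (A n)) + ennreal e" .
  qed
qed

lemma hausdorff_pre_Un:
  assumes "0 \<le> \<delta>"
  shows "hausdorff_pre s \<delta> (A \<union> B) \<le> hausdorff_pre s \<delta> A + hausdorff_pre s \<delta> B"
proof -
  define F where "F i = (if i = 0 then A else if i = 1 then B else {})" for i :: nat
  have "A \<union> B = (\<Union>i. F i)"
    by (auto simp: F_def split: if_splits)
  then have "hausdorff_pre s \<delta> (A \<union> B) \<le> (\<Sum>i. hausdorff_pre s \<delta> (F i))"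
    using hausdorff_pre_UN by metis
  also have "\<dots> = (\<Sum>i\<in>{0,1}. hausdorff_pre s \<delta> (F i))"
    using assms by (intro suminf_finite) (auto simp: F_def hausdorff_pre_empty)
  finally show ?thesis
    by (simp add: F_def)
qed

lemma hausdorff_pre_finite_UN:
  assumes "0 \<le> \<delta>"
  shows "hausdorff_pre s \<delta> (\<Union>i<n. A i) \<le> (\<Sum>i<n. hausdorff_pre s \<delta> (A (i::nat)))"
proof (induction n)
  case (Suc n)
  have "hausdorff_pre s \<delta> (\<Union>i<Suc n. A i) \<le> hausdorff_pre s \<delta> (\<Union>i<n. A i) + hausdorff_pre s \<delta> (A n)"
    using hausdorff_pre_Un[OF assms, of s "\<Union>i<n. A i" "A n"] by (simp add: lessThan_Suc Un_commute)
  also have "\<dots> \<le> (\<Sum>i<n. hausdorff_pre s \<delta> (A i)) + hausdorff_pre s \<delta> (A n)"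
    by (intro add_mono Suc.IH) simp
  finally show ?case by simp
qed (simp add: assms hausdorff_pre_empty)

context
  fixes I :: "'a::euclidean_space set"
  assumes I: "I \<subseteq> Basis" and IB: "I \<noteq> Basis"
begin

text \<open>Each covering set is replaced by the part of its closure in \<open>A\<close>: the
  diameter does not grow, and the isodiametric bound applies to closed subsets of the subsphere. The
  covers have size h/2 because that bound asks for a diameter strictly below h.\<close>

lemma smeasure_le_pre:
  assumes A: "closed A" "A \<subseteq> subsphere I" and h: "0 < h" "h \<le> 1"
  shows "ennreal (smeasure I A / ((1 + h / 2) * (1 + 2 * h) ^ (codim I - 1))) \<le>
    hausdorff_pre (codim I - 1) (h / 2) A"
  unfolding hausdorff_pre_eq
proof (rule INF_greatest)
  let ?c = "(1 + h / 2) * (1 + 2 * h) ^ (codim I - 1)"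
  have c: "?c > 0" using h by simp
  fix E assume E: "E \<in> diam_cover (h / 2) A"
  define F where "F i = closure (E i) \<inter> A" for i
  have Fc: "closed (F i)" "F i \<subseteq> subsphere I" for i
    using A by (auto simp: F_def)
  have le: "smeasure I (F i) \<le> ?c * hcontent (codim I - 1) (E i)" for i
  proof (cases "E i = {}")
    case True
    then show ?thesis
      by (simp add: F_def smeasure_def[OF I] sector_def hcontent_def)
  next
    case False
    have b: "bounded (E i)" "diameter (E i) \<le> h / 2"
      using E by (auto simp: diam_cover_def)
    have "smeasure I (F i) \<le> ?c * (unit_ball_vol (real (codim I - 1)) / 2 ^ (codim I - 1) *
        diameter (E i) ^ (codim I - 1))"
    proof (rule smeasure_le_diameter[OF I IB Fc])
      fix x y assume "x \<in> F i" "y \<in> F i"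
      then have "x \<in> closure (E i)" "y \<in> closure (E i)"
        unfolding F_def by blast+
      then have "dist x y \<le> diameter (closure (E i))"
        using bounded_closure[OF b(1)] by (intro diameter_bounded_bound)
      then show "dist x y \<le> diameter (E i)"
        unfolding diameter_closure[OF b(1)] .
    next
      show "0 \<le> diameter (E i)" by (rule diameter_ge_0[OF b(1)])
      show "diameter (E i) < h" using b(2) h(1) by simp
      show "h \<le> 1" by (rule h(2))
    qed
    then show ?thesis
      using False by (simp add: hcontent_def)
  qed
  have "A \<subseteq> (\<Union>i. F i)"
  proof
    fix x assume x: "x \<in> A"
    then obtain i where "x \<in> E i"
      using E unfolding diam_cover_def by blast
    then have "x \<in> F i"
      using x closure_subset[of "E i"] unfolding F_def by blast
    then show "x \<in> (\<Union>i. F i)" by blast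
  qed
  then have "ennreal (smeasure I A) \<le> (\<Sum>i. ennreal (smeasure I (F i)))"
    using borel_closed[OF A(1)] borel_closed[OF Fc(1)] by (intro smeasure_countable_subadditive[OF I])
  also have "\<dots> \<le> (\<Sum>i. ennreal ?c * ennreal (hcontent (codim I - 1) (E i)))"
  proof (rule suminf_le)
    fix i
    have "ennreal (smeasure I (F i)) \<le> ennreal (?c * hcontent (codim I - 1) (E i))"
      by (rule ennreal_leI[OF le])
    also have "\<dots> = ennreal ?c * ennreal (hcontent (codim I - 1) (E i))"
      using c by (intro ennreal_mult') simp
    finally show "ennreal (smeasure I (F i)) \<le> ennreal ?c * ennreal (hcontent (codim I - 1) (E i))" .
  qed simp_all
  also have "\<dots> = ennreal ?c * (\<Sum>i. ennreal (hcontent (codim I - 1) (E i)))"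
    by (rule ennreal_suminf_cmult)
  finally have le': "ennreal (smeasure I A) \<le> ennreal ?c * (\<Sum>i. ennreal (hcontent (codim I - 1) (E i)))" .
  have "ennreal (smeasure I A / ?c) = ennreal (smeasure I A) / ennreal ?c"
    using c smeasure_nonneg[OF I] by (intro divide_ennreal[symmetric])
  also have "\<dots> \<le> (\<Sum>i. ennreal (hcontent (codim I - 1) (E i)))"
  proof (rule divide_le_posI_ennreal[OF _ le'])
    show "0 < ennreal ?c"
      using c by (simp only: ennreal_less_zero_iff)
  qed
  finally show "ennreal (smeasure I A / ?c) \<le> (\<Sum>i. ennreal (hcontent (codim I - 1) (E i)))" .
qed

lemma smeasure_le_hausdorff_measure:
  assumes A: "closed A" "A \<subseteq> subsphere I"
  shows "ennreal (smeasure I A) \<le> hausdorff_measure (codim I - 1) A"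
proof (rule tendsto_upperbound)
  let ?f = "\<lambda>h::real. ennreal (smeasure I A / ((1 + h / 2) * (1 + 2 * h) ^ (codim I - 1)))"
  have "isCont (\<lambda>h::real. smeasure I A / ((1 + h / 2) * (1 + 2 * h) ^ (codim I - 1))) 0"
    by (auto intro!: continuous_intros)
  then have "((\<lambda>h::real. smeasure I A / ((1 + h / 2) * (1 + 2 * h) ^ (codim I - 1))) \<longlongrightarrow>
      smeasure I A / ((1 + 0 / 2) * (1 + 2 * 0) ^ (codim I - 1))) (at_right 0)"
    unfolding isCont_def filterlim_at_split by blast
  then show "(?f \<longlongrightarrow> ennreal (smeasure I A)) (at_right 0)"
    by (intro tendsto_ennrealI) simp
  show "\<forall>\<^sub>F h in at_right 0. ?f h \<le> hausdorff_measure (codim I - 1) A"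
  proof (rule eventually_at_rightI[of 0 1])
    fix h :: real assume "h \<in> {0<..<1}"
    then show "?f h \<le> hausdorff_measure (codim I - 1) A"
      using smeasure_le_pre[OF A, of h] hausdorff_pre_le_measure[of "h / 2" "codim I - 1" A]
      by (auto intro: order_trans)
  qed simp
qed simp

text \<open>A small cap has nearly the area of a flat ball of the same radius, uniformly in the
  centre. The upper bound uses the diameter alone and so holds for any centre.\<close>

lemma small_cap_bounds:
  assumes L: "L > 1"
  obtains \<rho> where "\<rho> > 0"
    "\<And>p r. p \<in> subsphere I \<Longrightarrow> 0 < r \<Longrightarrow> r \<le> \<rho> \<Longrightarrow>
      unit_ball_vol (real (codim I - 1)) * r ^ (codim I - 1) \<le> L * smeasure I (subsphere I \<inter> cball p r)"
    "\<And>p r. 0 < r \<Longrightarrow> r \<le> \<rho> \<Longrightarrow>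
      smeasure I (subsphere I \<inter> cball p r) \<le> L * (unit_ball_vol (real (codim I - 1)) * r ^ (codim I - 1))"
proof -
  let ?m = "codim I - 1"
  let ?f = "\<lambda>x::real. (1 + x) ^ ?m / (1 - x / 2)" and ?g = "\<lambda>x::real. (1 + x / 2) * (1 + 2 * x) ^ ?m"
  have "isCont ?f 0" "isCont ?g 0"
    by (auto intro!: continuous_intros)
  then have lim: "(?f \<longlongrightarrow> ?f 0) (at_right 0)" "(?g \<longlongrightarrow> ?g 0) (at_right 0)"
    unfolding isCont_def filterlim_at_split by blast+
  have e1: "\<forall>\<^sub>F x in at_right 0. ?f x < L"
    using L by (intro order_tendstoD(2)[OF lim(1)]) simp
  have e2: "\<forall>\<^sub>F x in at_right 0. ?g x < L"
    using L by (intro order_tendstoD(2)[OF lim(2)]) simp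
  obtain b where b: "b > 0" "\<And>x. 0 < x \<Longrightarrow> x < b \<Longrightarrow>
      (1 + x) ^ ?m / (1 - x / 2) < L \<and> (1 + x / 2) * (1 + 2 * x) ^ ?m < L"
    using eventually_conj[OF e1 e2] unfolding eventually_at_right_field by auto
  \<comment> \<open>At most a quarter of \<open>b\<close> and of 1, because the diameter 2r is
    combined with a shell of thickness 3r.\<close>
  define \<rho> where "\<rho> = min (b / 4) (1 / 4)"
  show ?thesis
  proof
    show "\<rho> > 0" using b(1) by (simp add: \<rho>_def)
    fix p :: 'a and r :: real assume r: "0 < r" "r \<le> \<rho>"
    then have r1: "r < b" "r \<le> 1" "3 * r < b" "3 * r \<le> 1"
      using b(1) by (auto simp: \<rho>_def)
    let ?b = "smeasure I (subsphere I \<inter> cball p r)"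
    show "unit_ball_vol (real ?m) * r ^ ?m \<le> L * ?b" if p: "p \<in> subsphere I"
    proof -
      have "unit_ball_vol (real ?m) * r ^ ?m * (1 - r / 2) \<le> (1 + r) ^ ?m * ?b"
        by (rule smeasure_cap_ge[OF I p r(1) r1(2)])
      then have "unit_ball_vol (real ?m) * r ^ ?m \<le> (1 + r) ^ ?m / (1 - r / 2) * ?b"
        using r1 by (simp add: field_simps)
      also have "\<dots> \<le> L * ?b"
        using b(2)[OF r(1) r1(1)] smeasure_nonneg[OF I] by (intro mult_right_mono) auto
      finally show ?thesis .
    qed
    have "?b \<le> (1 + 3 * r / 2) * (1 + 2 * (3 * r)) ^ ?m *
        (unit_ball_vol (real ?m) / 2 ^ ?m * (2 * r) ^ ?m)"
    proof (rule smeasure_le_diameter[OF I IB])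
      show "closed (subsphere I \<inter> cball p r)"
        using closed_subsphere by (intro closed_Int) auto
      show "dist x y \<le> 2 * r" if "x \<in> subsphere I \<inter> cball p r" "y \<in> subsphere I \<inter> cball p r" for x y
        using that dist_triangle2[of x y p] by (simp add: dist_commute)
    qed (use r r1 in auto)
    also have "\<dots> = ((1 + (3 * r) / 2) * (1 + 2 * (3 * r)) ^ ?m) * (unit_ball_vol (real ?m) * r ^ ?m)"
      by (simp add: power_mult_distrib)
    also have "\<dots> \<le> L * (unit_ball_vol (real ?m) * r ^ ?m)"
      using b(2)[of "3 * r"] r r1 by (intro mult_right_mono) auto
    finally show "?b \<le> L * (unit_ball_vol (real ?m) * r ^ ?m)" .
  qed
qed

text \<open>Vitali's covering lemma with fivefold enlargement, numbered by a set \<open>T\<close> of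
  naturals because the disjoint family may be finite.\<close>

lemma vitali_sequence:
  assumes W: "open W" and \<rho>: "\<rho> > 0"
  obtains x :: "nat \<Rightarrow> 'a" and r :: "nat \<Rightarrow> real" and T :: "nat set" where
    "\<And>i. i \<in> T \<Longrightarrow> x i \<in> W \<inter> subsphere I \<and> 0 < r i \<and> r i \<le> \<rho> \<and> cball (x i) (r i) \<subseteq> W"
    "\<And>i j. i \<in> T \<Longrightarrow> j \<in> T \<Longrightarrow> i \<noteq> j \<Longrightarrow> cball (x i) (r i) \<inter> cball (x j) (r j) = {}"
    "W \<inter> subsphere I \<subseteq> (\<Union>i\<in>T. cball (x i) (5 * r i))"
proof -
  let ?U = "W \<inter> subsphere I"
  have "\<exists>s. 0 < s \<and> s \<le> \<rho> \<and> cball y s \<subseteq> W" if "y \<in> ?U" for y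
  proof -
    have "y \<in> W" using that by (rule IntD1)
    with iffD1[OF open_contains_cball W] have "\<exists>e>0. cball y e \<subseteq> W"
      by (rule bspec)
    then obtain e where "e > 0" "cball y e \<subseteq> W"
      by (elim exE conjE)
    moreover have "cball y (min e \<rho>) \<subseteq> cball y e"
      by (rule subset_cball) simp
    ultimately have "0 < min e \<rho> \<and> min e \<rho> \<le> \<rho> \<and> cball y (min e \<rho>) \<subseteq> W"
      using \<rho> by auto
    then show ?thesis ..
  qed
  then obtain s where s: "\<And>y. y \<in> ?U \<Longrightarrow> 0 < s y \<and> s y \<le> \<rho> \<and> cball y (s y) \<subseteq> W"
    by (metis (no_types))
  have cov: "?U \<subseteq> (\<Union>i\<in>?U. cball i (s i))"
  proof
    fix y assume y: "y \<in> ?U"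
    then have "y \<in> cball y (s y)"
      using s[OF y] by simp
    then show "y \<in> (\<Union>i\<in>?U. cball i (s i))"
      using y by blast
  qed
  have rb: "\<And>i. i \<in> ?U \<Longrightarrow> 0 < s i \<and> s i \<le> \<rho>"
    using s by blast
  obtain C where C: "countable C" "C \<subseteq> ?U"
      "pairwise (\<lambda>i j. disjnt (cball i (s i)) (cball j (s j))) C"
      "?U \<subseteq> (\<Union>i\<in>C. cball i (5 * s i))"
    by (rule Vitali_covering_lemma_cballs[OF cov rb])
  define f where "f = from_nat_into C"
  define T where "T = to_nat_on C ` C"
  have fT: "f i \<in> C \<and> to_nat_on C (f i) = i" if "i \<in> T" for i
  proof -
    obtain c where c: "c \<in> C" "i = to_nat_on C c"
      using \<open>i \<in> T\<close> unfolding T_def by blast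
    then have "f i = c"
      using C(1) by (simp add: f_def)
    then show ?thesis
      using c by simp
  qed
  show ?thesis
  proof (rule that[of T f "s \<circ> f"])
    show "f i \<in> ?U \<and> 0 < (s \<circ> f) i \<and> (s \<circ> f) i \<le> \<rho> \<and> cball (f i) ((s \<circ> f) i) \<subseteq> W" if "i \<in> T" for i
    proof -
      have "f i \<in> ?U"
        using fT[OF that] C(2) by blast
      then show ?thesis
        using s unfolding comp_apply by blast
    qed
    show "cball (f i) ((s \<circ> f) i) \<inter> cball (f j) ((s \<circ> f) j) = {}" if "i \<in> T" "j \<in> T" "i \<noteq> j" for i j
    proof -
      have "f i \<in> C" "f j \<in> C" "f i \<noteq> f j"
        using fT[OF that(1)] fT[OF that(2)] that(3) by auto
      then show ?thesis
        using C(3) by (simp add: pairwise_def disjnt_def)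
    qed
    show "?U \<subseteq> (\<Union>i\<in>T. cball (f i) (5 * (s \<circ> f) i))"
    proof
      fix y assume "y \<in> ?U"
      then obtain c where c: "c \<in> C" "y \<in> cball c (5 * s c)" using C(4) by blast
      then have "to_nat_on C c \<in> T" "f (to_nat_on C c) = c"
        using C(1) c(1) by (simp_all add: T_def f_def)
      then have "y \<in> cball (f (to_nat_on C c)) (5 * (s \<circ> f) (to_nat_on C c))"
        using c(2) unfolding comp_apply by simp
      with \<open>to_nat_on C c \<in> T\<close> show "y \<in> (\<Union>i\<in>T. cball (f i) (5 * (s \<circ> f) i))"
        by (rule UN_I)
    qed
  qed
qed

lemma hausdorff_pre_cap:
  assumes "0 < r" "2 * r \<le> \<delta>"
  shows "hausdorff_pre k \<delta> (subsphere I \<inter> cball p r) \<le> ennreal (unit_ball_vol (real k) * r ^ k)"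
proof -
  let ?E = "subsphere I \<inter> cball p r"
  have b: "bounded ?E"
    by (simp add: bounded_Int)
  have d: "diameter ?E \<le> 2 * r"
  proof (rule diameter_le)
    show "norm (x - y) \<le> 2 * r" if "x \<in> ?E" "y \<in> ?E" for x y
      using that dist_triangle2[of x y p] by (simp add: dist_commute flip: dist_norm)
  qed (use assms in auto)
  have "hausdorff_pre k \<delta> ?E \<le> ennreal (hcontent k ?E)"
    using b d assms by (intro hausdorff_pre_single) auto
  also have "hcontent k ?E \<le> unit_ball_vol (real k) * r ^ k"
  proof (cases "?E = {}")
    case True
    then show ?thesis using assms by (simp add: hcontent_def)
  next
    case False
    have "unit_ball_vol (real k) / 2 ^ k * diameter ?E ^ k \<le> unit_ball_vol (real k) / 2 ^ k * (2 * r) ^ k"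
      using d diameter_ge_0[OF b] by (intro mult_left_mono power_mono) auto
    then show ?thesis
      using False by (simp add: hcontent_def power_mult_distrib)
  qed
  finally show ?thesis
    by (simp add: ennreal_leI)
qed

end

subsection \<open>Hausdorff measure from above\<close>

context
  fixes I :: "'a::euclidean_space set"
  assumes I: "I \<subseteq> Basis" and IB: "I \<noteq> Basis"
begin

lemma smeasure_empty: "smeasure I {} = 0"
  by (simp add: smeasure_def[OF I] sector_def)

text \<open>The caps serve twice. Each is covered at a cost of at most \<open>L\<close> times its
  area; and their fivefold enlargements cover everything, which bounds both the premeasure and the
  area of the open set by the total area of the caps, at the price of 5 ^ (codim I - 1). Indices
  outside the Vitali family get the empty cap.\<close>

lemma smeasure_vitali_caps:
  assumes W: "open W" and \<delta>: "\<delta> > 0" and L: "L > 1"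
  obtains cap :: "nat \<Rightarrow> 'a set" where
    "\<And>i. closed (cap i)" "\<And>i. cap i \<subseteq> W \<inter> subsphere I" "disjoint_family cap"
    "\<And>i. hausdorff_pre (codim I - 1) \<delta> (cap i) \<le> ennreal (L * smeasure I (cap i))"
    "hausdorff_pre (codim I - 1) \<delta> (W \<inter> subsphere I) \<le>
      (\<Sum>i. ennreal (5 ^ (codim I - 1) * L * smeasure I (cap i)))"
    "ennreal (smeasure I (W \<inter> subsphere I)) \<le> (\<Sum>i. ennreal (5 ^ (codim I - 1) * L\<^sup>2 * smeasure I (cap i)))"
proof -
  define k where "k = codim I - 1"
  define \<omega> where "\<omega> = unit_ball_vol (real k)"
  let ?S = "subsphere I"
  obtain \<rho>0 where \<rho>0: "\<rho>0 > 0"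
    "\<And>p r. p \<in> ?S \<Longrightarrow> 0 < r \<Longrightarrow> r \<le> \<rho>0 \<Longrightarrow> \<omega> * r ^ k \<le> L * smeasure I (?S \<inter> cball p r)"
    "\<And>p r. 0 < r \<Longrightarrow> r \<le> \<rho>0 \<Longrightarrow> smeasure I (?S \<inter> cball p r) \<le> L * (\<omega> * r ^ k)"
    unfolding \<omega>_def k_def by (rule small_cap_bounds[OF I IB L]) blast
  \<comment> \<open>A fifth of the admissible radius and a tenth of \<delta>, so that the enlarged
    caps still obey the area bounds and have diameter at most \<delta>.\<close>
  define \<rho> where "\<rho> = min (\<rho>0 / 5) (\<delta> / 10)"
  have \<rho>: "\<rho> > 0" using \<rho>0(1) \<delta> by (simp add: \<rho>_def)
  obtain x r T where
    x: "\<And>i::nat. i \<in> T \<Longrightarrow> x i \<in> W \<inter> ?S \<and> 0 < r i \<and> r i \<le> \<rho> \<and> cball (x i) (r i) \<subseteq> W" and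
    disj: "\<And>i j. i \<in> T \<Longrightarrow> j \<in> T \<Longrightarrow> i \<noteq> j \<Longrightarrow> cball (x i) (r i) \<inter> cball (x j) (r j) = {}" and
    cov: "W \<inter> ?S \<subseteq> (\<Union>i\<in>T. cball (x i) (5 * r i))"
    by (rule vitali_sequence[OF I IB W \<rho>]) blast
  define cap where "cap i = (if i \<in> T then ?S \<inter> cball (x i) (r i) else {})" for i
  define cap5 where "cap5 i = (if i \<in> T then ?S \<inter> cball (x i) (5 * r i) else {})" for i
  have r: "0 < r i" "r i \<le> \<rho>0" "5 * r i \<le> \<rho>0" "2 * r i \<le> \<delta>" "2 * (5 * r i) \<le> \<delta>" if "i \<in> T" for i
    using x[OF that] \<delta> \<rho>0(1) by (auto simp: \<rho>_def)
  have xS: "x i \<in> ?S" if "i \<in> T" for i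
    using x[OF that] by blast
  have b0: "smeasure I A \<ge> 0" for A
    by (rule smeasure_nonneg[OF I])
  have main: "\<omega> * r i ^ k \<le> L * smeasure I (cap i)" if "i \<in> T" for i
    using \<rho>0(2)[OF xS r(1,2), OF that that that] that by (simp add: cap_def)
  have pre: "hausdorff_pre k \<delta> (cap i) \<le> ennreal (L * smeasure I (cap i))" for i
  proof (cases "i \<in> T")
    case True
    have "hausdorff_pre k \<delta> (cap i) \<le> ennreal (\<omega> * r i ^ k)"
      unfolding cap_def \<omega>_def using True hausdorff_pre_cap[OF I IB r(1,4)] by simp
    also have "\<dots> \<le> ennreal (L * smeasure I (cap i))"
      by (rule ennreal_leI[OF main[OF True]])
    finally show ?thesis .
  next
    case False
    then show ?thesis using \<delta> by (simp add: cap_def hausdorff_pre_empty)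
  qed
  have pre5: "hausdorff_pre k \<delta> (cap5 i) \<le> ennreal (5 ^ k * L * smeasure I (cap i))" for i
  proof (cases "i \<in> T")
    case True
    have "0 < 5 * r i" using r(1)[OF True] by simp
    then have "hausdorff_pre k \<delta> (cap5 i) \<le> ennreal (\<omega> * (5 * r i) ^ k)"
      unfolding cap5_def \<omega>_def using True hausdorff_pre_cap[OF I IB _ r(5)] by simp
    also have "\<omega> * (5 * r i) ^ k = 5 ^ k * (\<omega> * r i ^ k)"
      by (simp add: power_mult_distrib)
    also have "ennreal (5 ^ k * (\<omega> * r i ^ k)) \<le> ennreal (5 ^ k * (L * smeasure I (cap i)))"
      using main[OF True] by (intro ennreal_leI mult_left_mono) auto
    finally show ?thesis by (simp add: mult.assoc)
  next
    case False
    then show ?thesis using \<delta> by (simp add: cap5_def hausdorff_pre_empty)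
  qed
  have b5: "smeasure I (cap5 i) \<le> 5 ^ k * L\<^sup>2 * smeasure I (cap i)" for i
  proof (cases "i \<in> T")
    case True
    have "0 < 5 * r i" using r(1)[OF True] by simp
    then have "smeasure I (cap5 i) \<le> L * (\<omega> * (5 * r i) ^ k)"
      unfolding cap5_def using True \<rho>0(3)[OF _ r(3)] by simp
    also have "L * (\<omega> * (5 * r i) ^ k) = 5 ^ k * L * (\<omega> * r i ^ k)"
      by (simp add: power_mult_distrib)
    also have "\<dots> \<le> 5 ^ k * L * (L * smeasure I (cap i))"
      using main[OF True] L by (intro mult_left_mono) auto
    finally show ?thesis by (simp add: power2_eq_square mult.assoc)
  next
    case False
    then show ?thesis using b0 by (simp add: cap5_def smeasure_empty)
  qed
  have c: "closed (cap i)" "closed (cap5 i)" for i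
    unfolding cap_def cap5_def by (simp_all add: closed_Int closed_subsphere)
  have Usub: "W \<inter> ?S \<subseteq> (\<Union>i. cap5 i)"
  proof
    fix y assume y: "y \<in> W \<inter> ?S"
    then obtain i where "i \<in> T" "y \<in> cball (x i) (5 * r i)"
      using cov by blast
    then have "y \<in> cap5 i"
      using y by (simp add: cap5_def)
    then show "y \<in> (\<Union>i. cap5 i)" by blast
  qed
  show ?thesis
  proof (rule that[of cap, folded k_def])
    show "closed (cap i)" for i by (rule c)
    show "cap i \<subseteq> W \<inter> ?S" for i
      using x[of i] unfolding cap_def by (cases "i \<in> T") auto
    show "disjoint_family cap"
      unfolding disjoint_family_on_def
    proof (intro ballI impI)
      fix i j :: nat assume "i \<noteq> j"
      then show "cap i \<inter> cap j = {}"
        using disj[of i j] unfolding cap_def by (cases "i \<in> T"; cases "j \<in> T") auto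
    qed
    show "hausdorff_pre k \<delta> (cap i) \<le> ennreal (L * smeasure I (cap i))" for i
      by (rule pre)
    have "hausdorff_pre k \<delta> (W \<inter> ?S) \<le> hausdorff_pre k \<delta> (\<Union>i. cap5 i)"
      by (rule hausdorff_pre_mono[OF Usub])
    also have "\<dots> \<le> (\<Sum>i. hausdorff_pre k \<delta> (cap5 i))"
      by (rule hausdorff_pre_UN)
    also have "\<dots> \<le> (\<Sum>i. ennreal (5 ^ k * L * smeasure I (cap i)))"
      by (intro suminf_le pre5) simp_all
    finally show "hausdorff_pre k \<delta> (W \<inter> ?S) \<le> (\<Sum>i. ennreal (5 ^ k * L * smeasure I (cap i)))" .
    have "ennreal (smeasure I (W \<inter> ?S)) \<le> (\<Sum>i. ennreal (smeasure I (cap5 i)))"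
    proof (rule smeasure_countable_subadditive[OF I _ _ Usub])
      show "W \<inter> ?S \<in> sets borel"
        using borel_open[OF W] borel_closed[OF closed_subsphere] by (rule sets.Int)
      show "cap5 i \<in> sets borel" for i
        by (rule borel_closed[OF c(2)])
    qed
    also have "\<dots> \<le> (\<Sum>i. ennreal (5 ^ k * L\<^sup>2 * smeasure I (cap i)))"
      by (intro suminf_le ennreal_leI b5) simp_all
    finally show "ennreal (smeasure I (W \<inter> ?S)) \<le> (\<Sum>i. ennreal (5 ^ k * L\<^sup>2 * smeasure I (cap i)))" .
  qed
qed

text \<open>Finitely many disjoint small caps fill a fixed proportion of an open set and are covered
  efficiently, so that any constant \<open>\<theta>\<close> valid for all open sets can be moved towards \<open>L\<close> by a fixed
  factor.\<close>

lemma hausdorff_pre_le_smeasure_step: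
  assumes W: "open W" and \<delta>: "\<delta> > 0" and L: "L > 1"
  shows "hausdorff_pre (codim I - 1) \<delta> (W \<inter> subsphere I) \<le>
      ennreal (5 ^ (codim I - 1) * L * smeasure I (W \<inter> subsphere I))"
    and "\<theta> \<ge> L \<Longrightarrow>
      (\<And>V. open V \<Longrightarrow> hausdorff_pre (codim I - 1) \<delta> (V \<inter> subsphere I) \<le> ennreal (\<theta> * smeasure I (V \<inter> subsphere I))) \<Longrightarrow>
      hausdorff_pre (codim I - 1) \<delta> (W \<inter> subsphere I) \<le>
        ennreal ((\<theta> - (\<theta> - L) / (2 * 5 ^ (codim I - 1) * L\<^sup>2)) * smeasure I (W \<inter> subsphere I))"
proof -
  define k where "k = codim I - 1"
  let ?U = "W \<inter> subsphere I"
  obtain cap :: "nat \<Rightarrow> 'a set" where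
    cl: "\<And>i. closed (cap i)" and sub: "\<And>i. cap i \<subseteq> ?U" and disj: "disjoint_family cap" and
    pre: "\<And>i. hausdorff_pre k \<delta> (cap i) \<le> ennreal (L * smeasure I (cap i))" and
    preU: "hausdorff_pre k \<delta> ?U \<le> (\<Sum>i. ennreal (5 ^ k * L * smeasure I (cap i)))" and
    bU: "ennreal (smeasure I ?U) \<le> (\<Sum>i. ennreal (5 ^ k * L\<^sup>2 * smeasure I (cap i)))"
    unfolding k_def by (rule smeasure_vitali_caps[OF W \<delta> L]) blast
  define a where "a i = smeasure I (cap i)" for i
  define b where "b = smeasure I ?U"
  have a0: "a i \<ge> 0" for i unfolding a_def by (rule smeasure_nonneg[OF I])
  have b0: "b \<ge> 0" unfolding b_def by (rule smeasure_nonneg[OF I])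
  have Ub: "?U \<in> sets borel"
    using borel_open[OF W] borel_closed[OF closed_subsphere] by (rule sets.Int)
  have part: "smeasure I (\<Union>i<n. cap i) = (\<Sum>i<n. a i)" for n
    unfolding a_def using cl disj
    by (intro smeasure_finite_UN[OF I] borel_closed) (auto simp: disjoint_family_on_def)
  have parts: "(\<Sum>i<n. a i) \<le> b" for n
  proof -
    have "closed (\<Union>i<n. cap i)" using cl by (intro closed_UN) auto
    moreover have "(\<Union>i<n. cap i) \<subseteq> ?U" using sub by blast
    ultimately show ?thesis
      unfolding part[symmetric] b_def using Ub borel_closed by (intro smeasure_mono[OF I])
  qed
  have summ: "summable a"
    using a0 parts by (rule summableI_nonneg_bounded)
  have suma: "suminf a \<le> b"
    using summ parts by (rule suminf_le_const)
  have ens: "(\<Sum>i. ennreal (c * a i)) = ennreal (c * suminf a)" if "c \<ge> 0" for c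
    using that a0 summ by (intro suminf_ennreal_eq) (auto intro: sums_mult summable_sums)
  have L0: "5 ^ k * L \<ge> 0" "5 ^ k * L\<^sup>2 > 0"
    using L by auto
  have "hausdorff_pre k \<delta> ?U \<le> ennreal (5 ^ k * L * suminf a)"
    using preU unfolding a_def[symmetric] ens[OF L0(1)] .
  also have "\<dots> \<le> ennreal (5 ^ k * L * b)"
    using L0 suma by (intro ennreal_leI mult_left_mono)
  finally show "hausdorff_pre (codim I - 1) \<delta> ?U \<le> ennreal (5 ^ (codim I - 1) * L * smeasure I ?U)"
    unfolding k_def b_def .
  have "ennreal b \<le> ennreal (5 ^ k * L\<^sup>2 * suminf a)"
    using bU unfolding a_def[symmetric] b_def[symmetric] ens[OF less_imp_le[OF L0(2)]] .
  moreover have "0 \<le> 5 ^ k * L\<^sup>2 * suminf a"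
    using L0(2) a0 summ by (intro mult_nonneg_nonneg suminf_nonneg) auto
  ultimately have b_le: "b \<le> 5 ^ k * L\<^sup>2 * suminf a"
    by (simp add: ennreal_le_iff)
  \<comment> \<open>All caps together fill at least the share 1 / (5^k L^2) of the area; half of
    this share is already reached by finitely many.\<close>
  define c where "c = 1 / (2 * 5 ^ k * L\<^sup>2)"
  have cb: "2 * (c * b) \<le> suminf a"
    using b_le L by (simp add: c_def field_simps)
  have c0: "c > 0"
    using L by (simp add: c_def)
  obtain n where n: "c * b \<le> (\<Sum>i<n. a i)"
  proof (cases "b = 0")
    case True
    then show ?thesis using that[of 0] by simp
  next
    case False
    then have "c * b < suminf a"
      using cb c0 b0 mult_pos_pos[of c b] by linarith
    moreover have "(\<lambda>n. \<Sum>i<n. a i) \<longlonglongrightarrow> suminf a"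
      using summ by (rule summable_LIMSEQ)
    ultimately have "\<forall>\<^sub>F n in sequentially. c * b < (\<Sum>i<n. a i)"
      by (intro order_tendstoD)
    then obtain n where "c * b < (\<Sum>i<n. a i)"
      using eventually_happens'[OF sequentially_bot] by blast
    then show ?thesis by (rule that[OF less_imp_le])
  qed
  assume \<theta>: "\<theta> \<ge> L" and hyp: "\<And>V. open V \<Longrightarrow> hausdorff_pre (codim I - 1) \<delta> (V \<inter> subsphere I) \<le> ennreal (\<theta> * smeasure I (V \<inter> subsphere I))"
  \<comment> \<open>Only finitely many caps are removed, so \<open>D\<close> is closed and the
    hypothesis applies to the open remainder \<open>W - D\<close>.\<close>
  define D where "D = (\<Union>i<n. cap i)"
  have D: "closed D" unfolding D_def using cl by (intro closed_UN) auto
  have DU: "D \<subseteq> ?U" unfolding D_def using sub by blast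
  have U_eq: "?U = D \<union> ((W - D) \<inter> subsphere I)"
    using DU by blast
  have bD: "smeasure I ((W - D) \<inter> subsphere I) = b - (\<Sum>i<n. a i)"
  proof -
    have "(W - D) \<inter> subsphere I \<in> sets borel"
      using borel_open[OF open_Diff[OF W D]] borel_closed[OF closed_subsphere] by (rule sets.Int)
    moreover have "D \<inter> ((W - D) \<inter> subsphere I) = {}" by blast
    ultimately have "smeasure I (D \<union> ((W - D) \<inter> subsphere I)) = smeasure I D + smeasure I ((W - D) \<inter> subsphere I)"
      using borel_closed[OF D] by (intro smeasure_Un[OF I])
    then have "b = smeasure I D + smeasure I ((W - D) \<inter> subsphere I)"
      unfolding b_def using U_eq by simp
    moreover have "smeasure I D = (\<Sum>i<n. a i)"
      unfolding D_def by (rule part)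
    ultimately show ?thesis by simp
  qed
  have "hausdorff_pre k \<delta> ?U \<le> hausdorff_pre k \<delta> D + hausdorff_pre k \<delta> ((W - D) \<inter> subsphere I)"
    using hausdorff_pre_Un[of \<delta> k D "(W - D) \<inter> subsphere I"] \<delta> U_eq by simp
  also have "\<dots> \<le> ennreal (L * (\<Sum>i<n. a i)) + ennreal (\<theta> * (b - (\<Sum>i<n. a i)))"
  proof (rule add_mono)
    have "hausdorff_pre k \<delta> D \<le> (\<Sum>i<n. hausdorff_pre k \<delta> (cap i))"
      unfolding D_def using \<delta> by (intro hausdorff_pre_finite_UN) simp
    also have "\<dots> \<le> (\<Sum>i<n. ennreal (L * a i))"
      unfolding a_def by (intro sum_mono pre)
    also have "\<dots> = ennreal (L * (\<Sum>i<n. a i))"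
      using L a0 by (simp add: sum_ennreal sum_distrib_left)
    finally show "hausdorff_pre k \<delta> D \<le> ennreal (L * (\<Sum>i<n. a i))" .
    show "hausdorff_pre k \<delta> ((W - D) \<inter> subsphere I) \<le> ennreal (\<theta> * (b - (\<Sum>i<n. a i)))"
      using hyp[OF open_Diff[OF W D]] unfolding bD k_def .
  qed
  also have "\<dots> = ennreal (L * (\<Sum>i<n. a i) + \<theta> * (b - (\<Sum>i<n. a i)))"
    using L \<theta> parts a0 by (intro ennreal_plus[symmetric] mult_nonneg_nonneg sum_nonneg) auto
  also have "\<dots> \<le> ennreal ((\<theta> - (\<theta> - L) * c) * b)"
  proof (rule ennreal_leI)
    have "(\<theta> - L) * (c * b) \<le> (\<theta> - L) * (\<Sum>i<n. a i)"
      using \<theta> n by (intro mult_left_mono) auto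
    then show "L * (\<Sum>i<n. a i) + \<theta> * (b - (\<Sum>i<n. a i)) \<le> (\<theta> - (\<theta> - L) * c) * b"
      by (simp add: algebra_simps)
  qed
  finally show "hausdorff_pre (codim I - 1) \<delta> ?U \<le>
      ennreal ((\<theta> - (\<theta> - L) / (2 * 5 ^ (codim I - 1) * L\<^sup>2)) * smeasure I ?U)"
    by (simp add: c_def b_def k_def)
qed

text \<open>Each step multiplies the excess of the constant over \<open>L\<close> by q < 1, starting
  from the crude constant 5^k L with k = \<open>codim I - 1\<close>. The induction is over all open
  sets at once, since what remains after removing caps is another open set.\<close>

lemma hausdorff_pre_le_smeasure:
  assumes W: "open W" and \<delta>: "\<delta> > 0" and L: "L > 1"
  shows "hausdorff_pre (codim I - 1) \<delta> (W \<inter> subsphere I) \<le> ennreal (L * smeasure I (W \<inter> subsphere I))"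
proof -
  define q where "q = 1 - 1 / (2 * 5 ^ (codim I - 1) * L\<^sup>2)"
  have "1 \<le> (5::real) ^ (codim I - 1)" "1 \<le> L\<^sup>2"
    using L by (simp_all add: one_le_power)
  then have "1 * 1 \<le> 5 ^ (codim I - 1) * L\<^sup>2"
    by (intro mult_mono) auto
  then have q: "0 \<le> q" "q < 1"
    by (auto simp: q_def field_simps)
  define M where "M = (5 ^ (codim I - 1) - 1) * L"
  have M: "M \<ge> 0"
    using L by (simp add: M_def)
  have *: "hausdorff_pre (codim I - 1) \<delta> (V \<inter> subsphere I) \<le> ennreal ((L + q ^ j * M) * smeasure I (V \<inter> subsphere I))"
    if "open V" for V and j :: nat
    using that
  proof (induction j arbitrary: V)
    case 0
    then show ?case
      using hausdorff_pre_le_smeasure_step(1)[OF 0 \<delta> L] by (simp add: M_def algebra_simps)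
  next
    case (Suc j)
    have "L \<le> L + q ^ j * M" using q M by simp
    then have "hausdorff_pre (codim I - 1) \<delta> (V \<inter> subsphere I) \<le>
        ennreal ((L + q ^ j * M - (L + q ^ j * M - L) / (2 * 5 ^ (codim I - 1) * L\<^sup>2)) * smeasure I (V \<inter> subsphere I))"
      using Suc.IH by (rule hausdorff_pre_le_smeasure_step(2)[OF Suc.prems \<delta> L])
    also have "L + q ^ j * M - (L + q ^ j * M - L) / (2 * 5 ^ (codim I - 1) * L\<^sup>2) = L + q ^ Suc j * M"
      by (simp add: q_def algebra_simps)
    finally show ?case .
  qed
  have "(\<lambda>j. (L + q ^ j * M) * smeasure I (W \<inter> subsphere I)) \<longlonglongrightarrow> (L + 0 * M) * smeasure I (W \<inter> subsphere I)"
    using q by (intro tendsto_intros LIMSEQ_realpow_zero)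
  then have "(\<lambda>j. ennreal ((L + q ^ j * M) * smeasure I (W \<inter> subsphere I))) \<longlonglongrightarrow> ennreal (L * smeasure I (W \<inter> subsphere I))"
    by (intro tendsto_ennrealI) simp
  then show ?thesis
    by (rule LIMSEQ_le_const) (use * W in blast)
qed

lemma hausdorff_measure_subsphere:
  "hausdorff_measure (codim I - 1) (subsphere I) = ennreal (codim I * unit_ball_vol (codim I))"
proof (rule antisym)
  have b: "smeasure I (subsphere I) = codim I * unit_ball_vol (codim I)"
    by (rule smeasure_subsphere[OF I IB])
  show "ennreal (codim I * unit_ball_vol (codim I)) \<le> hausdorff_measure (codim I - 1) (subsphere I)"
    using smeasure_le_hausdorff_measure[OF I IB closed_subsphere order_refl] unfolding b .
  show "hausdorff_measure (codim I - 1) (subsphere I) \<le> ennreal (codim I * unit_ball_vol (codim I))"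
    unfolding hausdorff_measure_def
  proof (rule SUP_least)
    fix \<delta> :: real assume "\<delta> \<in> {0<..}"
    then have \<delta>: "\<delta> > 0" by simp
    \<comment> \<open>The bound is the same for every \<delta>, so \<open>L\<close> may tend to 1
      with \<delta> fixed.\<close>
    show "hausdorff_pre (codim I - 1) \<delta> (subsphere I) \<le> ennreal (codim I * unit_ball_vol (codim I))"
    proof (rule tendsto_lowerbound)
      have "((\<lambda>L. L * smeasure I (subsphere I)) \<longlongrightarrow> 1 * smeasure I (subsphere I)) (at_right 1)"
        by (intro tendsto_intros)
      then show "((\<lambda>L. ennreal (L * smeasure I (subsphere I))) \<longlongrightarrow> ennreal (codim I * unit_ball_vol (codim I))) (at_right 1)"
        unfolding b[symmetric] by (intro tendsto_ennrealI) simp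
      show "\<forall>\<^sub>F L in at_right 1. hausdorff_pre (codim I - 1) \<delta> (subsphere I) \<le> ennreal (L * smeasure I (subsphere I))"
      proof (rule eventually_at_rightI[of 1 2])
        fix L :: real assume "L \<in> {1<..<2}"
        then show "hausdorff_pre (codim I - 1) \<delta> (subsphere I) \<le> ennreal (L * smeasure I (subsphere I))"
          using hausdorff_pre_le_smeasure[OF open_UNIV \<delta>, of L] by simp
      qed simp
    qed simp
  qed
qed

end

subsection \<open>The scale-invariant measure\<close>

text \<open>With this density the mass of a cone between two radii may be computed with the distance to an
  axis in place of the norm, and on the lines parallel to the axis a rotationally symmetric cone then
  always has the same share.\<close>

definition radial :: "'a::euclidean_space measure" where
  "radial = density lborel (\<lambda>z. ennreal (inverse (norm z ^ DIM('a))))"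

lemma sets_radial [measurable_cong, simp]: "sets radial = sets borel"
  by (simp add: radial_def)

lemma emeasure_radial:
  fixes A :: "'a::euclidean_space set"
  shows "A \<in> sets borel \<Longrightarrow> emeasure radial A = (\<integral>\<^sup>+z. ennreal (inverse (norm z ^ DIM('a))) * indicator A z \<partial>lborel)"
  unfolding radial_def by (subst emeasure_density) auto

lemma nn_integral_lborel_scale:
  fixes f :: "'a::euclidean_space \<Rightarrow> ennreal"
  assumes [measurable]: "f \<in> borel_measurable borel" and c: "c > 0"
  shows "(\<integral>\<^sup>+z. f z \<partial>lborel) = ennreal (c ^ DIM('a)) * (\<integral>\<^sup>+z. f (c *\<^sub>R z) \<partial>lborel)"
proof -
  have "(lborel :: 'a measure) = density (distr lborel borel (\<lambda>x. 0 + c *\<^sub>R x)) (\<lambda>_. ennreal (\<bar>c\<bar> ^ DIM('a)))"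
    using c by (intro lborel_affine) simp
  then have "(\<integral>\<^sup>+z. f z \<partial>lborel) = (\<integral>\<^sup>+z. f z \<partial>density (distr lborel borel (\<lambda>x::'a. 0 + c *\<^sub>R x)) (\<lambda>_. ennreal (\<bar>c\<bar> ^ DIM('a))))"
    by simp
  also have "\<dots> = (\<integral>\<^sup>+z. ennreal (\<bar>c\<bar> ^ DIM('a)) * f z \<partial>distr lborel borel (\<lambda>x::'a. 0 + c *\<^sub>R x))"
    by (rule nn_integral_density) simp_all
  also have "\<dots> = (\<integral>\<^sup>+z. ennreal (\<bar>c\<bar> ^ DIM('a)) * f (0 + c *\<^sub>R z) \<partial>lborel)"
    by (rule nn_integral_distr) simp_all
  also have "\<dots> = ennreal (c ^ DIM('a)) * (\<integral>\<^sup>+z. f (c *\<^sub>R z) \<partial>lborel)"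
    using c by (subst nn_integral_cmult) simp_all
  finally show ?thesis .
qed

text \<open>The density is homogeneous of degree minus the dimension, which cancels the Jacobian of
  the dilation.\<close>

lemma emeasure_radial_scale:
  fixes A :: "'a::euclidean_space set"
  assumes A: "A \<in> sets borel" and c: "c > 0"
  shows "emeasure radial ((\<lambda>z. c *\<^sub>R z) -` A) = emeasure radial A"
proof -
  have [measurable]: "A \<in> sets borel" by (rule A)
  have "(\<lambda>z::'a. c *\<^sub>R z) \<in> borel_measurable borel" by measurable
  from measurable_sets[OF this A] have A': "(\<lambda>z. c *\<^sub>R z) -` A \<in> sets borel" by simp
  have "emeasure radial A = (\<integral>\<^sup>+z. ennreal (inverse (norm z ^ DIM('a))) * indicator A z \<partial>lborel)"
    by (rule emeasure_radial[OF A])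
  also have "\<dots> = ennreal (c ^ DIM('a)) * (\<integral>\<^sup>+z. ennreal (inverse (norm (c *\<^sub>R z) ^ DIM('a))) * indicator A (c *\<^sub>R z) \<partial>lborel)"
    using c by (intro nn_integral_lborel_scale) simp_all
  also have "\<dots> = (\<integral>\<^sup>+z. ennreal (c ^ DIM('a)) * (ennreal (inverse (norm (c *\<^sub>R z) ^ DIM('a))) * indicator A (c *\<^sub>R z)) \<partial>lborel)"
    by (rule nn_integral_cmult[symmetric]) simp
  also have "\<dots> = (\<integral>\<^sup>+z. ennreal (inverse (norm z ^ DIM('a))) * indicator ((\<lambda>z. c *\<^sub>R z) -` A) z \<partial>lborel)"
  proof (rule nn_integral_cong)
    fix z :: 'a
    have "c ^ DIM('a) * inverse (norm (c *\<^sub>R z) ^ DIM('a)) = inverse (norm z ^ DIM('a))"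
      using c by (simp add: power_mult_distrib inverse_mult_distrib)
    then have "ennreal (c ^ DIM('a)) * ennreal (inverse (norm (c *\<^sub>R z) ^ DIM('a))) = ennreal (inverse (norm z ^ DIM('a)))"
      using c by (subst ennreal_mult'[symmetric]) auto
    then show "ennreal (c ^ DIM('a)) * (ennreal (inverse (norm (c *\<^sub>R z) ^ DIM('a))) * indicator A (c *\<^sub>R z)) =
        ennreal (inverse (norm z ^ DIM('a))) * indicator ((\<lambda>z. c *\<^sub>R z) -` A) z"
      by (simp add: indicator_def mult.assoc[symmetric])
  qed
  also have "\<dots> = emeasure radial ((\<lambda>z. c *\<^sub>R z) -` A)"
    by (rule emeasure_radial[OF A', symmetric])
  finally show ?thesis ..
qed

text \<open>Level 1 of the logarithmic scale is the half-open shell from 1 to q. Positivity is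
  stated separately, as \<open>log\<close> carries no information at other arguments.\<close>

lemma ceiling_log_eq_1_iff:
  assumes "q > 1"
  shows "x > 0 \<and> \<lceil>log q x\<rceil> = 1 \<longleftrightarrow> 1 < x \<and> x \<le> q"
proof -
  have "\<lceil>log q x\<rceil> = 1 \<longleftrightarrow> 0 < log q x \<and> log q x \<le> 1"
    by (auto simp: ceiling_eq_iff)
  then show ?thesis
    using assms by (cases "x > 0") (auto simp: zero_less_log_cancel_iff log_le_one_cancel_iff)
qed

lemma cone_scale_iff:
  fixes K :: "'a::real_vector set"
  assumes cone: "\<And>z t. z \<in> K \<Longrightarrow> t > 0 \<Longrightarrow> t *\<^sub>R z \<in> K" and c: "c > 0"
  shows "c *\<^sub>R z \<in> K \<longleftrightarrow> z \<in> K"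
proof
  assume "c *\<^sub>R z \<in> K"
  then have "(1 / c) *\<^sub>R (c *\<^sub>R z) \<in> K"
    by (rule cone) (use c in simp)
  then have "(1 / c * c) *\<^sub>R z \<in> K" by (simp only: scaleR_scaleR)
  then show "z \<in> K" using c by simp
qed (use cone c in blast)

text \<open>In a cone, both shells are fundamental domains for the scaling by \<open>q\<close>, which preserves the
  measure.\<close>

lemma radial_gauge_swap:
  fixes K :: "'a::euclidean_space set"
  assumes K: "K \<in> sets borel" and cone: "\<And>z t. z \<in> K \<Longrightarrow> t > 0 \<Longrightarrow> t *\<^sub>R z \<in> K"
    and g [measurable]: "g \<in> borel_measurable borel" and hg: "\<And>t z. t > 0 \<Longrightarrow> g (t *\<^sub>R z) = t * g z"
    and h [measurable]: "h \<in> borel_measurable borel" and hh: "\<And>t z. t > 0 \<Longrightarrow> h (t *\<^sub>R z) = t * h z"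
    and q: "(q::real) > 1"
  shows "emeasure radial {z\<in>K. 1 < g z \<and> g z \<le> q \<and> 0 < h z} =
    emeasure radial {z\<in>K. 1 < h z \<and> h z \<le> q \<and> 0 < g z}"
proof -
  have [measurable]: "K \<in> sets borel" by (rule K)
  \<comment> \<open>Level \<open>j\<close> of a gauge means a value above q^(j-1) and at most q^j.
    The shell for \<open>g\<close> is the row j = 1, the shell for \<open>h\<close> the column k =
    1.\<close>
  define A where "A j k = {z\<in>K. 0 < g z \<and> 0 < h z \<and> \<lceil>log q (g z)\<rceil> = j \<and> \<lceil>log q (h z)\<rceil> = k}" for j k
  have Ab: "A j k \<in> sets borel" for j k
  proof -
    have "{z \<in> space borel. z \<in> K \<and> 0 < g z \<and> 0 < h z \<and> \<lceil>log q (g z)\<rceil> = j \<and> \<lceil>log q (h z)\<rceil> = k} \<in> sets borel"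
      by measurable
    then show ?thesis by (simp add: A_def)
  qed
  \<comment> \<open>Scaling by q^(k-1) raises both levels by k - 1 and so carries
    \<open>A (2 - k) 1\<close> onto \<open>A 1 k\<close>.\<close>
  have shift: "emeasure radial (A 1 k) = emeasure radial (A (2 - k) 1)" for k
  proof -
    define c where "c = q powr (real_of_int (k - 1))"
    have c: "c > 0" and c': "q > 0" using q by (auto simp: c_def)
    have lev: "\<lceil>log q (c * x)\<rceil> = (k - 1) + \<lceil>log q x\<rceil>" if "x > 0" for x
    proof -
      have "log q (c * x) = real_of_int (k - 1) + log q x"
        using that c q by (subst log_mult) (auto simp: c_def)
      then show ?thesis by (simp only: ceiling_add_of_int add.commute)
    qed
    have Kc: "c *\<^sub>R z \<in> K \<longleftrightarrow> z \<in> K" for z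
      using cone c by (rule cone_scale_iff)
    have "(\<lambda>z. c *\<^sub>R z) -` A 1 k = A (2 - k) 1"
    proof (intro set_eqI)
      fix z
      have "c *\<^sub>R z \<in> A 1 k \<longleftrightarrow> z \<in> K \<and> 0 < g z \<and> 0 < h z \<and> \<lceil>log q (c * g z)\<rceil> = 1 \<and> \<lceil>log q (c * h z)\<rceil> = k"
        unfolding A_def mem_Collect_eq Kc hg[OF c] hh[OF c] using c by (simp add: zero_less_mult_iff)
      also have "\<dots> \<longleftrightarrow> z \<in> K \<and> 0 < g z \<and> 0 < h z \<and> \<lceil>log q (g z)\<rceil> = 2 - k \<and> \<lceil>log q (h z)\<rceil> = 1"
        using lev[of "g z"] lev[of "h z"] by fastforce
      finally show "z \<in> (\<lambda>z. c *\<^sub>R z) -` A 1 k \<longleftrightarrow> z \<in> A (2 - k) 1"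
        by (simp add: A_def)
    qed
    then show ?thesis
      using emeasure_radial_scale[OF Ab c, of 1 k] by simp
  qed
  have g1: "{z\<in>K. 1 < g z \<and> g z \<le> q \<and> 0 < h z} = (\<Union>k::int. A 1 k)"
    using ceiling_log_eq_1_iff[OF q] by (auto simp: A_def)
  have h1: "{z\<in>K. 1 < h z \<and> h z \<le> q \<and> 0 < g z} = (\<Union>j::int. A j 1)"
    using ceiling_log_eq_1_iff[OF q] by (auto simp: A_def)
  have "emeasure radial (\<Union>k::int. A 1 k) = (\<integral>\<^sup>+k. emeasure radial (A 1 k) \<partial>count_space UNIV)"
    using Ab by (intro emeasure_UN_countable) (auto simp: disjoint_family_on_def A_def)
  also have "\<dots> = (\<integral>\<^sup>+k. emeasure radial (A (2 - k) 1) \<partial>count_space UNIV)"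
    by (simp only: shift)
  also have "\<dots> = (\<integral>\<^sup>+j. emeasure radial (A j 1) \<partial>count_space UNIV)"
  proof (rule nn_integral_bij_count_space)
    show "bij_betw (\<lambda>k::int. 2 - k) UNIV UNIV"
      by (rule bij_betwI[where g = "\<lambda>k. 2 - k"]) auto
  qed
  also have "\<dots> = emeasure radial (\<Union>j::int. A j 1)"
    using Ab by (intro emeasure_UN_countable[symmetric]) (auto simp: disjoint_family_on_def A_def)
  finally show ?thesis
    unfolding g1 h1 .
qed

section \<open>Distance from an axis\<close>

definition rad :: "'a::euclidean_space \<Rightarrow> 'a \<Rightarrow> real" where
  "rad v z = norm (z - (z \<bullet> v) *\<^sub>R v)"

lemma rad_measurable [measurable]: "rad v \<in> borel_measurable borel"
  unfolding rad_def[abs_def] by measurable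

lemma rad_scale: "t > 0 \<Longrightarrow> rad v (t *\<^sub>R z) = t * rad v z"
proof -
  assume "t > 0"
  have "t *\<^sub>R z - ((t *\<^sub>R z) \<bullet> v) *\<^sub>R v = t *\<^sub>R (z - (z \<bullet> v) *\<^sub>R v)"
    by (simp add: scaleR_diff_right)
  then show ?thesis
    using \<open>t > 0\<close> by (simp add: rad_def)
qed

context
  fixes v :: "'a::euclidean_space"
  assumes v: "norm v = 1" and dim2: "DIM('a) \<ge> 2"
begin

lemma inner_axis_self: "v \<bullet> v = 1"
  unfolding dot_square_norm v by simp

lemma rad_shift: "rad v (z + s *\<^sub>R v) = rad v z"
  unfolding rad_def inner_add_left inner_scaleR_left inner_axis_self by (simp add: scaleR_add_left)

lemma norm_rad: "(norm z)\<^sup>2 = (z \<bullet> v)\<^sup>2 + (rad v z)\<^sup>2"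
proof -
  have "(rad v z)\<^sup>2 = (norm z)\<^sup>2 - (z \<bullet> v)\<^sup>2"
    unfolding rad_def power2_norm_eq_inner inner_diff_left inner_diff_right inner_scaleR_left inner_scaleR_right inner_axis_self
    by (simp add: inner_commute power2_eq_square)
  then show ?thesis by simp
qed

lemma rad_le_norm: "rad v z \<le> norm z"
proof (rule power2_le_imp_le)
  show "(rad v z)\<^sup>2 \<le> (norm z)\<^sup>2"
    unfolding norm_rad by simp
qed simp

lemma axis_null: "{z. rad v z = 0} \<in> null_sets lborel"
proof -
  have "{z. rad v z = 0} \<subseteq> span {v}"
  proof
    fix z assume "z \<in> {z. rad v z = 0}"
    then have "z = (z \<bullet> v) *\<^sub>R v"
      by (simp add: rad_def)
    then show "z \<in> span {v}"
      by (metis span_base span_scale singletonI)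
  qed
  moreover have "negligible (span {v})"
  proof (rule negligible_lowdim)
    have "dim (span {v}) \<le> 1"
      using dim_le_card'[of "{v}"] by simp
    then show "dim (span {v}) < DIM('a)"
      using dim2 by linarith
  qed
  ultimately have "negligible {z. rad v z = 0}"
    by (rule negligible_subset[rotated])
  moreover have "{z. rad v z = 0} \<in> sets borel"
    by measurable
  ultimately show ?thesis
    by (simp add: negligible_iff_null_sets null_sets_completion_iff)
qed

end

subsection \<open>Star-shaped cones meet caps\<close>

text \<open>Up to a scalar, the density on a line parallel to the axis, in terms of height divided
  by distance from the axis. For N \<ge> 2 its integral is the quotient of the areas of the unit
  spheres in R^N and R^(N-1).\<close>

definition profile :: "nat \<Rightarrow> real \<Rightarrow> real" where
  "profile N t = inverse (sqrt (1 + t\<^sup>2) ^ N)"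

definition tail_mass :: "nat \<Rightarrow> real \<Rightarrow> ennreal" where
  "tail_mass N \<kappa> = (\<integral>\<^sup>+t. ennreal (profile N t) * indicator {\<kappa>..} t \<partial>lborel)"

definition total_mass :: "nat \<Rightarrow> ennreal" where
  "total_mass N = (\<integral>\<^sup>+t. ennreal (profile N t) \<partial>lborel)"

lemma profile_measurable [measurable]: "profile N \<in> borel_measurable borel"
  unfolding profile_def[abs_def] by measurable

lemma profile_le: "N \<ge> 2 \<Longrightarrow> profile N t \<le> inverse (1 + t\<^sup>2)"
proof -
  assume N: "N \<ge> 2"
  have "1 + t\<^sup>2 = sqrt (1 + t\<^sup>2) ^ 2"
    by simp
  also have "\<dots> \<le> sqrt (1 + t\<^sup>2) ^ N"
    using N by (intro power_increasing) auto
  finally show ?thesis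
    unfolding profile_def by (intro le_imp_inverse_le) (auto simp: add_pos_nonneg)
qed

lemma total_mass_eq: "total_mass N = tail_mass N 0 + tail_mass N 0"
proof -
  have neg: "(\<integral>\<^sup>+t. ennreal (profile N t) * indicator {..0} t \<partial>lborel) = tail_mass N 0"
  proof -
    have "(\<integral>\<^sup>+t. ennreal (profile N t) * indicator {..0} t \<partial>lborel) =
        ennreal \<bar>-1\<bar> * (\<integral>\<^sup>+t. ennreal (profile N (0 + (-1) * t)) * indicator {..0} (0 + (-1) * t) \<partial>lborel)"
      by (rule nn_integral_real_affine) simp_all
    also have "\<dots> = tail_mass N 0"
      unfolding tail_mass_def by (simp add: profile_def indicator_def)
    finally show ?thesis .
  qed
  have "total_mass N = (\<integral>\<^sup>+t. ennreal (profile N t) * indicator {0..} t + ennreal (profile N t) * indicator {..0} t \<partial>lborel)"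
    unfolding total_mass_def
  proof (rule nn_integral_cong_AE)
    have "AE t in lborel. t \<noteq> (0::real)"
      by (rule AE_lborel_singleton)
    then show "AE t in lborel. ennreal (profile N t) =
        ennreal (profile N t) * indicator {0..} t + ennreal (profile N t) * indicator {..0} t"
      by eventually_elim (auto simp: indicator_def)
  qed
  also have "\<dots> = tail_mass N 0 + tail_mass N 0"
    unfolding neg[symmetric] by (subst nn_integral_add) (simp_all add: neg tail_mass_def)
  finally show ?thesis .
qed

lemma tail_mass_finite: "N \<ge> 2 \<Longrightarrow> tail_mass N 0 < \<infinity>"
proof -
  assume N: "N \<ge> 2"
  have "tail_mass N 0 \<le> (\<integral>\<^sup>+t. ennreal (inverse (1 + t\<^sup>2)) * indicator {0..} t \<partial>lborel)"
    unfolding tail_mass_def by (intro nn_integral_mono mult_right_mono ennreal_leI profile_le N) simp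
  also have "\<dots> = ennreal (pi / 2 - arctan 0)"
    by (rule nn_integral_FTC_atLeast)
      (auto intro!: tendsto_arctan_at_top DERIV_arctan add_nonneg_nonneg)
  finally show ?thesis
    using order_le_less_trans by fastforce
qed

text \<open>The profile is at most 1/(1 + t^2), the derivative of arctan, whose integral from 0 to
  \<open>tan a\<close> is \<open>a\<close>. This makes the loss in the final bound linear in the
  angle.\<close>

lemma tail_mass_diff:
  assumes N: "N \<ge> 2" and a: "0 < a" "a < pi / 2"
  shows "tail_mass N 0 \<le> tail_mass N (tan a) + ennreal a"
proof -
  have t: "tan a > 0"
    using a by (intro tan_gt_zero) auto
  have "tail_mass N 0 \<le> (\<integral>\<^sup>+t. ennreal (profile N t) * indicator {tan a..} t +
      ennreal (inverse (1 + t\<^sup>2)) * indicator {0..tan a} t \<partial>lborel)"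
    unfolding tail_mass_def
  proof (rule nn_integral_mono)
    fix t :: real
    have "ennreal (profile N t) \<le> ennreal (inverse (1 + t\<^sup>2))"
      by (rule ennreal_leI[OF profile_le[OF N]])
    then show "ennreal (profile N t) * indicator {0..} t \<le> ennreal (profile N t) * indicator {tan a..} t +
        ennreal (inverse (1 + t\<^sup>2)) * indicator {0..tan a} t"
      by (cases "t \<ge> tan a") (auto simp: indicator_def)
  qed
  also have "\<dots> = tail_mass N (tan a) + (\<integral>\<^sup>+t. ennreal (inverse (1 + t\<^sup>2)) * indicator {0..tan a} t \<partial>lborel)"
    unfolding tail_mass_def by (subst nn_integral_add) simp_all
  also have "(\<integral>\<^sup>+t. ennreal (inverse (1 + t\<^sup>2)) * indicator {0..tan a} t \<partial>lborel) = ennreal (arctan (tan a) - arctan 0)"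
    using t by (intro nn_integral_FTC_Icc)
      (auto intro!: DERIV_arctan[THEN has_field_derivative_at_within] add_nonneg_nonneg
        simp flip: has_real_derivative_iff_has_vector_derivative)
  also have "arctan (tan a) - arctan 0 = a"
    using a by (simp add: arctan_tan)
  finally show ?thesis .
qed

section \<open>Integration along lines parallel to an axis\<close>

context
  fixes v :: "'a::euclidean_space"
  assumes v: "norm v = 1" and dim2: "DIM('a) \<ge> 2"
begin

text \<open>A parametrisation of the line through \<open>z\<close> by the slope seen from the
  origin. In this parameter a circular cone about \<open>v\<close> meets every line off the axis in
  the same half-line.\<close>

definition fiber_point :: "'a \<Rightarrow> real \<Rightarrow> 'a" where
  "fiber_point z t = (z - (z \<bullet> v) *\<^sub>R v) + (rad v z * t) *\<^sub>R v"

lemma fiber_point_inner: "fiber_point z t \<bullet> v = rad v z * t"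
  unfolding fiber_point_def inner_add_left inner_diff_left inner_scaleR_left inner_axis_self[OF v dim2] by simp

lemma rad_fiber_point: "rad v (fiber_point z t) = rad v z"
proof -
  have "fiber_point z t = z + (rad v z * t - z \<bullet> v) *\<^sub>R v"
    by (simp add: fiber_point_def scaleR_diff_left algebra_simps)
  then show ?thesis
    by (simp add: rad_shift[OF v dim2])
qed

lemma norm_fiber_point: "norm (fiber_point z t) = rad v z * sqrt (1 + t\<^sup>2)"
proof -
  have "norm (fiber_point z t) = sqrt ((rad v z * t)\<^sup>2 + (rad v z)\<^sup>2)"
    using norm_rad[OF v dim2, of "fiber_point z t"] unfolding fiber_point_inner rad_fiber_point
    by (metis norm_ge_zero real_sqrt_abs abs_of_nonneg)
  also have "(rad v z * t)\<^sup>2 + (rad v z)\<^sup>2 = (rad v z)\<^sup>2 * (1 + t\<^sup>2)"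
    by (simp add: power_mult_distrib algebra_simps)
  finally show ?thesis
    by (simp add: real_sqrt_mult rad_def)
qed

text \<open>After the substitution s = - (z \<bullet> v) + rad v z * t the norm is
  \<open>rad v z * sqrt (1 + t\<^sup>2)\<close>, so the dependence of the density on the line
  reduces to a scalar factor.\<close>

lemma fiber_integral:
  fixes A :: "'a set"
  assumes A: "A \<in> sets borel" and \<rho>: "rad v z > 0"
  shows "(\<integral>\<^sup>+s. ennreal (inverse (norm (z + s *\<^sub>R v) ^ DIM('a))) * indicator A (z + s *\<^sub>R v) \<partial>lborel) =
    ennreal (rad v z * inverse (rad v z ^ DIM('a))) *
      (\<integral>\<^sup>+t. ennreal (profile DIM('a) t) * indicator A (fiber_point z t) \<partial>lborel)"
proof -
  have [measurable]: "A \<in> sets borel" by (rule A)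
  let ?f = "\<lambda>s. ennreal (inverse (norm (z + s *\<^sub>R v) ^ DIM('a))) * indicator A (z + s *\<^sub>R v)"
  have fp: "z + (- (z \<bullet> v) + rad v z * t) *\<^sub>R v = fiber_point z t" for t
    by (simp add: fiber_point_def scaleR_add_left scaleR_diff_left)
  have m: "(\<lambda>t. ennreal (profile DIM('a) t) * indicator A (fiber_point z t)) \<in> borel_measurable borel"
    unfolding fiber_point_def by measurable
  have "(\<integral>\<^sup>+s. ?f s \<partial>lborel) = ennreal \<bar>rad v z\<bar> * (\<integral>\<^sup>+t. ?f (- (z \<bullet> v) + rad v z * t) \<partial>lborel)"
    using \<rho> by (intro nn_integral_real_affine) simp_all
  also have "(\<integral>\<^sup>+t. ?f (- (z \<bullet> v) + rad v z * t) \<partial>lborel) =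
      (\<integral>\<^sup>+t. ennreal (inverse (rad v z ^ DIM('a))) * (ennreal (profile DIM('a) t) * indicator A (fiber_point z t)) \<partial>lborel)"
  proof (rule nn_integral_cong)
    fix t
    have "inverse (norm (fiber_point z t) ^ DIM('a)) = inverse (rad v z ^ DIM('a)) * profile DIM('a) t"
      unfolding norm_fiber_point by (simp add: power_mult_distrib inverse_mult_distrib profile_def)
    then have "ennreal (inverse (norm (fiber_point z t) ^ DIM('a))) = ennreal (inverse (rad v z ^ DIM('a))) * ennreal (profile DIM('a) t)"
      using \<rho> by (simp add: ennreal_mult' flip: ennreal_mult)
    then show "?f (- (z \<bullet> v) + rad v z * t) =
        ennreal (inverse (rad v z ^ DIM('a))) * (ennreal (profile DIM('a) t) * indicator A (fiber_point z t))"
      unfolding fp by (simp add: mult.assoc)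
  qed
  also have "\<dots> = ennreal (inverse (rad v z ^ DIM('a))) * (\<integral>\<^sup>+t. ennreal (profile DIM('a) t) * indicator A (fiber_point z t) \<partial>lborel)"
    using m by (intro nn_integral_cmult) simp
  finally show ?thesis
    using \<rho> by (simp add: ennreal_mult' mult.assoc)
qed

text \<open>This collects what depends on the line alone: the slab for base points, the shell, and
  the factor left by the substitution.\<close>

definition fiber_weight :: "real \<Rightarrow> 'a \<Rightarrow> ennreal" where
  "fiber_weight q z = indicator {z. \<bar>z \<bullet> v\<bar> \<le> 1/2 \<and> 1 < rad v z \<and> rad v z \<le> q} z *
     ennreal (rad v z * inverse (rad v z ^ DIM('a)))"

lemma fiber_weight_measurable [measurable]: "fiber_weight q \<in> borel_measurable borel"
  unfolding fiber_weight_def[abs_def] by measurable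

definition fiber_mass :: "'a set \<Rightarrow> 'a \<Rightarrow> ennreal" where
  "fiber_mass A z = (\<integral>\<^sup>+t. ennreal (profile DIM('a) t) * indicator A (fiber_point z t) \<partial>lborel)"

lemma fiber_mass_measurable:
  assumes A: "A \<in> sets borel"
  shows "fiber_mass A \<in> borel_measurable borel"
proof -
  have [measurable]: "A \<in> sets borel" by (rule A)
  have "(\<lambda>(z, t). ennreal (profile DIM('a) t) * indicator A (fiber_point z t)) \<in> borel_measurable (borel \<Otimes>\<^sub>M lborel)"
    unfolding fiber_point_def rad_def by measurable
  then show ?thesis
    unfolding fiber_mass_def[abs_def] by (rule lborel.borel_measurable_nn_integral)
qed

text \<open>\<open>rad v\<close> is constant along each line, so the shell condition moves from the
  set into the weight. A shell given by the norm would cut the fibres instead.\<close>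

lemma radial_fibers:
  fixes A :: "'a set"
  assumes A: "A \<in> sets borel"
  shows "emeasure radial {z\<in>A. 1 < rad v z \<and> rad v z \<le> q} = (\<integral>\<^sup>+z. fiber_weight q z * fiber_mass A z \<partial>lborel)"
proof -
  have [measurable]: "A \<in> sets borel" by (rule A)
  let ?S = "{z\<in>A. 1 < rad v z \<and> rad v z \<le> q}"
  have "{z\<in>space borel. z \<in> A \<and> 1 < rad v z \<and> rad v z \<le> q} \<in> sets borel" by measurable
  then have S [measurable]: "?S \<in> sets borel" by simp
  let ?f = "\<lambda>z::'a. ennreal (inverse (norm z ^ DIM('a))) * indicator ?S z"
  have "emeasure radial ?S = (\<integral>\<^sup>+z. ?f z \<partial>lborel)"
    by (rule emeasure_radial[OF S])
  also have "\<dots> = (\<integral>\<^sup>+z. indicator {z. \<bar>z \<bullet> v\<bar> \<le> 1/2} z * (\<integral>\<^sup>+s. ?f (z + s *\<^sub>R v) \<partial>lborel) \<partial>lborel)"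
    by (rule nn_integral_lborel_fibers[OF _ v]) simp
  also have "\<dots> = (\<integral>\<^sup>+z. fiber_weight q z * fiber_mass A z \<partial>lborel)"
  proof (rule nn_integral_cong)
    fix z
    show "indicator {z. \<bar>z \<bullet> v\<bar> \<le> 1/2} z * (\<integral>\<^sup>+s. ?f (z + s *\<^sub>R v) \<partial>lborel) = fiber_weight q z * fiber_mass A z"
    proof (cases "1 < rad v z \<and> rad v z \<le> q")
      case True
      then have "indicator ?S (z + s *\<^sub>R v) = (indicator A (z + s *\<^sub>R v) :: ennreal)" for s
        by (simp add: indicator_def rad_shift[OF v dim2])
      moreover have "rad v z > 0" using True by linarith
      ultimately have "(\<integral>\<^sup>+s. ?f (z + s *\<^sub>R v) \<partial>lborel) =
          ennreal (rad v z * inverse (rad v z ^ DIM('a))) * fiber_mass A z"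
        unfolding fiber_mass_def by (simp only: fiber_integral[OF A])
      then show ?thesis
        using True by (simp add: fiber_weight_def indicator_def)
    next
      case False
      then have "indicator ?S (z + s *\<^sub>R v) = (0 :: ennreal)" for s
        by (auto simp: indicator_def rad_shift[OF v dim2])
      then have "(\<integral>\<^sup>+s. ?f (z + s *\<^sub>R v) \<partial>lborel) = 0"
        by simp
      moreover have "fiber_weight q z = 0"
        using False by (auto simp: fiber_weight_def indicator_def)
      ultimately show ?thesis by simp
    qed
  qed
  finally show ?thesis .
qed

definition up_cap :: "real \<Rightarrow> 'a set" where
  "up_cap \<kappa> = {z. z \<bullet> v \<ge> \<kappa> * rad v z}"

lemma up_cap_borel: "up_cap \<kappa> \<in> sets borel"
proof -
  have "{z\<in>space borel. z \<bullet> v \<ge> \<kappa> * rad v z} \<in> sets borel" by measurable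
  then show ?thesis by (simp add: up_cap_def)
qed

lemma fiber_point_in_up_cap: "rad v z > 0 \<Longrightarrow> fiber_point z t \<in> up_cap \<kappa> \<longleftrightarrow> \<kappa> \<le> t"
  unfolding up_cap_def mem_Collect_eq fiber_point_inner rad_fiber_point
  by (simp add: mult.commute[of \<kappa>])

text \<open>On each fibre both sets are up-sets, hence comparable; this is where star-shapedness about
  \<open>v\<close> enters.\<close>

lemma fiber_mass_correlation:
  assumes K: "K \<in> sets borel" and up: "\<And>z t. z \<in> K \<Longrightarrow> t \<ge> 0 \<Longrightarrow> z + t *\<^sub>R v \<in> K" and \<rho>: "rad v z > 0"
  shows "tail_mass DIM('a) \<kappa> * fiber_mass K z \<le> total_mass DIM('a) * fiber_mass (K \<inter> up_cap \<kappa>) z"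
proof -
  have tail: "tail_mass DIM('a) \<kappa> \<le> total_mass DIM('a)"
    unfolding tail_mass_def total_mass_def by (rule nn_integral_mono) (auto simp: indicator_def)
  have fm: "fiber_mass A z \<le> total_mass DIM('a)" for A
    unfolding fiber_mass_def total_mass_def by (rule nn_integral_mono) (auto simp: indicator_def)
  show ?thesis
  \<comment> \<open>A fibre of \<open>K\<close> that starts at or above \<kappa> loses nothing to
    the cap, and one that reaches below \<kappa> contains the whole tail. Either way the share in
    the cap is at least that of the tail.\<close>
  proof (cases "\<exists>t<\<kappa>. fiber_point z t \<in> K")
    case False
    then have "indicator K (fiber_point z t) = (indicator (K \<inter> up_cap \<kappa>) (fiber_point z t) :: ennreal)" for t
      using fiber_point_in_up_cap[OF \<rho>, of t \<kappa>] by (auto simp: indicator_def not_less)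
    then have "fiber_mass K z = fiber_mass (K \<inter> up_cap \<kappa>) z"
      unfolding fiber_mass_def by simp
    then show ?thesis
      using tail by (simp add: mult_right_mono)
  next
    case True
    then obtain t0 where t0: "t0 < \<kappa>" "fiber_point z t0 \<in> K" by blast
    have "fiber_point z t \<in> K" if "t \<ge> \<kappa>" for t
    proof -
      have "fiber_point z t = fiber_point z t0 + (rad v z * (t - t0)) *\<^sub>R v"
        by (simp add: fiber_point_def right_diff_distrib scaleR_diff_left)
      then show ?thesis
        using up[OF t0(2), of "rad v z * (t - t0)"] \<rho> t0(1) that by simp
    qed
    then have "indicator (K \<inter> up_cap \<kappa>) (fiber_point z t) = (indicator {\<kappa>..} t :: ennreal)" for t
      using fiber_point_in_up_cap[OF \<rho>, of t \<kappa>] by (auto simp: indicator_def)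
    then have "fiber_mass (K \<inter> up_cap \<kappa>) z = tail_mass DIM('a) \<kappa>"
      unfolding fiber_mass_def tail_mass_def by simp
    then show ?thesis
      using fm[of K] by (simp add: mult.commute mult_right_mono)
  qed
qed

lemma radial_correlation:
  assumes K: "K \<in> sets borel" and up: "\<And>z t. z \<in> K \<Longrightarrow> t \<ge> 0 \<Longrightarrow> z + t *\<^sub>R v \<in> K"
  shows "tail_mass DIM('a) \<kappa> * emeasure radial {z\<in>K. 1 < rad v z \<and> rad v z \<le> q} \<le>
    total_mass DIM('a) * emeasure radial {z\<in>K \<inter> up_cap \<kappa>. 1 < rad v z \<and> rad v z \<le> q}"
proof -
  have KC: "K \<inter> up_cap \<kappa> \<in> sets borel"
    using K up_cap_borel by (rule sets.Int)
  note [measurable] = fiber_mass_measurable[OF K] fiber_mass_measurable[OF KC]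
  have "tail_mass DIM('a) \<kappa> * (\<integral>\<^sup>+z. fiber_weight q z * fiber_mass K z \<partial>lborel) =
      (\<integral>\<^sup>+z. tail_mass DIM('a) \<kappa> * (fiber_weight q z * fiber_mass K z) \<partial>lborel)"
    by (rule nn_integral_cmult[symmetric]) simp
  also have "\<dots> \<le> (\<integral>\<^sup>+z. total_mass DIM('a) * (fiber_weight q z * fiber_mass (K \<inter> up_cap \<kappa>) z) \<partial>lborel)"
  proof (rule nn_integral_mono)
    fix z
    show "tail_mass DIM('a) \<kappa> * (fiber_weight q z * fiber_mass K z) \<le>
        total_mass DIM('a) * (fiber_weight q z * fiber_mass (K \<inter> up_cap \<kappa>) z)"
    proof (cases "rad v z > 0")
      case True
      then show ?thesis
        using mult_left_mono[OF fiber_mass_correlation[OF K up True, of \<kappa>], of "fiber_weight q z"]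
        by (simp add: mult_ac)
    next
      case False
      then show ?thesis by (simp add: fiber_weight_def indicator_def)
    qed
  qed
  also have "\<dots> = total_mass DIM('a) * (\<integral>\<^sup>+z. fiber_weight q z * fiber_mass (K \<inter> up_cap \<kappa>) z \<partial>lborel)"
    by (rule nn_integral_cmult) simp
  finally show ?thesis
    unfolding radial_fibers[OF K] radial_fibers[OF KC] .
qed

text \<open>For the whole space every fibre has the full mass, and the weight is at most 1 because
  \<open>rad v z > 1\<close> on the shell. What remains is the volume between two cylinders of
  height 1.\<close>

lemma radial_total_le:
  assumes q: "q > 1"
  shows "emeasure radial {z. 1 < rad v z \<and> rad v z \<le> q} \<le>
    total_mass DIM('a) * ennreal (unit_ball_vol (real (DIM('a) - 1)) * (q ^ (DIM('a) - 1) - 1))"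
proof -
  let ?n = "DIM('a) - 1"
  have cyl: "cylinder {} v 1 (1/2) r = {z. \<bar>z \<bullet> v\<bar> \<le> 1/2 \<and> rad v z \<le> r}" if "r > 0" for r
  proof -
    have "(norm z)\<^sup>2 - (z \<bullet> v)\<^sup>2 \<le> r\<^sup>2 \<longleftrightarrow> rad v z \<le> r" for z
    proof -
      have "(norm z)\<^sup>2 - (z \<bullet> v)\<^sup>2 = (rad v z)\<^sup>2"
        unfolding norm_rad[OF v dim2] by simp
      then show ?thesis
        using that abs_le_square_iff[of "rad v z" r] by (simp add: rad_def)
    qed
    then show ?thesis
      unfolding cylinder_def by simp
  qed
  have vol: "emeasure lborel {z. \<bar>z \<bullet> v\<bar> \<le> 1/2 \<and> rad v z \<le> r} = ennreal (unit_ball_vol (real ?n) * r ^ ?n)" if "r > 0" for r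
    using emeasure_cylinder[of "{}" v 1 "1/2" r] v that unfolding cyl[OF that] by simp
  have m: "{z. \<bar>z \<bullet> v\<bar> \<le> 1/2 \<and> rad v z \<le> r} \<in> sets borel" for r
  proof -
    have "{z\<in>space borel. \<bar>z \<bullet> v\<bar> \<le> 1/2 \<and> rad v z \<le> r} \<in> sets borel" by measurable
    then show ?thesis by simp
  qed
  let ?S = "{z. \<bar>z \<bullet> v\<bar> \<le> 1/2 \<and> rad v z \<le> q} - {z. \<bar>z \<bullet> v\<bar> \<le> 1/2 \<and> rad v z \<le> 1}"
  have Sm: "?S \<in> sets borel" using m by (intro sets.Diff)
  have "emeasure radial {z\<in>UNIV. 1 < rad v z \<and> rad v z \<le> q} = (\<integral>\<^sup>+z. fiber_weight q z * fiber_mass UNIV z \<partial>lborel)"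
    by (rule radial_fibers) simp
  also have "\<dots> \<le> (\<integral>\<^sup>+z. total_mass DIM('a) * indicator ?S z \<partial>lborel)"
  proof (rule nn_integral_mono)
    fix z
    have t: "fiber_mass UNIV z = total_mass DIM('a)"
      by (simp add: fiber_mass_def total_mass_def)
    have "fiber_weight q z \<le> indicator ?S z"
    proof (cases "\<bar>z \<bullet> v\<bar> \<le> 1/2 \<and> 1 < rad v z \<and> rad v z \<le> q")
      case True
      have "rad v z ^ 1 \<le> rad v z ^ DIM('a)"
        using True dim2 by (intro power_increasing) auto
      then have "rad v z * inverse (rad v z ^ DIM('a)) \<le> 1"
        using True by (simp add: field_simps)
      then show ?thesis
        using True by (simp add: fiber_weight_def indicator_def ennreal_le_1)
    next
      case False
      then show ?thesis by (auto simp: fiber_weight_def indicator_def)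
    qed
    then show "fiber_weight q z * fiber_mass UNIV z \<le> total_mass DIM('a) * indicator ?S z"
      unfolding t by (subst mult.commute) (rule mult_left_mono, auto)
  qed
  also have "\<dots> = total_mass DIM('a) * emeasure lborel ?S"
    using Sm by (intro nn_integral_cmult_indicator) simp
  also have "emeasure lborel ?S = emeasure lborel {z. \<bar>z \<bullet> v\<bar> \<le> 1/2 \<and> rad v z \<le> q} - emeasure lborel {z. \<bar>z \<bullet> v\<bar> \<le> 1/2 \<and> rad v z \<le> 1}"
    using m vol[of 1] q by (intro emeasure_Diff) auto
  also have "\<dots> = ennreal (unit_ball_vol (real ?n) * q ^ ?n) - ennreal (unit_ball_vol (real ?n) * 1 ^ ?n)"
  proof -
    have "q > 0" using q by simp
    show ?thesis
      unfolding vol[OF \<open>q > 0\<close>] vol[OF zero_less_one] ..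
  qed
  also have "\<dots> = ennreal (unit_ball_vol (real ?n) * (q ^ ?n - 1))"
    by (subst ennreal_minus) (simp_all add: right_diff_distrib)
  finally show ?thesis by simp
qed

end

section \<open>Thin shells of cones\<close>

lemma tendsto_power_at_right_1: "((\<lambda>q::real. q ^ k) \<longlongrightarrow> 1) (at_right 1)"
proof -
  have "((\<lambda>q::real. q ^ k) \<longlongrightarrow> 1 ^ k) (at_right 1)"
    by (intro tendsto_intros)
  then show ?thesis by simp
qed

text \<open>Estimates on the shell from 1 to q lose a power of q, which disappears as q tends to
  1.\<close>

lemma le_of_power_bound:
  fixes a b :: real
  assumes "\<And>q. q > 1 \<Longrightarrow> a \<le> b * q ^ k"
  shows "a \<le> b"
proof (rule tendsto_lowerbound)
  have "((\<lambda>q. b * q ^ k) \<longlongrightarrow> b * 1) (at_right 1)"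
    by (intro tendsto_mult tendsto_const tendsto_power_at_right_1)
  then show "((\<lambda>q. b * q ^ k) \<longlongrightarrow> b) (at_right 1)"
    by simp
  show "\<forall>\<^sub>F q in at_right 1. a \<le> b * q ^ k"
    by (rule eventually_at_rightI[of 1 2]) (use assms in auto)
qed simp

lemma measure_cone_shell:
  fixes K :: "'a::euclidean_space set"
  assumes K: "K \<in> sets borel" and cone: "\<And>z t. z \<in> K \<Longrightarrow> t > 0 \<Longrightarrow> t *\<^sub>R z \<in> K" and q: "q > 1"
  shows "emeasure lborel {z\<in>K. 1 < norm z \<and> norm z \<le> q} = ennreal ((q ^ DIM('a) - 1) * measure lborel (K \<inter> cball 0 1))"
proof -
  have Kc: "c *\<^sub>R z \<in> K \<longleftrightarrow> z \<in> K" if "c > 0" for c z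
    using cone that by (rule cone_scale_iff)
  have b: "K \<inter> cball 0 r \<in> sets borel" for r
    using K by (intro sets.Int) auto
  have fin: "emeasure lborel (K \<inter> cball 0 r) < \<infinity>" for r
    using emeasure_bounded_finite[of "K \<inter> cball 0 r"] by (simp add: bounded_Int)
  have "emeasure lborel (K \<inter> cball 0 q) = (\<integral>\<^sup>+z. indicator (K \<inter> cball 0 q) z \<partial>lborel)"
    using b by simp
  also have "\<dots> = ennreal (q ^ DIM('a)) * (\<integral>\<^sup>+z. indicator (K \<inter> cball 0 q) (q *\<^sub>R z) \<partial>lborel)"
    using b q by (intro nn_integral_lborel_scale) auto
  also have "(\<lambda>z. indicator (K \<inter> cball 0 q) (q *\<^sub>R z)) = (indicator (K \<inter> cball 0 1) :: 'a \<Rightarrow> ennreal)"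
  proof
    fix z
    have "q *\<^sub>R z \<in> K \<inter> cball 0 q \<longleftrightarrow> z \<in> K \<inter> cball 0 1"
      using Kc[of q z] q by simp
    then show "indicator (K \<inter> cball 0 q) (q *\<^sub>R z) = (indicator (K \<inter> cball 0 1) z :: ennreal)"
      by (simp only: indicator_def)
  qed
  also have "(\<integral>\<^sup>+z. indicator (K \<inter> cball 0 1) z \<partial>lborel) = emeasure lborel (K \<inter> cball 0 1)"
    using b by simp
  also have "\<dots> = ennreal (measure lborel (K \<inter> cball 0 1))"
    using fin[of 1] by (intro emeasure_eq_ennreal_measure) simp
  finally have Kq: "emeasure lborel (K \<inter> cball 0 q) = ennreal (q ^ DIM('a) * measure lborel (K \<inter> cball 0 1))"
    using q by (simp add: ennreal_mult')
  have "{z\<in>K. 1 < norm z \<and> norm z \<le> q} = (K \<inter> cball 0 q) - (K \<inter> cball 0 1)"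
    by auto
  also have "emeasure lborel \<dots> = emeasure lborel (K \<inter> cball 0 q) - emeasure lborel (K \<inter> cball 0 1)"
    using b fin[of 1] q by (intro emeasure_Diff) auto
  also have "\<dots> = ennreal (q ^ DIM('a) * measure lborel (K \<inter> cball 0 1)) - ennreal (measure lborel (K \<inter> cball 0 1))"
    unfolding Kq using fin[of 1] by (subst emeasure_eq_ennreal_measure[of lborel "K \<inter> cball 0 1"]) auto
  also have "\<dots> = ennreal ((q ^ DIM('a) - 1) * measure lborel (K \<inter> cball 0 1))"
    by (subst ennreal_minus) (simp_all add: left_diff_distrib)
  finally show ?thesis .
qed

context
  fixes v :: "'a::euclidean_space"
  assumes v: "norm v = 1" and dim2: "DIM('a) \<ge> 2"
begin

text \<open>The gauge swap replaces \<open>rad v\<close> by the norm, up to the axis, which is null.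
  On the shell \<open>1 < norm z \<le> q\<close> the density lies between q^(-N) and 1, where N is
  the dimension, and the volume of the shell is known.\<close>

lemma radial_cone_bounds:
  fixes K :: "'a set"
  assumes K: "K \<in> sets borel" and cone: "\<And>z t. z \<in> K \<Longrightarrow> t > 0 \<Longrightarrow> t *\<^sub>R z \<in> K" and q: "q > 1"
  shows "emeasure radial {z\<in>K. 1 < rad v z \<and> rad v z \<le> q} \<le> ennreal ((q ^ DIM('a) - 1) * measure lborel (K \<inter> cball 0 1))"
    and "ennreal (inverse (q ^ DIM('a)) * ((q ^ DIM('a) - 1) * measure lborel (K \<inter> cball 0 1))) \<le>
      emeasure radial {z\<in>K. 1 < rad v z \<and> rad v z \<le> q}"
proof -
  have [measurable]: "K \<in> sets borel" by (rule K)
  let ?T = "{z\<in>K. 1 < norm z \<and> norm z \<le> q}" and ?T' = "{z\<in>K. 1 < norm z \<and> norm z \<le> q \<and> 0 < rad v z}"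
  have "{z\<in>space borel. z \<in> K \<and> 1 < norm z \<and> norm z \<le> q} \<in> sets borel"
    "{z\<in>space borel. z \<in> K \<and> 1 < norm z \<and> norm z \<le> q \<and> 0 < rad v z} \<in> sets borel"
    by measurable
  then have T: "?T \<in> sets borel" "?T' \<in> sets borel"
    by simp_all
  have swap: "emeasure radial {z\<in>K. 1 < rad v z \<and> rad v z \<le> q} = emeasure radial ?T'"
  proof -
    have "{z\<in>K. 1 < rad v z \<and> rad v z \<le> q} = {z\<in>K. 1 < rad v z \<and> rad v z \<le> q \<and> 0 < norm z}"
      using rad_le_norm[OF v dim2] by (auto simp: rad_def)
    moreover have "(norm :: 'a \<Rightarrow> real) \<in> borel_measurable borel"
      by measurable
    ultimately show ?thesis
      using radial_gauge_swap[OF K cone rad_measurable[of v] rad_scale _ _ q, of norm]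
      by simp
  qed
  have T'T: "emeasure lborel ?T' = emeasure lborel ?T"
  proof -
    have "?T' = ?T - {z. rad v z = 0}"
      by (auto simp: rad_def)
    then show ?thesis
      using emeasure_Diff_null_set[OF axis_null[OF v dim2], of ?T] T by simp
  qed
  have T'_vol: "emeasure lborel ?T' = ennreal ((q ^ DIM('a) - 1) * measure lborel (K \<inter> cball 0 1))"
    unfolding T'T by (rule measure_cone_shell[OF K cone q])
  have "emeasure radial ?T' \<le> (\<integral>\<^sup>+z. indicator ?T' z \<partial>lborel)"
    unfolding emeasure_radial[OF T(2)]
  proof (rule nn_integral_mono)
    fix z
    have "inverse (norm z ^ DIM('a)) \<le> 1" if "z \<in> ?T'"
      using that by (intro inverse_le_1_iff[THEN iffD2] disjI2 one_le_power) simp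
    then show "ennreal (inverse (norm z ^ DIM('a))) * indicator ?T' z \<le> indicator ?T' z"
      by (cases "z \<in> ?T'") (simp_all add: ennreal_le_1)
  qed
  then show "emeasure radial {z\<in>K. 1 < rad v z \<and> rad v z \<le> q} \<le> ennreal ((q ^ DIM('a) - 1) * measure lborel (K \<inter> cball 0 1))"
    unfolding swap using T by (simp add: T'_vol)
  have "ennreal (inverse (q ^ DIM('a))) * emeasure lborel ?T' = (\<integral>\<^sup>+z. ennreal (inverse (q ^ DIM('a))) * indicator ?T' z \<partial>lborel)"
    using T by (intro nn_integral_cmult_indicator[symmetric]) simp
  also have "\<dots> \<le> emeasure radial ?T'"
    unfolding emeasure_radial[OF T(2)]
  proof (rule nn_integral_mono)
    fix z
    have "inverse (q ^ DIM('a)) \<le> inverse (norm z ^ DIM('a))" if "z \<in> ?T'"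
    proof -
      have "0 < norm z"
        using that by auto
      then show ?thesis
        using that by (intro le_imp_inverse_le power_mono zero_less_power) auto
    qed
    then show "ennreal (inverse (q ^ DIM('a))) * indicator ?T' z \<le> ennreal (inverse (norm z ^ DIM('a))) * indicator ?T' z"
      by (cases "z \<in> ?T'") (simp_all add: ennreal_leI)
  qed
  finally show "ennreal (inverse (q ^ DIM('a)) * ((q ^ DIM('a) - 1) * measure lborel (K \<inter> cball 0 1))) \<le>
      emeasure radial {z\<in>K. 1 < rad v z \<and> rad v z \<le> q}"
    unfolding swap T'_vol using q by (simp add: ennreal_mult')
qed

lemma total_mass_real: "total_mass DIM('a) = ennreal (enn2real (total_mass DIM('a)))"
  using tail_mass_finite[OF dim2] by (simp add: total_mass_eq)

text \<open>The thin-shell estimates for the whole space are compared to first order as q tends to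
  1. The total mass enters the final bound through a loss of \<alpha> divided by it, so it has to be
  bounded from below.\<close>

lemma total_mass_ge:
  "real DIM('a) * unit_ball_vol (real DIM('a)) \<le>
    enn2real (total_mass DIM('a)) * (real (DIM('a) - 1) * unit_ball_vol (real (DIM('a) - 1)))"
proof -
  let ?N = "DIM('a)" and ?n = "DIM('a) - 1" and ?j = "enn2real (total_mass DIM('a))"
  have ball: "measure lborel (UNIV \<inter> cball (0::'a) 1) = unit_ball_vol (real ?N)"
    using content_cball[of 1 "0::'a"] by simp
  have "real ?N * unit_ball_vol (real ?N) \<le> (?j * (real ?n * unit_ball_vol (real ?n))) * q ^ (?n - 1 + ?N)"
    if q: "q > 1" for q
  proof -
    have "ennreal (inverse (q ^ ?N) * ((q ^ ?N - 1) * unit_ball_vol (real ?N))) \<le>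
        emeasure radial {z\<in>UNIV. 1 < rad v z \<and> rad v z \<le> q}"
      using radial_cone_bounds(2)[OF _ _ q, of UNIV] unfolding ball by simp
    also have "\<dots> \<le> ennreal ?j * ennreal (unit_ball_vol (real ?n) * (q ^ ?n - 1))"
      using radial_total_le[OF v dim2 q] unfolding total_mass_real[symmetric] by simp
    also have "\<dots> = ennreal (?j * (unit_ball_vol (real ?n) * (q ^ ?n - 1)))"
      by (rule ennreal_mult'[symmetric]) simp
    finally have "inverse (q ^ ?N) * ((q ^ ?N - 1) * unit_ball_vol (real ?N)) \<le> ?j * (unit_ball_vol (real ?n) * (q ^ ?n - 1))"
      using q by (subst (asm) ennreal_le_iff) (auto intro!: mult_nonneg_nonneg)
    then have "(q ^ ?N - 1) * unit_ball_vol (real ?N) \<le> ?j * (unit_ball_vol (real ?n) * (q ^ ?n - 1)) * q ^ ?N"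
      using q by (simp add: field_simps)
    also have "\<dots> \<le> ?j * (unit_ball_vol (real ?n) * (real ?n * (q - 1) * q ^ (?n - 1))) * q ^ ?N"
      using q power_minus_one_le[of q ?n] by (intro mult_right_mono mult_left_mono) auto
    also have "\<dots> = (q - 1) * (?j * (real ?n * unit_ball_vol (real ?n)) * q ^ (?n - 1 + ?N))"
      by (simp only: power_add mult_ac)
    finally have "(q ^ ?N - 1) * unit_ball_vol (real ?N) \<le> (q - 1) * (?j * (real ?n * unit_ball_vol (real ?n)) * q ^ (?n - 1 + ?N))" .
    moreover have "(q - 1) * (real ?N * unit_ball_vol (real ?N)) \<le> (q ^ ?N - 1) * unit_ball_vol (real ?N)"
    proof -
      have "(real ?N * (q - 1)) * unit_ball_vol (real ?N) \<le> (q ^ ?N - 1) * unit_ball_vol (real ?N)"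
        using Bernoulli_inequality[of "q - 1" ?N] q by (intro mult_right_mono) auto
      then show ?thesis by (simp add: mult_ac)
    qed
    ultimately have "(q - 1) * (real ?N * unit_ball_vol (real ?N)) \<le> (q - 1) * (?j * (real ?n * unit_ball_vol (real ?n)) * q ^ (?n - 1 + ?N))"
      by linarith
    then show ?thesis
      using q by (simp only: mult_le_cancel_left_pos diff_gt_0_iff_gt)
  qed
  then show ?thesis
    by (rule le_of_power_bound)
qed

text \<open>With J the total mass of the profile, the share of the cap is at least the tail divided
  by J, the tail is at least J/2 - \<alpha>, and 1/J is at most the quotient of the two sphere
  areas.\<close>

lemma cone_cap_volume:
  fixes K :: "'a set"
  assumes K: "K \<in> sets borel" and cone: "\<And>z t. z \<in> K \<Longrightarrow> t > 0 \<Longrightarrow> t *\<^sub>R z \<in> K"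
    and up: "\<And>z t. z \<in> K \<Longrightarrow> t \<ge> 0 \<Longrightarrow> z + t *\<^sub>R v \<in> K" and \<alpha>: "0 < \<alpha>" "\<alpha> < pi / 2"
  shows "(1 / 2 - \<alpha> * (real (DIM('a) - 1) * unit_ball_vol (real (DIM('a) - 1))) / (real DIM('a) * unit_ball_vol (real DIM('a)))) *
      measure lborel (K \<inter> cball 0 1) \<le> measure lborel (K \<inter> up_cap v (tan \<alpha>) \<inter> cball 0 1)"
proof -
  let ?N = "DIM('a)" and ?n = "DIM('a) - 1"
  define j where "j = enn2real (total_mass ?N)"
  define t where "t = enn2real (tail_mass ?N (tan \<alpha>))"
  define x where "x = measure lborel (K \<inter> up_cap v (tan \<alpha>) \<inter> cball 0 1)"
  define y where "y = measure lborel (K \<inter> cball 0 1)"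
  let ?C = "K \<inter> up_cap v (tan \<alpha>)"
  have C: "?C \<in> sets borel"
    using K up_cap_borel[OF v dim2] by (rule sets.Int)
  have coneC: "s *\<^sub>R z \<in> ?C" if "z \<in> ?C" "s > 0" for z s
  proof -
    have "s * (tan \<alpha> * rad v z) \<le> s * (z \<bullet> v)"
      using that unfolding up_cap_def[OF v dim2] by (intro mult_left_mono) auto
    then show ?thesis
      using that cone[of z s] unfolding up_cap_def[OF v dim2] by (simp add: rad_scale mult_ac)
  qed
  have jt: "total_mass ?N = ennreal j"
    unfolding j_def by (rule total_mass_real)
  have "tail_mass ?N (tan \<alpha>) \<le> total_mass ?N"
    unfolding tail_mass_def total_mass_def by (rule nn_integral_mono) (auto simp: indicator_def)
  then have tt: "tail_mass ?N (tan \<alpha>) = ennreal t"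
    unfolding t_def jt by (metis ennreal_enn2real ennreal_less_top order_le_less_trans)
  have j0: "j \<ge> 0" and t0: "t \<ge> 0" and x0: "x \<ge> 0" and y0: "y \<ge> 0"
    by (simp_all add: j_def t_def x_def y_def)
  \<comment> \<open>By symmetry half of the total mass lies above 0, and at most \<alpha> of this
    half lies below \<open>tan \<alpha>\<close>.\<close>
  have jt2: "j / 2 \<le> t + \<alpha>"
  proof -
    obtain h where h: "tail_mass ?N 0 = ennreal h" "h \<ge> 0"
      using tail_mass_finite[OF dim2] by (cases "tail_mass ?N 0") auto
    have "ennreal j = ennreal (h + h)"
      using total_mass_eq[of ?N] unfolding jt h(1) ennreal_plus[OF h(2) h(2)] .
    then have "j = h + h"
      using j0 h(2) by simp
    moreover have "h \<le> t + \<alpha>"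
      using tail_mass_diff[OF dim2 \<alpha>] h(2) t0 \<alpha> unfolding tt h(1) by (simp flip: ennreal_plus)
    ultimately show ?thesis by simp
  qed
  have "t * y \<le> j * x * q ^ ?N" if q: "q > 1" for q
  proof -
    have q1: "q ^ ?N > 1"
      using q by (intro one_less_power) auto
    have "ennreal t * ennreal (inverse (q ^ ?N) * ((q ^ ?N - 1) * y)) \<le>
        tail_mass ?N (tan \<alpha>) * emeasure radial {z\<in>K. 1 < rad v z \<and> rad v z \<le> q}"
      unfolding tt y_def by (intro mult_left_mono radial_cone_bounds(2)[OF K cone q]) auto
    also have "\<dots> \<le> total_mass ?N * emeasure radial {z\<in>?C. 1 < rad v z \<and> rad v z \<le> q}"
      by (rule radial_correlation[OF v dim2 K up])
    also have "\<dots> \<le> ennreal j * ennreal ((q ^ ?N - 1) * x)"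
      unfolding jt x_def by (intro mult_left_mono radial_cone_bounds(1)[OF C coneC q]) auto
    finally have "ennreal (t * (inverse (q ^ ?N) * ((q ^ ?N - 1) * y))) \<le> ennreal (j * ((q ^ ?N - 1) * x))"
      using t0 j0 by (simp add: ennreal_mult')
    then have "t * (inverse (q ^ ?N) * ((q ^ ?N - 1) * y)) \<le> j * ((q ^ ?N - 1) * x)"
      using j0 x0 q1 by (subst (asm) ennreal_le_iff) (auto intro!: mult_nonneg_nonneg)
    then have "q ^ ?N * (t * (inverse (q ^ ?N) * ((q ^ ?N - 1) * y))) \<le> q ^ ?N * (j * ((q ^ ?N - 1) * x))"
      using q1 by (intro mult_left_mono) auto
    moreover have "q ^ ?N * (t * (inverse (q ^ ?N) * ((q ^ ?N - 1) * y))) = (q ^ ?N - 1) * (t * y)"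
      using q by simp
    moreover have "q ^ ?N * (j * ((q ^ ?N - 1) * x)) = (q ^ ?N - 1) * (j * x * q ^ ?N)"
      by (simp only: mult_ac)
    ultimately have "(q ^ ?N - 1) * (t * y) \<le> (q ^ ?N - 1) * (j * x * q ^ ?N)"
      by simp
    then show ?thesis
      using q1 by (simp only: mult_le_cancel_left_pos diff_gt_0_iff_gt)
  qed
  then have tx: "t * y \<le> j * x"
    by (rule le_of_power_bound)
  define a where "a = real ?n * unit_ball_vol (real ?n)"
  define b where "b = real ?N * unit_ball_vol (real ?N)"
  have a0: "a > 0" and b0: "b > 0"
    using dim2 by (simp_all add: a_def b_def)
  have bj: "b \<le> j * a"
    unfolding a_def b_def j_def by (rule total_mass_ge)
  then have jpos: "j > 0"
    using a0 b0 j0 by (metis less_eq_real_def mult_zero_left not_less)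
  have "(j / 2 - \<alpha>) * y \<le> t * y"
    using jt2 y0 by (intro mult_right_mono) auto
  then have "(j / 2 - \<alpha>) * y \<le> j * x"
    using tx by linarith
  then have "(1 / 2 - \<alpha> / j) * y \<le> x"
    using jpos by (simp add: field_simps)
  moreover have "(1 / 2 - \<alpha> * a / b) * y \<le> (1 / 2 - \<alpha> / j) * y"
  proof (rule mult_right_mono[OF _ y0])
    have "\<alpha> * b \<le> \<alpha> * (j * a)"
      using bj \<alpha> by (intro mult_left_mono) auto
    then have "\<alpha> / j \<le> \<alpha> * a / b"
      using jpos b0 by (simp add: field_simps)
    then show "1 / 2 - \<alpha> * a / b \<le> 1 / 2 - \<alpha> / j" by simp
  qed
  ultimately show ?thesis
    unfolding a_def b_def x_def y_def by linarith
qed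

end

subsection \<open>Normal cones\<close>

text \<open>The set is the projection of a compact set of pairs (y, \<nu>), since all conditions on
  such a pair are closed. Measurability and the lower bound for the Hausdorff measure rest on
  this.\<close>

lemma compact_NA:
  fixes X :: "'a::euclidean_space set"
  assumes X: "compact X" and cont: "continuous_on X \<sigma>"
  shows "compact (NA \<alpha> X \<sigma>)"
proof -
  let ?P = "X \<times> sphere (0::'a) 1"
  have P: "compact ?P"
    using X by (intro compact_Times) auto
  have fs: "continuous_on ?P fst" "continuous_on ?P snd"
    by (intro continuous_intros)+
  have cs: "continuous_on ?P (\<lambda>p. \<sigma> (fst p))"
    by (rule continuous_on_compose2[OF cont fs(1)]) auto
  have "closed {p\<in>?P. sin \<alpha> \<le> \<sigma> (fst p) \<bullet> snd p}"
    using cs fs P by (intro continuous_on_closed_Collect_le continuous_intros) (auto simp: compact_imp_closed)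
  moreover have "closed (\<Inter>x\<in>X. {p. snd p \<bullet> (x - fst p) \<le> 0} :: ('a \<times> 'a) set)"
    by (intro closed_INT ballI closed_Collect_le continuous_intros)
  ultimately have "closed ({p\<in>?P. sin \<alpha> \<le> \<sigma> (fst p) \<bullet> snd p} \<inter> (\<Inter>x\<in>X. {p. snd p \<bullet> (x - fst p) \<le> 0}))"
    by (rule closed_Int)
  then have "compact (?P \<inter> ({p\<in>?P. sin \<alpha> \<le> \<sigma> (fst p) \<bullet> snd p} \<inter> (\<Inter>x\<in>X. {p. snd p \<bullet> (x - fst p) \<le> 0})))"
    by (rule compact_Int_closed[OF P])
  then have "compact (snd ` (?P \<inter> ({p\<in>?P. sin \<alpha> \<le> \<sigma> (fst p) \<bullet> snd p} \<inter> (\<Inter>x\<in>X. {p. snd p \<bullet> (x - fst p) \<le> 0}))))"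
    by (intro compact_continuous_image continuous_on_snd continuous_on_id)
  also have "snd ` (?P \<inter> ({p\<in>?P. sin \<alpha> \<le> \<sigma> (fst p) \<bullet> snd p} \<inter> (\<Inter>x\<in>X. {p. snd p \<bullet> (x - fst p) \<le> 0}))) = NA \<alpha> X \<sigma>"
    unfolding NA_def normal_cone_alpha_def normal_cone_def by force
  finally show ?thesis .
qed

lemma NA_subset_sphere: "NA \<alpha> X \<sigma> \<subseteq> subsphere {}"
  unfolding NA_def normal_cone_alpha_def normal_cone_def subsphere_def by auto

definition dual_cone :: "'a::euclidean_space set \<Rightarrow> 'a \<Rightarrow> 'a set" where
  "dual_cone X y = {z. \<forall>x\<in>X. z \<bullet> (x - y) \<le> 0}"

lemma closed_dual_cone: "closed (dual_cone X y)"
proof -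
  have "dual_cone X y = (\<Inter>x\<in>X. {z. z \<bullet> (x - y) \<le> 0})"
    unfolding dual_cone_def by auto
  then show ?thesis
    by (auto intro!: closed_INT closed_Collect_le continuous_intros)
qed

lemma dual_cone_scale: "z \<in> dual_cone X y \<Longrightarrow> t \<ge> 0 \<Longrightarrow> t *\<^sub>R z \<in> dual_cone X y"
  by (simp add: dual_cone_def mult_nonneg_nonpos)

lemma dual_cone_add: "z \<in> dual_cone X y \<Longrightarrow> w \<in> dual_cone X y \<Longrightarrow> z + w \<in> dual_cone X y"
  by (simp add: dual_cone_def inner_add_left add_nonpos_nonpos)

text \<open>The fibre computation describes the cap by the slope \<open>tan \<alpha>\<close>, the
  normal cone by \<open>sin \<alpha>\<close>; squaring and sin^2 + cos^2 = 1 lead from one to the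
  other.\<close>

lemma up_cap_sin:
  fixes v :: "'a::euclidean_space"
  assumes v: "norm v = 1" and dim2: "DIM('a) \<ge> 2" and \<alpha>: "0 < \<alpha>" "\<alpha> < pi / 2"
    and z: "z \<in> up_cap v (tan \<alpha>)"
  shows "v \<bullet> z \<ge> sin \<alpha> * norm z"
proof -
  have c: "cos \<alpha> > 0" and s: "sin \<alpha> > 0"
    using \<alpha> by (auto intro: cos_gt_zero sin_gt_zero2)
  have 1: "tan \<alpha> * rad v z \<le> z \<bullet> v"
    using z unfolding up_cap_def[OF v dim2] by simp
  then have 2: "sin \<alpha> * rad v z \<le> cos \<alpha> * (z \<bullet> v)"
    using c by (simp add: tan_def field_simps)
  have r0: "rad v z \<ge> 0" by (simp add: rad_def)
  then have zv: "z \<bullet> v \<ge> 0"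
    using 2 c s by (metis mult_nonneg_nonneg order_trans less_imp_le zero_le_mult_iff not_less)
  have "(sin \<alpha> * norm z)\<^sup>2 = (sin \<alpha>)\<^sup>2 * (z \<bullet> v)\<^sup>2 + (sin \<alpha> * rad v z)\<^sup>2"
    by (simp add: power_mult_distrib norm_rad[OF v dim2] distrib_left)
  also have "\<dots> \<le> (sin \<alpha>)\<^sup>2 * (z \<bullet> v)\<^sup>2 + (cos \<alpha> * (z \<bullet> v))\<^sup>2"
    using 2 s r0 by (intro add_left_mono power_mono) auto
  also have "\<dots> = ((sin \<alpha>)\<^sup>2 + (cos \<alpha>)\<^sup>2) * (z \<bullet> v)\<^sup>2"
    by (simp only: power_mult_distrib distrib_right)
  also have "\<dots> = (z \<bullet> v)\<^sup>2"
    unfolding sin_cos_squared_add by simp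
  finally have "sin \<alpha> * norm z \<le> z \<bullet> v"
    using zv by (rule power2_le_imp_le)
  then show ?thesis
    by (simp add: inner_commute)
qed

lemma NA_finite:
  fixes X :: "'a::euclidean_space set"
  assumes dim2: "DIM('a) \<ge> 2" and X: "finite X" "X \<noteq> {}"
    and sig: "\<And>y. y \<in> X \<Longrightarrow> \<sigma> y \<in> normal_cone X y" and \<alpha>: "0 < \<alpha>" "\<alpha> < pi / 2"
  shows "real DIM('a) * unit_ball_vol (real DIM('a)) / 2 - \<alpha> * (real (DIM('a) - 1) * unit_ball_vol (real (DIM('a) - 1))) \<le>
    smeasure {} (NA \<alpha> X \<sigma>)"
proof -
  let ?N = "DIM('a)"
  define a where "a = real (?N - 1) * unit_ball_vol (real (?N - 1))"
  define b where "b = real ?N * unit_ball_vol (real ?N)"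
  define c where "c = 1 / 2 - \<alpha> * a / b"
  have b0: "b > 0" by (simp add: b_def)
  have bc: "b / 2 - \<alpha> * a = b * c"
    using b0 by (simp add: c_def field_simps)
  show ?thesis
  \<comment> \<open>For negative \<open>c\<close> the claimed bound is not positive. Otherwise the
    covering inequality may be multiplied by \<open>c\<close>.\<close>
  proof (cases "c \<ge> 0")
    case False
    then have "b * c \<le> 0"
      using b0 by (simp add: mult_nonneg_nonpos)
    then show ?thesis
      using smeasure_nonneg[of "{}" "NA \<alpha> X \<sigma>"] bc unfolding a_def b_def by simp
  next
    case True
    define B where "B y = dual_cone X y \<inter> cball 0 1" for y
    define D where "D y = dual_cone X y \<inter> up_cap (\<sigma> y) (tan \<alpha>) \<inter> cball 0 1" for y
    have \<sigma>1: "norm (\<sigma> y) = 1" and \<sigma>K: "\<sigma> y \<in> dual_cone X y" if "y \<in> X" for y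
      using sig[OF that] by (auto simp: normal_cone_def dual_cone_def)
    have Kb: "dual_cone X y \<in> sets borel" for y
      by (rule borel_closed[OF closed_dual_cone])
    have fm: "A \<inter> cball 0 1 \<in> fmeasurable lborel" if "A \<in> sets borel" for A :: "'a set"
    proof (rule fmeasurableI)
      show "A \<inter> cball 0 1 \<in> sets lborel" using that by simp
      show "emeasure lborel (A \<inter> cball 0 1) < \<infinity>"
        by (rule emeasure_bounded_finite) (simp add: bounded_Int)
    qed
    have Bm: "B y \<in> fmeasurable lborel" for y
      unfolding B_def by (rule fm[OF Kb])
    have Dm: "D y \<in> fmeasurable lborel" if "y \<in> X" for y
      unfolding D_def by (intro fm sets.Int Kb up_cap_borel[OF \<sigma>1[OF that] dim2])
    have DU: "(\<Union>y\<in>X. D y) \<in> sets lborel"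
      by (rule sets.finite_UN[OF X(1) fmeasurableD[OF Dm]])
    \<comment> \<open>As a linear functional, \<open>z\<close> attains its maximum on the finite set
      at some \<open>y\<close>, which places \<open>z\<close> in the cone at
      \<open>y\<close>.\<close>
    have cover: "cball 0 1 \<subseteq> (\<Union>y\<in>X. B y)"
    proof
      fix z :: 'a assume z: "z \<in> cball 0 1"
      obtain y where y: "y \<in> X" "\<And>x. x \<in> X \<Longrightarrow> z \<bullet> x \<le> z \<bullet> y"
        using continuous_attains_sup[OF finite_imp_compact[OF X(1)] X(2), of "\<lambda>x. z \<bullet> x"]
          continuous_on_inner[OF continuous_on_const continuous_on_id] by blast
      then have "z \<in> B y"
        using z by (simp add: B_def dual_cone_def inner_diff_right)
      then show "z \<in> (\<Union>y\<in>X. B y)"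
        using y(1) by blast
    qed
    have "unit_ball_vol (real ?N) = measure lborel (cball (0::'a) 1)"
      using content_cball[of 1 "0::'a"] by simp
    also have "\<dots> \<le> measure lborel (\<Union>y\<in>X. B y)"
      using cover Bm X(1) by (intro measure_mono_fmeasurable fmeasurable.finite_UN) auto
    also have "\<dots> \<le> (\<Sum>y\<in>X. measure lborel (B y))"
      using Bm X(1) by (intro measure_UNION_le fmeasurableD)
    finally have 1: "unit_ball_vol (real ?N) \<le> (\<Sum>y\<in>X. measure lborel (B y))" .
    have "c * measure lborel (B y) \<le> measure lborel (D y)" if y: "y \<in> X" for y
      unfolding B_def D_def c_def a_def b_def
    proof (rule cone_cap_volume[OF \<sigma>1[OF y] dim2 Kb _ _ \<alpha>])
      show "t *\<^sub>R z \<in> dual_cone X y" if "z \<in> dual_cone X y" "t > 0" for z t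
        using dual_cone_scale[OF that(1)] that(2) by simp
      show "z + t *\<^sub>R \<sigma> y \<in> dual_cone X y" if "z \<in> dual_cone X y" "t \<ge> 0" for z t
        by (intro dual_cone_add dual_cone_scale that \<sigma>K y)
    qed
    then have "c * (\<Sum>y\<in>X. measure lborel (B y)) \<le> (\<Sum>y\<in>X. measure lborel (D y))"
      unfolding sum_distrib_left by (rule sum_mono)
    moreover have "c * unit_ball_vol (real ?N) \<le> c * (\<Sum>y\<in>X. measure lborel (B y))"
      using 1 True by (rule mult_left_mono)
    moreover have "(\<Sum>y\<in>X. measure lborel (D y)) = measure lborel (\<Union>y\<in>X. D y)"
    proof -
      have Dl: "D y \<in> lmeasurable" if "y \<in> X" for y
        using Dm[OF that] by (auto simp: fmeasurable_def)
      have "measure lebesgue (\<Union>(D ` X)) = (\<Sum>y\<in>X. measure lebesgue (D y))"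
      proof (rule measure_negligible_finite_Union_image[OF X(1) Dl])
        show "pairwise (\<lambda>x y. negligible (D x \<inter> D y)) X"
        proof (rule pairwiseI)
          fix x y assume xy: "x \<in> X" "y \<in> X" "x \<noteq> y"
          \<comment> \<open>A vector in two of the cones is maximal at both points and hence
            orthogonal to their difference.\<close>
          have "D x \<inter> D y \<subseteq> {z. (y - x) \<bullet> z = 0}"
          proof
            fix z assume "z \<in> D x \<inter> D y"
            then have "z \<bullet> (y - x) \<le> 0" "z \<bullet> (x - y) \<le> 0"
              using xy unfolding D_def dual_cone_def by blast+
            then show "z \<in> {z. (y - x) \<bullet> z = 0}"
              by (simp add: inner_diff_right inner_diff_left inner_commute)
          qed
          moreover have "negligible {z. (y - x) \<bullet> z = 0}"
            using xy by (intro negligible_hyperplane) simp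
          ultimately show "negligible (D x \<inter> D y)"
            by (rule negligible_subset[rotated])
        qed
      qed
      moreover have "measure lebesgue (D y) = measure lborel (D y)" if "y \<in> X" for y
        by (rule measure_completion[OF fmeasurableD[OF Dm[OF that]]])
      moreover have "measure lebesgue (\<Union>(D ` X)) = measure lborel (\<Union>(D ` X))"
        by (rule measure_completion[OF DU])
      ultimately show ?thesis by simp
    qed
    moreover have "measure lborel (\<Union>y\<in>X. D y) \<le> measure lborel (sector {} (NA \<alpha> X \<sigma>) 1)"
    proof -
      have NAb: "NA \<alpha> X \<sigma> \<in> sets borel"
        using compact_NA[of X \<sigma> \<alpha>] X(1) by (auto intro: borel_compact finite_imp_compact continuous_on_finite)
      have sec: "sector {} (NA \<alpha> X \<sigma>) 1 \<in> fmeasurable lborel"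
        by (rule sector_fmeasurable[OF _ NAb]) simp
      \<comment> \<open>The origin lies in every cone but has no direction on the sphere.\<close>
      have sub: "(\<Union>y\<in>X. D y) - {0} \<subseteq> sector {} (NA \<alpha> X \<sigma>) 1"
      proof
        fix z assume "z \<in> (\<Union>y\<in>X. D y) - {0}"
        then obtain y where y: "y \<in> X" "z \<in> D y" and z0: "z \<noteq> 0" by blast
        have s: "sgn z = inverse (norm z) *\<^sub>R z"
          by (rule sgn_div_norm)
        have "sgn z \<in> dual_cone X y"
          unfolding s using y(2) by (intro dual_cone_scale) (auto simp: D_def)
        moreover have "norm (sgn z) = 1"
          using z0 by (simp add: norm_sgn)
        ultimately have "sgn z \<in> normal_cone X y"
          by (simp add: normal_cone_def dual_cone_def)
        moreover have "sin \<alpha> * norm z \<le> \<sigma> y \<bullet> z"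
          using y(2) up_cap_sin[OF \<sigma>1[OF y(1)] dim2 \<alpha>] by (simp add: D_def)
        then have "sin \<alpha> \<le> \<sigma> y \<bullet> sgn z"
          unfolding s using z0 by (simp add: field_simps)
        ultimately have "sgn z \<in> NA \<alpha> X \<sigma>"
          using y(1) by (auto simp: NA_def normal_cone_alpha_def)
        then show "z \<in> sector {} (NA \<alpha> X \<sigma>) 1"
          using y(2) by (simp add: sector_def proj_def D_def)
      qed
      have "measure lborel (\<Union>y\<in>X. D y) = measure lborel ((\<Union>y\<in>X. D y) - {0})"
        by (intro measure_Diff_null_set[OF DU, symmetric]) (simp add: null_setsI)
      also have "\<dots> \<le> measure lborel (sector {} (NA \<alpha> X \<sigma>) 1)"
        by (rule measure_mono_fmeasurable[OF sub sets.Diff[OF DU] sec]) simp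
      finally show ?thesis .
    qed
    ultimately have "c * unit_ball_vol (real ?N) \<le> measure lborel (sector {} (NA \<alpha> X \<sigma>) 1)"
      by linarith
    then have "real ?N * (c * unit_ball_vol (real ?N)) \<le> real ?N * measure lborel (sector {} (NA \<alpha> X \<sigma>) 1)"
      by (rule mult_left_mono) simp
    moreover have "real ?N * (c * unit_ball_vol (real ?N)) = b * c"
      by (simp add: b_def)
    moreover have "smeasure {} (NA \<alpha> X \<sigma>) = real ?N * measure lborel (sector {} (NA \<alpha> X \<sigma>) 1)"
      by (simp add: smeasure_def codim_def)
    ultimately show ?thesis
      using bc unfolding a_def b_def by linarith
  qed
qed

text \<open>If \<nu> is normal to infinitely many of the finite sets, the base points accumulate at
  some \<open>l\<close> in \<open>X\<close>. The inequalities for each fixed point of the union pass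
  to the limit and extend to \<open>X\<close> by density; continuity of \<sigma> preserves the bound
  by \<open>sin \<alpha>\<close>.\<close>

lemma NA_limit:
  fixes X :: "'a::euclidean_space set"
  assumes X: "compact X" and cont: "continuous_on X \<sigma>"
    and sub: "\<And>k::nat. F k \<subseteq> X" and mono: "\<And>j k. j \<le> k \<Longrightarrow> F j \<subseteq> F k" and dense: "X \<subseteq> closure (\<Union>k. F k)"
    and \<nu>: "\<And>m::nat. \<exists>k\<ge>m. \<nu> \<in> NA \<alpha> (F k) \<sigma>"
  shows "\<nu> \<in> NA \<alpha> X \<sigma>"
proof -
  have "\<exists>y. y \<in> X \<and> (\<forall>x\<in>F m. \<nu> \<bullet> (x - y) \<le> 0) \<and> sin \<alpha> \<le> \<sigma> y \<bullet> \<nu> \<and> \<nu> \<in> sphere 0 1" for m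
  proof -
    obtain k where k: "k \<ge> m" "\<nu> \<in> NA \<alpha> (F k) \<sigma>" using \<nu> by blast
    then obtain y where "y \<in> F k" "\<forall>x\<in>F k. \<nu> \<bullet> (x - y) \<le> 0" "sin \<alpha> \<le> \<sigma> y \<bullet> \<nu>" "\<nu> \<in> sphere 0 1"
      unfolding NA_def normal_cone_alpha_def normal_cone_def by blast
    then show ?thesis
      using mono[OF k(1)] sub[of k] by blast
  qed
  then obtain y where y: "\<And>m. y m \<in> X" "\<And>m x. x \<in> F m \<Longrightarrow> \<nu> \<bullet> (x - y m) \<le> 0"
      "\<And>m. sin \<alpha> \<le> \<sigma> (y m) \<bullet> \<nu>" and \<nu>1: "\<nu> \<in> sphere 0 1"
    by metis
  obtain l r where l: "l \<in> X" "strict_mono r" "(y \<circ> r) \<longlonglongrightarrow> l"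
    using X y(1) unfolding compact_def by blast
  have lim: "(\<lambda>m. \<nu> \<bullet> (x - y (r m))) \<longlonglongrightarrow> \<nu> \<bullet> (x - l)" for x
    using l(3) unfolding comp_def by (intro tendsto_intros)
  have "\<nu> \<bullet> (x - l) \<le> 0" if x: "x \<in> (\<Union>k. F k)" for x
  proof -
    obtain k where k: "x \<in> F k" using x by blast
    have "\<nu> \<bullet> (x - y (r m)) \<le> 0" if "m \<ge> k" for m
    proof (rule y(2))
      have "k \<le> r m"
        using seq_suble[OF l(2), of m] that by simp
      then show "x \<in> F (r m)" using mono k by blast
    qed
    then show ?thesis
      by (intro LIMSEQ_le_const2[OF lim]) blast
  qed
  moreover have "closed {x. \<nu> \<bullet> (x - l) \<le> 0}"
    by (intro closed_Collect_le continuous_intros)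
  ultimately have "closure (\<Union>k. F k) \<subseteq> {x. \<nu> \<bullet> (x - l) \<le> 0}"
    by (intro closure_minimal) auto
  then have "\<forall>x\<in>X. \<nu> \<bullet> (x - l) \<le> 0"
    using dense by blast
  moreover have "sin \<alpha> \<le> \<sigma> l \<bullet> \<nu>"
  proof -
    have "(\<lambda>m. \<sigma> (y (r m))) \<longlonglongrightarrow> \<sigma> l"
      using continuous_on_tendsto_compose[OF cont l(3) l(1)] y(1) unfolding comp_def by simp
    then have "(\<lambda>m. \<sigma> (y (r m)) \<bullet> \<nu>) \<longlonglongrightarrow> \<sigma> l \<bullet> \<nu>"
      by (intro tendsto_intros)
    then show ?thesis
      by (rule LIMSEQ_le_const) (use y(3) in blast)
  qed
  ultimately show ?thesis
    using l(1) \<nu>1 unfolding NA_def normal_cone_alpha_def normal_cone_def by blast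
qed

text \<open>Adding points creates new cones and shrinks old ones, so the sets
  \<open>NA \<alpha> (F k) \<sigma>\<close> need not be monotone in \<open>k\<close>. Their limit
  superior is used instead: the tails \<open>G m\<close> decrease, each contains \<open>S m\<close>,
  and continuity of measure from above keeps the bound.\<close>

lemma NA_compact:
  fixes X :: "'a::euclidean_space set"
  assumes dim2: "DIM('a) \<ge> 2" and X: "compact X" "X \<noteq> {}" and cont: "continuous_on X \<sigma>"
    and sig: "\<And>y. y \<in> X \<Longrightarrow> \<sigma> y \<in> normal_cone X y" and \<alpha>: "0 < \<alpha>" "\<alpha> < pi / 2"
  shows "real DIM('a) * unit_ball_vol (real DIM('a)) / 2 - \<alpha> * (real (DIM('a) - 1) * unit_ball_vol (real (DIM('a) - 1))) \<le>
    smeasure {} (NA \<alpha> X \<sigma>)" (is "?c \<le> _")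
proof -
  obtain E where E: "countable E" "E \<subseteq> X" "X \<subseteq> closure E"
    using separable by metis
  have E0: "E \<noteq> {}"
    using E(3) X(2) by auto
  define F where "F k = from_nat_into E ` {..k}" for k
  have FE: "(\<Union>k. F k) = E"
  proof -
    have "(\<Union>k. F k) = range (from_nat_into E)"
      unfolding F_def by blast
    then show ?thesis
      using E0 E(1) by (simp add: range_from_nat_into)
  qed
  have F: "finite (F k)" "F k \<noteq> {}" "F k \<subseteq> X" for k
    using FE E(2) unfolding F_def by auto
  have Fmono: "F j \<subseteq> F k" if "j \<le> k" for j k
    using that unfolding F_def by auto
  \<comment> \<open>Fewer points impose fewer conditions, so the normal cones of the subset are
    larger.\<close>
  have nc: "\<sigma> y \<in> normal_cone (F k) y" if "y \<in> F k" for k y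
    using sig[of y] that F(3)[of k] unfolding normal_cone_def by blast
  define S where "S k = sector {} (NA \<alpha> (F k) \<sigma>) 1" for k
  define G where "G m = (\<Union>k\<in>{m..}. S k)" for m
  let ?N = "DIM('a)"
  have NAb: "NA \<alpha> (F k) \<sigma> \<in> sets borel" for k
    by (intro borel_compact compact_NA finite_imp_compact continuous_on_finite F)
  have Sb: "S k \<in> sets borel" for k
    unfolding S_def by (rule sector_borel[OF _ NAb]) simp
  have Gb: "G m \<in> sets borel" for m
    unfolding G_def using Sb by (intro sets.countable_UN') auto
  have Gsub: "G m \<subseteq> cball 0 1" for m
    unfolding G_def S_def sector_def proj_def by auto
  have Gf: "G m \<in> fmeasurable lborel" for m
  proof (rule fmeasurableI)
    show "G m \<in> sets lborel" using Gb by simp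
    show "emeasure lborel (G m) < \<infinity>"
      using Gsub bounded_subset[OF bounded_cball] by (intro emeasure_bounded_finite) blast
  qed
  have Gge: "?c \<le> real ?N * measure lborel (G m)" for m
  proof -
    have "?c \<le> smeasure {} (NA \<alpha> (F m) \<sigma>)"
      by (rule NA_finite[OF dim2 F(1,2) nc \<alpha>])
    also have "\<dots> = real ?N * measure lborel (S m)"
      by (simp add: smeasure_def codim_def S_def)
    also have "\<dots> \<le> real ?N * measure lborel (G m)"
      using Gf Sb by (intro mult_left_mono measure_mono_fmeasurable) (auto simp: G_def)
    finally show ?thesis .
  qed
  have "(\<lambda>m. measure lborel (G m)) \<longlonglongrightarrow> measure lborel (\<Inter>m. G m)"
  proof (rule Lim_measure_decseq)
    show "range G \<subseteq> sets lborel" using Gb by auto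
    show "decseq G"
      unfolding decseq_def G_def by force
    show "emeasure lborel (G i) \<noteq> \<infinity>" for i
      using Gf[of i] by (auto simp: fmeasurable_def)
  qed
  then have "(\<lambda>m. real ?N * measure lborel (G m)) \<longlonglongrightarrow> real ?N * measure lborel (\<Inter>m. G m)"
    by (intro tendsto_intros)
  then have "?c \<le> real ?N * measure lborel (\<Inter>m. G m)"
    by (rule LIMSEQ_le_const) (use Gge in blast)
  also have "\<dots> \<le> real ?N * measure lborel (sector {} (NA \<alpha> X \<sigma>) 1)"
  proof (intro mult_left_mono measure_mono_fmeasurable)
    show "(\<Inter>m. G m) \<in> sets lborel"
      using Gb by auto
    show "sector {} (NA \<alpha> X \<sigma>) 1 \<in> fmeasurable lborel"
      by (rule sector_fmeasurable) (auto intro: borel_compact compact_NA X cont)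
    show "(\<Inter>m. G m) \<subseteq> sector {} (NA \<alpha> X \<sigma>) 1"
    proof
      fix z assume z: "z \<in> (\<Inter>m. G m)"
      have "\<exists>k\<ge>m. sgn z \<in> NA \<alpha> (F k) \<sigma>" for m
      proof -
        have "z \<in> G m" using z by blast
        then show ?thesis
          unfolding G_def S_def sector_def proj_def by auto
      qed
      then have "sgn z \<in> NA \<alpha> X \<sigma>"
        using F(3) Fmono E(3) FE by (intro NA_limit[OF X(1) cont, of F]) auto
      moreover have "norm z \<le> 1"
        using z Gsub[of 0] by auto
      ultimately show "z \<in> sector {} (NA \<alpha> X \<sigma>) 1"
        by (simp add: sector_def proj_def)
    qed
  qed simp
  also have "\<dots> = smeasure {} (NA \<alpha> X \<sigma>)"
    by (simp add: smeasure_def codim_def)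
  finally show ?thesis .
qed

theorem theorem11p1:
  fixes X :: "'a::euclidean_space set" and \<sigma> :: "'a \<Rightarrow> 'a" and n :: nat
  assumes dim: "DIM('a) = n + 1" and n1: "n \<ge> 1"
    and X: "compact X" "X \<noteq> {}"
    and cont: "continuous_on X \<sigma>"
    and sig: "\<And>y. y \<in> X \<Longrightarrow> \<sigma> y \<in> normal_cone X y"
  shows "(\<forall>\<alpha>. 0 < \<alpha> \<and> \<alpha> < pi / 2 \<longrightarrow>
           hausdorff_measure n (NA \<alpha> X \<sigma>) \<ge>
             ennreal ((1 - (2 * enn2real (hausdorff_measure (n - 1) (equator :: 'a set))
                              / enn2real (hausdorff_measure n (sphere (0::'a) 1))) * \<alpha>) / 2)
             * hausdorff_measure n (sphere (0::'a) 1)) \<and>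
         hausdorff_measure n (NP X \<sigma>) \<ge> ennreal (1/2) * hausdorff_measure n (sphere (0::'a) 1)"
proof -
  define a where "a = real n * unit_ball_vol (real n)"
  define b where "b = real (n + 1) * unit_ball_vol (real (n + 1))"
  have a0: "a > 0" and b0: "b > 0"
    using n1 by (simp_all add: a_def b_def)
  have dim2: "DIM('a) \<ge> 2"
    using dim n1 by simp
  have cod0: "codim ({} :: 'a set) = n + 1"
    by (simp add: codim_def dim)
  have ne: "({} :: 'a set) \<noteq> Basis"
    using nonempty_Basis by metis
  have Hs: "hausdorff_measure n (sphere (0::'a) 1) = ennreal b"
  proof -
    have "sphere (0::'a) 1 = subsphere {}"
      by (auto simp: subsphere_def)
    then show ?thesis
      using hausdorff_measure_subsphere[OF _ ne] by (simp add: cod0 b_def)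
  qed
  define e :: 'a where "e = (SOME b. b \<in> Basis)"
  have e: "e \<in> Basis"
    unfolding e_def by (rule someI_ex) (use nonempty_Basis in blast)
  \<comment> \<open>For n = 1 the equator is a pair of points, and the formula gives 1 *
    unit_ball_vol 1 = 2.\<close>
  have He: "hausdorff_measure (n - 1) (equator :: 'a set) = ennreal a"
  proof -
    have "(equator :: 'a set) = subsphere {e}"
      by (auto simp: equator_def subsphere_def e_def)
    moreover have "codim {e} = n"
      using e by (simp add: codim_def dim)
    moreover have "{e} \<noteq> Basis"
      using dim n1 by (metis One_nat_def add_eq_self_zero card.empty card_insert_disjoint empty_iff finite.emptyI
          add.commute not_one_le_zero plus_1_eq_Suc)
    ultimately show ?thesis
      using hausdorff_measure_subsphere[of "{e}"] e by (simp add: a_def)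
  qed
  have low: "ennreal (b / 2 - \<alpha> * a) \<le> hausdorff_measure n (NA \<alpha> X \<sigma>)" if \<alpha>: "0 < \<alpha>" "\<alpha> < pi / 2" for \<alpha>
  proof -
    have "ennreal (b / 2 - \<alpha> * a) \<le> ennreal (smeasure {} (NA \<alpha> X \<sigma>))"
      using NA_compact[OF dim2 X cont sig \<alpha>] unfolding dim by (intro ennreal_leI) (simp add: a_def b_def)
    also have "\<dots> \<le> hausdorff_measure (codim ({} :: 'a set) - 1) (NA \<alpha> X \<sigma>)"
      using ne compact_imp_closed[OF compact_NA[OF X(1) cont]]
      by (intro smeasure_le_hausdorff_measure NA_subset_sphere) auto
    finally show ?thesis
      by (simp add: cod0)
  qed
  have "ennreal ((1 - (2 * a / b) * \<alpha>) / 2) * ennreal b \<le> hausdorff_measure n (NA \<alpha> X \<sigma>)"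
    if \<alpha>: "0 < \<alpha>" "\<alpha> < pi / 2" for \<alpha>
  proof -
    have "(1 - (2 * a / b) * \<alpha>) / 2 * b = b / 2 - \<alpha> * a"
      using b0 by (simp add: field_simps)
    \<comment> \<open>\<open>ennreal\<close> sends negative numbers to 0, so for large \<alpha> both
      sides vanish and the identity still holds.\<close>
    then have "ennreal ((1 - (2 * a / b) * \<alpha>) / 2) * ennreal b = ennreal (b / 2 - \<alpha> * a)"
      using b0 by (metis ennreal_mult'' less_imp_le)
    then show ?thesis
      using low[OF \<alpha>] by simp
  qed
  moreover have "ennreal (1 / 2) * ennreal b \<le> hausdorff_measure n (NP X \<sigma>)"
  proof (rule tendsto_upperbound)
    have "((\<lambda>\<alpha>. b / 2 - \<alpha> * a) \<longlongrightarrow> b / 2 - 0 * a) (at_right 0)"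
      by (intro tendsto_intros) simp
    then have "((\<lambda>\<alpha>. ennreal (b / 2 - \<alpha> * a)) \<longlongrightarrow> ennreal (b / 2)) (at_right 0)"
      by (intro tendsto_ennrealI) simp
    also have "ennreal (b / 2) = ennreal (1 / 2) * ennreal b"
      by (subst ennreal_mult'[symmetric]) simp_all
    finally show "((\<lambda>\<alpha>. ennreal (b / 2 - \<alpha> * a)) \<longlongrightarrow> ennreal (1 / 2) * ennreal b) (at_right 0)" .
    show "\<forall>\<^sub>F \<alpha> in at_right 0. ennreal (b / 2 - \<alpha> * a) \<le> hausdorff_measure n (NP X \<sigma>)"
    proof (rule eventually_at_rightI[of 0 "pi / 2"])
      fix \<alpha> :: real assume "\<alpha> \<in> {0<..<pi / 2}"
      then have \<alpha>: "0 < \<alpha>" "\<alpha> < pi / 2" by auto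
      then have "sin \<alpha> > 0" by (rule sin_gt_zero2)
      then have "NA \<alpha> X \<sigma> \<subseteq> NP X \<sigma>"
        unfolding NA_def NP_def normal_cone_alpha_def normal_cone_pos_def by force
      then show "ennreal (b / 2 - \<alpha> * a) \<le> hausdorff_measure n (NP X \<sigma>)"
        using low[OF \<alpha>] hausdorff_measure_mono order_trans by blast
    qed simp
  qed simp
  ultimately show ?thesis
    unfolding Hs He using a0 b0 by simp
qed

end
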